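(* Let $q\in L_1[0,1]$ be complex-valued with $\int_0^1 q(x)\,dx=0$, let $\beta\in\mathbb{C}$, $\beta\neq\pm1$, and let $T_1$ be the operator in $L_2[0,1]$ generated by $-y''+q(x)y$ and the boundary conditions $y'(0)+\beta y'(1)=0$, $y(0)-y(1)=0$. Put $s_k=\int_0^1 q(x)\sin 2\pi kx\,dx$ and $\gamma_1=\dfrac{16\pi(\beta+1)}{\beta-1}$. If $$\lim_{n\to\infty}\frac{\ln|n|}{n\,s_{2n}}=0,$$ then the large eigenvalues $\lambda_{n,j}$ of $T_1$ are simple and satisfy the asymptotic formulas $$\lambda_{n,j}=(2\pi n)^2+(-1)^j\frac{\sqrt{2\gamma_1}}{2}\sqrt{n s_{2n}}\,(1+o(1))$$ for $j=1,2$. Moreover, if there exists a sequence $\{n_k\}$ of positive integers with $n_k\to\infty$ such that $\lim_{k\to\infty}\dfrac{\ln|n_k|}{n_k\,s_{2n_k}}=0$, then the root functions of $T_1$ do not form a Riesz basis in $L_2[0,1]$.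
   Context: The eigenvalues of $T_1$ consist of two sequences $\{\lambda_{n,1}\},\{\lambda_{n,2}\}$ (counted with algebraic multiplicity) with $\lambda_{n,j}=(2\pi n)^2+O(n^{1/2})$, $j=1,2$. "Large eigenvalues are simple" means that there is $N$ such that $\lambda_{n,j}$ is simple for all $n>N$, $j=1,2$. For each large $n$ the labels $j=1,2$ are assigned suitably, with a fixed choice of branch of the square roots. The root functions of an operator are its eigenfunctions and associated functions. *)

theory Defs
  imports "HOL-Analysis.Analysis" "HOL-Library.Function_Algebras" "HOL-Library.Landau_Symbols"
begin

section \<open>Complex-valued functions on the unit interval\<close>

definition cfun_scale :: "complex \<Rightarrow> (real \<Rightarrow> complex) \<Rightarrow> real \<Rightarrow> complex" where
  "cfun_scale c f = (\<lambda>x. c * f x)"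

interpretation cfun: vector_space cfun_scale
  by unfold_locales (auto simp: cfun_scale_def fun_eq_iff algebra_simps)

text \<open>Elements of \<open>L\<^sub>2[0,1]\<close> are represented by functions, two of which are identified when they
  are related by \<open>L2_eq\<close>.\<close>

definition L2 :: "(real \<Rightarrow> complex) set" where
  "L2 = {f. f \<in> borel_measurable (lebesgue_on {0..1}) \<and>
            (\<lambda>x. (cmod (f x))\<^sup>2) absolutely_integrable_on {0..1}}"

definition L2_eq :: "(real \<Rightarrow> complex) \<Rightarrow> (real \<Rightarrow> complex) \<Rightarrow> bool" where
  "L2_eq f g \<longleftrightarrow> (AE x in lebesgue_on {0..1}. f x = g x)"

definition L2_inner :: "(real \<Rightarrow> complex) \<Rightarrow> (real \<Rightarrow> complex) \<Rightarrow> complex" where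
  "L2_inner f g = integral {0..1} (\<lambda>x. f x * cnj (g x))"

definition L2_norm :: "(real \<Rightarrow> complex) \<Rightarrow> real" where
  "L2_norm f = sqrt (integral {0..1} (\<lambda>x. (cmod (f x))\<^sup>2))"

definition L2_orthonormal_basis :: "(nat \<Rightarrow> real \<Rightarrow> complex) \<Rightarrow> bool" where
  "L2_orthonormal_basis u \<longleftrightarrow>
     (\<forall>n. u n \<in> L2) \<and>
     (\<forall>m n. L2_inner (u m) (u n) = (if m = n then 1 else 0)) \<and>
     (\<forall>f\<in>L2. (\<forall>n. L2_inner f (u n) = 0) \<longrightarrow> L2_eq f 0)"

text \<open>Linearity and boundedness together make such a map compatible with \<open>L2_eq\<close>.\<close>

definition L2_bounded_operator :: "((real \<Rightarrow> complex) \<Rightarrow> real \<Rightarrow> complex) \<Rightarrow> bool" where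
  "L2_bounded_operator A \<longleftrightarrow>
     (\<forall>f\<in>L2. A f \<in> L2) \<and>
     (\<forall>f\<in>L2. \<forall>g\<in>L2. \<forall>a b. L2_eq (A (cfun_scale a f + cfun_scale b g))
                                   (cfun_scale a (A f) + cfun_scale b (A g))) \<and>
     (\<exists>C. \<forall>f\<in>L2. L2_norm (A f) \<le> C * L2_norm f)"

text \<open>A Riesz basis is the image of an orthonormal basis under a bounded operator with bounded
  inverse.\<close>

definition L2_Riesz_basis :: "(nat \<Rightarrow> real \<Rightarrow> complex) \<Rightarrow> bool" where
  "L2_Riesz_basis e \<longleftrightarrow>
     (\<exists>u A B. L2_orthonormal_basis u \<and> L2_bounded_operator A \<and> L2_bounded_operator B \<and>
        (\<forall>f\<in>L2. L2_eq (B (A f)) f \<and> L2_eq (A (B f)) f) \<and>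
        (\<forall>n. e n \<in> L2 \<and> L2_eq (e n) (A (u n))))"


section \<open>The operator\<close>

text \<open>\<open>T1_graph q \<beta> y f\<close> says that \<open>y\<close> lies in the domain of the operator and is mapped to
  (the class of) \<open>f\<close>. Absolute continuity of the derivative \<open>y1\<close> is expressed by its being the
  indefinite integral of a Lebesgue integrable function \<open>y2\<close>, which is then \<open>y''\<close>. Elements of the
  domain are represented by their continuously differentiable representative on \<open>[0,1]\<close>, extended
  by zero, so that equality in \<open>L\<^sub>2[0,1]\<close> is equality of functions there.\<close>

definition T1_graph ::
  "(real \<Rightarrow> complex) \<Rightarrow> complex \<Rightarrow> (real \<Rightarrow> complex) \<Rightarrow> (real \<Rightarrow> complex) \<Rightarrow> bool" where
  "T1_graph q \<beta> y f \<longleftrightarrow>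
     (\<forall>x. x \<notin> {0..1} \<longrightarrow> y x = 0) \<and>
     (\<exists>y1 y2.
        (\<forall>x\<in>{0..1}. (y has_vector_derivative y1 x) (at x within {0..1})) \<and>
        y2 absolutely_integrable_on {0..1} \<and>
        (\<forall>x\<in>{0..1}. y1 x = y1 0 + integral {0..x} y2) \<and>
        y1 0 + \<beta> * y1 1 = 0 \<and> y 0 - y 1 = 0 \<and>
        f \<in> L2 \<and> L2_eq f (\<lambda>x. - y2 x + q x * y x))"

text \<open>\<open>T1_ker q \<beta> \<mu> k\<close> is the kernel of the \<open>k\<close>-th power of the operator minus \<open>\<mu>\<close>.\<close>

primrec T1_ker ::
  "(real \<Rightarrow> complex) \<Rightarrow> complex \<Rightarrow> complex \<Rightarrow> nat \<Rightarrow> (real \<Rightarrow> complex) set" where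
  "T1_ker q \<beta> \<mu> 0 = {0}"
| "T1_ker q \<beta> \<mu> (Suc k) =
     {y. \<exists>z \<in> T1_ker q \<beta> \<mu> k. T1_graph q \<beta> y (cfun_scale \<mu> y + z)}"

text \<open>The nonzero elements of the root space are the eigenfunctions and associated functions
  for \<open>\<mu>\<close>.\<close>

definition T1_root_space ::
  "(real \<Rightarrow> complex) \<Rightarrow> complex \<Rightarrow> complex \<Rightarrow> (real \<Rightarrow> complex) set" where
  "T1_root_space q \<beta> \<mu> = (\<Union>k. T1_ker q \<beta> \<mu> k)"

text \<open>Algebraic multiplicity \<open>0\<close> means that \<open>\<mu>\<close> is not an eigenvalue.\<close>

definition T1_alg_multiplicity ::
  "(real \<Rightarrow> complex) \<Rightarrow> complex \<Rightarrow> complex \<Rightarrow> nat \<Rightarrow> bool" where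
  "T1_alg_multiplicity q \<beta> \<mu> m \<longleftrightarrow>
     (\<exists>B. finite B \<and> card B = m \<and> cfun.independent B \<and> cfun.span B = T1_root_space q \<beta> \<mu>)"

definition T1_simple_eigenvalue :: "(real \<Rightarrow> complex) \<Rightarrow> complex \<Rightarrow> complex \<Rightarrow> bool" where
  "T1_simple_eigenvalue q \<beta> \<mu> \<longleftrightarrow> T1_alg_multiplicity q \<beta> \<mu> 1"

text \<open>\<open>lam n j\<close>, for \<open>j = 1\<close>, \<open>n \<ge> 0\<close> and \<open>j = 2\<close>, \<open>n \<ge> 1\<close>, lists the eigenvalues with algebraic
  multiplicity. The index \<open>n = 0\<close> occurs once: for \<open>q = 0\<close> the eigenvalue \<open>0\<close> is simple, whereas
  \<open>(2 \<pi> n)\<^sup>2\<close> is double for every \<open>n \<ge> 1\<close>. The values \<open>lam n j\<close> at other indices are irrelevant.\<close>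

definition T1_eigenvalue_sequences ::
  "(real \<Rightarrow> complex) \<Rightarrow> complex \<Rightarrow> (nat \<Rightarrow> nat \<Rightarrow> complex) \<Rightarrow> bool" where
  "T1_eigenvalue_sequences q \<beta> lam \<longleftrightarrow>
     (\<forall>\<mu>. let I = {(n, j). (j = 1 \<or> j = 2 \<and> n \<ge> 1) \<and> lam n j = \<mu>}
           in finite I \<and> T1_alg_multiplicity q \<beta> \<mu> (card I)) \<and>
     (\<forall>j\<in>{1, 2}. (\<lambda>n. cmod (lam n j - of_real ((2 * pi * real n)\<^sup>2))) \<in> O(\<lambda>n. sqrt (real n)))"

text \<open>A system of root functions: the members belonging to each eigenvalue form a basis of its root
  space. No normalisation is imposed.\<close>

definition T1_root_functions ::
  "(real \<Rightarrow> complex) \<Rightarrow> complex \<Rightarrow> (nat \<Rightarrow> real \<Rightarrow> complex) \<Rightarrow> bool" where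
  "T1_root_functions q \<beta> e \<longleftrightarrow>
     inj e \<and>
     (\<forall>n. \<exists>\<mu>. e n \<in> T1_root_space q \<beta> \<mu>) \<and>
     (\<forall>\<mu>. cfun.independent (range e \<inter> T1_root_space q \<beta> \<mu>) \<and>
          cfun.span (range e \<inter> T1_root_space q \<beta> \<mu>) = T1_root_space q \<beta> \<mu>)"

definition sine_coeff :: "(real \<Rightarrow> complex) \<Rightarrow> nat \<Rightarrow> complex" where
  "sine_coeff q k = integral {0..1} (\<lambda>x. q x * of_real (sin (2 * pi * real k * x)))"

definition gamma1 :: "complex \<Rightarrow> complex" where
  "gamma1 \<beta> = 16 * of_real pi * (\<beta> + 1) / (\<beta> - 1)"

text \<open>The condition \<open>ln n\<^sub>k / (n\<^sub>k s\<^bsub>2n\<^sub>k\<^esub>) \<longlongrightarrow> 0\<close> along a sequence \<open>n\<^sub>k\<close>. The quotient has to be defined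
  for large \<open>k\<close>; this must be required explicitly because division by zero yields zero.\<close>

definition sine_coeff_dominates ::
  "(real \<Rightarrow> complex) \<Rightarrow> (nat \<Rightarrow> nat) \<Rightarrow> bool" where
  "sine_coeff_dominates q \<nu> \<longleftrightarrow>
     (\<forall>\<^sub>F k in sequentially. sine_coeff q (2 * \<nu> k) \<noteq> 0) \<and>
     (\<lambda>k. of_real (ln (real (\<nu> k))) / (of_nat (\<nu> k) * sine_coeff q (2 * \<nu> k))) \<longlonglongrightarrow> 0"

end

theory Submission
  imports Defs "HOL-Complex_Analysis.Complex_Analysis"
begin

text \<open>The spectrum is read off from one entire function. Let \<open>c(x, \<lambda>)\<close> and \<open>s(x, \<lambda>)\<close> solve
  \<open>-y'' + q y = \<lambda> y\<close> with \<open>(y, y')(0) = (1, 0)\<close> and \<open>(0, 1)\<close>. Inserting \<open>a c + b s\<close> into the two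
  boundary conditions gives a \<open>2 \<times> 2\<close> system whose determinant, by the Wronskian identity, is
  \<open>\<Delta>(\<lambda>) = 1 - \<beta> + \<beta> s'(1, \<lambda>) - c(1, \<lambda>)\<close> (\<open>char_fun\<close>). For \<open>q = 0\<close> it is \<open>(1 - \<beta>)(1 - cos \<surd>\<lambda>)\<close>, with a
  simple zero at \<open>0\<close> and double zeros at \<open>(2\<pi>n)\<^sup>2\<close>, \<open>n \<ge> 1\<close>.

  Multiplicities. Since \<open>\<beta> \<noteq> -1\<close>, the \<open>2 \<times> 2\<close> matrix never vanishes, so eigenspaces are at most
  one-dimensional and every root space is spanned by a single Jordan chain. A family of solutions that
  depends analytically on \<open>\<lambda>\<close>, satisfies one boundary condition identically and violates the other by
  exactly \<open>\<Delta>(\<lambda>)\<close> has Taylor coefficients at \<open>\<mu>\<close> that form such a chain, and the chain breaks off at the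
  order of the zero of \<open>\<Delta>\<close> at \<open>\<mu>\<close>. Hence algebraic multiplicity and order of the zero agree
  (\<open>T1_ker_eq\<close>, \<open>T1_multiplicity_subdegree\<close>).

  Eigenvalues. With \<open>\<lambda> = w\<^sup>2\<close>, iterating the integral equation with kernel \<open>sin w(x - t) / w\<close> gives
  \<open>\<Delta> = (1 - \<beta>)(1 - cos w) - (1 + \<beta>)/(2w) \<integral> q(t) sin w(1 - 2t) dt\<close> up to \<open>O(e\<^bsup>|Im w|\<^esup> / |w|\<^sup>2)\<close>
  (\<open>char_fun_expansion\<close>). At \<open>w = 2\<pi>n + \<delta>\<close> the integral is \<open>-s\<^bsub>2n\<^esub> + O(\<delta>)\<close>, so \<open>\<Delta>\<close> is close to
  \<open>(1 - \<beta>)/2 (\<delta>\<^sup>2 - \<sigma>\<^sub>n)\<close> with \<open>\<sigma>\<^sub>n = (1 + \<beta>)/(\<beta> - 1) s\<^bsub>2n\<^esub> / (2\<pi>n)\<close> (\<open>char_fun_near\<close>). The hypothesis makes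
  \<open>n |s\<^bsub>2n\<^esub>|\<close> tend to infinity, and then the error is small against \<open>\<sigma>\<^sub>n\<close> on circles of radius
  \<open>\<epsilon> |\<sigma>\<^sub>n|\<^bsup>1/2\<^esup>\<close> around the two square roots of \<open>\<sigma>\<^sub>n\<close>; each disc contains a zero (\<open>zeros_near\<close>). Comparison
  with \<open>q = 0\<close> by Rouche's theorem on \<open>|\<lambda>| = (\<pi>(2N + 1))\<^sup>2\<close> shows that there are \<open>2N + 1\<close> zeros inside
  (\<open>zeros_below_count\<close>), so an annulus between consecutive circles contains exactly two. These are the
  two zeros found, which are therefore simple and the only ones (\<open>annulus_pair\<close>).

  Riesz bases. The double eigenvalue \<open>(2\<pi>n)\<^sup>2\<close> of the free operator has the single eigenfunction
  \<open>cos 2\<pi>nx\<close>. The two eigenvalues that split off from it have eigenfunctions which are both uniformly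
  close to multiples of \<open>cos 2\<pi>nx\<close> (\<open>eigenfunction_near\<close>), hence asymptotically parallel. Two different
  members of a Riesz basis cannot become parallel while staying bounded (\<open>Riesz_basis_bounds\<close>), and this
  argument uses only a subsequence of the indices \<open>n\<close>.\<close>

section \<open>Functions with an integrable second derivative\<close>

lemma absolutely_integrable_mult_continuous:
  fixes p y :: "real \<Rightarrow> complex"
  assumes "p absolutely_integrable_on {a..b}" "continuous_on {a..b} y"
  shows "(\<lambda>x. p x * y x) absolutely_integrable_on {a..b}"
proof -
  have "bilinear (\<lambda>x y :: complex. y * x)"
    by (simp add: bilinear_def linear_iff algebra_simps)
  moreover have "y \<in> borel_measurable (lebesgue_on {a..b})"
    using assms(2) by (intro continuous_imp_measurable_on_sets_lebesgue) auto
  moreover have "bounded (y ` {a..b})"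
    using assms(2) by (intro compact_imp_bounded compact_continuous_image) auto
  ultimately show ?thesis
    using absolutely_integrable_bounded_measurable_product[of "\<lambda>x y. y * x" y "{a..b}" p] assms(1)
    by auto
qed

lemma norm_integral_mult_le:
  fixes p y :: "real \<Rightarrow> complex"
  assumes p: "p absolutely_integrable_on {a..b}" and y: "continuous_on {a..b} y"
    and B: "\<And>t. t \<in> {a..b} \<Longrightarrow> norm (y t) \<le> B"
  shows "norm (integral {a..b} (\<lambda>t. p t * y t)) \<le> B * integral {a..b} (\<lambda>t. norm (p t))"
proof -
  have "norm (integral {a..b} (\<lambda>t. p t * y t)) \<le> integral {a..b} (\<lambda>t. B * norm (p t))"
  proof (rule integral_norm_bound_integral)
    show "(\<lambda>t. p t * y t) integrable_on {a..b}"
      using absolutely_integrable_mult_continuous[OF p y] set_lebesgue_integral_eq_integral(1) by blast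
    show "(\<lambda>t. B * norm (p t)) integrable_on {a..b}"
      using p by (intro integrable_on_mult_right) (simp add: absolutely_integrable_on_def)
    show "norm (p t * y t) \<le> B * norm (p t)" if "t \<in> {a..b}" for t
      using mult_right_mono[OF B[OF that] norm_ge_zero[of "p t"]] by (simp add: norm_mult mult.commute)
  qed
  then show ?thesis by simp
qed

lemma integral_norm_subinterval_le:
  fixes p :: "real \<Rightarrow> complex"
  assumes "p absolutely_integrable_on {a..b}" "{c..d} \<subseteq> {a..b}"
  shows "integral {c..d} (\<lambda>t. norm (p t)) \<le> integral {a..b} (\<lambda>t. norm (p t))"
proof (rule integral_subset_le)
  show "(\<lambda>t. norm (p t)) integrable_on {a..b}"
    using assms by (simp add: absolutely_integrable_on_def)
  then show "(\<lambda>t. norm (p t)) integrable_on {c..d}"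
    using assms(2) integrable_on_subinterval by blast
qed (use assms in auto)

lemma absolutely_integrable_subinterval:
  fixes p :: "real \<Rightarrow> complex"
  assumes "p absolutely_integrable_on {a..b}" "{c..d} \<subseteq> {a..b}"
  shows "p absolutely_integrable_on {c..d}"
  using assms by (meson absolutely_integrable_on_def integrable_on_subinterval)

lemma norm_integral_exp_le:
  fixes h :: "real \<Rightarrow> complex"
  assumes "h integrable_on {0..x}" "0 \<le> x" "0 < \<kappa>" "0 \<le> K"
    and "\<And>t. t \<in> {0..x} \<Longrightarrow> norm (h t) \<le> K * exp (\<kappa> * t)"
  shows "norm (integral {0..x} h) \<le> K * exp (\<kappa> * x) / \<kappa>"
proof -
  have I: "((\<lambda>t. K * exp (\<kappa> * t)) has_integral (K * exp (\<kappa> * x) / \<kappa> - K * exp (\<kappa> * 0) / \<kappa>)) {0..x}"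
    using assms(2,3)
    by (intro fundamental_theorem_of_calculus)
       (auto intro!: derivative_eq_intros simp: has_real_derivative_iff_has_vector_derivative[symmetric])
  have "norm (integral {0..x} h) \<le> integral {0..x} (\<lambda>t. K * exp (\<kappa> * t))"
    using assms(1,5) I by (intro integral_norm_bound_integral) auto
  also have "\<dots> = K * exp (\<kappa> * x) / \<kappa> - K / \<kappa>"
    using integral_unique[OF I] by simp
  also have "\<dots> \<le> K * exp (\<kappa> * x) / \<kappa>"
    using assms(3,4) by simp
  finally show ?thesis .
qed

text \<open>All differential equations here have merely integrable coefficients, so \<open>h = y''\<close> is meant in the
  Caratheodory sense: \<open>y1\<close> is an indefinite integral of \<open>h\<close>. Carrying \<open>y1\<close> and \<open>h\<close> as parameters makes the
  relation linear in the triple.\<close>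

definition second_deriv :: "(real \<Rightarrow> complex) \<Rightarrow> (real \<Rightarrow> complex) \<Rightarrow> (real \<Rightarrow> complex) \<Rightarrow> bool" where
  "second_deriv y y1 h \<longleftrightarrow>
     (\<forall>x\<in>{0..1}. (y has_vector_derivative y1 x) (at x within {0..1})) \<and>
     h absolutely_integrable_on {0..1} \<and>
     (\<forall>x\<in>{0..1}. y1 x = y1 0 + integral {0..x} h)"

lemma second_derivD:
  assumes "second_deriv y y1 h"
  shows "x \<in> {0..1} \<Longrightarrow> (y has_vector_derivative y1 x) (at x within {0..1})"
    and "h absolutely_integrable_on {0..1}" "h integrable_on {0..1}"
    and "x \<in> {0..1} \<Longrightarrow> y1 x = y1 0 + integral {0..x} h"
  using assms unfolding second_deriv_def absolutely_integrable_on_def by blast+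

lemma second_derivI:
  assumes "\<And>x. x \<in> {0..1} \<Longrightarrow> (y has_vector_derivative y1 x) (at x within {0..1})"
    and "h absolutely_integrable_on {0..1}"
    and "\<And>x. x \<in> {0..1} \<Longrightarrow> y1 x = y1 0 + integral {0..x} h"
  shows "second_deriv y y1 h"
  using assms unfolding second_deriv_def by blast

lemma second_deriv_continuous:
  assumes "second_deriv y y1 h"
  shows "continuous_on {0..1} y" "continuous_on {0..1} y1"
proof -
  show "continuous_on {0..1} y"
    using second_derivD(1)[OF assms]
    by (meson continuous_on_eq_continuous_within has_vector_derivative_continuous)
  have "continuous_on {0..1} (\<lambda>x. y1 0 + integral {0..x} h)"
    by (intro continuous_intros indefinite_integral_continuous_1 second_derivD(3)[OF assms])
  then show "continuous_on {0..1} y1"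
    using continuous_on_cong[OF refl second_derivD(4)[OF assms], of "{0..1}" "\<lambda>x. x"] by simp
qed

lemma second_deriv_integral:
  assumes "second_deriv y y1 h" "x \<in> {0..1}"
  shows "y x = y 0 + integral {0..x} y1"
proof -
  have "(y1 has_integral (y x - y 0)) {0..x}"
  proof (rule fundamental_theorem_of_calculus)
    fix t assume "t \<in> {0..x}"
    then show "(y has_vector_derivative y1 t) (at t within {0..x})"
      using assms(2) second_derivD(1)[OF assms(1), of t]
      by (auto intro: has_vector_derivative_within_subset)
  qed (use assms(2) in simp)
  then show ?thesis by (simp add: integral_unique)
qed

lemma second_deriv_cong:
  assumes "second_deriv y y1 h" "\<And>x. x \<in> {0..1} \<Longrightarrow> y x = z x" "\<And>x. x \<in> {0..1} \<Longrightarrow> y1 x = z1 x"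
    "\<And>x. x \<in> {0..1} \<Longrightarrow> h x = k x"
  shows "second_deriv z z1 k"
proof (rule second_derivI)
  fix x :: real assume x: "x \<in> {0..1}"
  show "(z has_vector_derivative z1 x) (at x within {0..1})"
    using second_derivD(1)[OF assms(1) x] assms(2,3) x
    by (metis has_vector_derivative_transform)
  have "integral {0..x} h = integral {0..x} k"
    using x assms(4) by (intro integral_cong) auto
  then show "z1 x = z1 0 + integral {0..x} k"
    using second_derivD(4)[OF assms(1) x] assms(3)[OF x] assms(3)[of 0] by simp
next
  show "k absolutely_integrable_on {0..1}"
    using second_derivD(2)[OF assms(1)] assms(4)
    by (subst set_integrable_cong[OF refl refl, where f' = h]) auto
qed

lemma second_deriv_add:
  assumes "second_deriv y y1 h" "second_deriv z z1 k"
  shows "second_deriv (\<lambda>x. y x + z x) (\<lambda>x. y1 x + z1 x) (\<lambda>x. h x + k x)"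
proof (rule second_derivI)
  fix x :: real assume x: "x \<in> {0..1}"
  show "((\<lambda>x. y x + z x) has_vector_derivative y1 x + z1 x) (at x within {0..1})"
    by (intro has_vector_derivative_add second_derivD(1)[OF assms(1) x] second_derivD(1)[OF assms(2) x])
  have "h integrable_on {0..x}" "k integrable_on {0..x}"
    using second_derivD(3)[OF assms(1)] second_derivD(3)[OF assms(2)] x
    by (auto intro: integrable_on_subinterval)
  then have "integral {0..x} (\<lambda>x. h x + k x) = integral {0..x} h + integral {0..x} k"
    by (rule integral_add)
  then show "y1 x + z1 x = y1 0 + z1 0 + integral {0..x} (\<lambda>x. h x + k x)"
    using second_derivD(4)[OF assms(1) x] second_derivD(4)[OF assms(2) x] by simp
next
  show "(\<lambda>x. h x + k x) absolutely_integrable_on {0..1}"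
    by (intro set_integral_add(1) second_derivD(2)[OF assms(1)] second_derivD(2)[OF assms(2)])
qed

lemma second_deriv_scale:
  assumes "second_deriv y y1 h"
  shows "second_deriv (\<lambda>x. c * y x) (\<lambda>x. c * y1 x) (\<lambda>x. c * h x)"
proof (rule second_derivI)
  fix x :: real assume x: "x \<in> {0..1}"
  show "((\<lambda>x. c * y x) has_vector_derivative c * y1 x) (at x within {0..1})"
    by (intro has_vector_derivative_mult_right second_derivD(1)[OF assms x])
  show "c * y1 x = c * y1 0 + integral {0..x} (\<lambda>x. c * h x)"
    using second_derivD(4)[OF assms x] by (simp add: algebra_simps)
next
  show "(\<lambda>x. c * h x) absolutely_integrable_on {0..1}"
    by (intro set_integrable_mult_right second_derivD(2)[OF assms])
qed

lemma second_deriv_zero: "second_deriv (\<lambda>x. 0) (\<lambda>x. 0) (\<lambda>x. 0)"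
  by (auto simp: second_deriv_def absolutely_integrable_on_def)

lemma second_deriv_sum:
  assumes "finite A" "\<And>i. i \<in> A \<Longrightarrow> second_deriv (y i) (y1 i) (h i)"
  shows "second_deriv (\<lambda>x. \<Sum>i\<in>A. y i x) (\<lambda>x. \<Sum>i\<in>A. y1 i x) (\<lambda>x. \<Sum>i\<in>A. h i x)"
  using assms
  by (induction A rule: finite_induct) (auto intro: second_deriv_zero second_deriv_add)

section \<open>Initial value problems\<close>

text \<open>The norm \<open>sup |y(x)| e\<^bsup>-\<kappa>x\<^esup>\<close> of Bielecki type: for large \<open>\<kappa>\<close> the Volterra operators below are
  contractions with respect to it, without any subdivision of the interval.\<close>

lemma weighted_sup_attained:
  fixes y :: "real \<Rightarrow> complex"
  assumes "continuous_on {0..1} y"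
  obtains N x0 where "0 \<le> N" "x0 \<in> {0..1}" "norm (y x0) = N * exp (\<kappa> * x0)"
    "\<And>t. t \<in> {0..1} \<Longrightarrow> norm (y t) \<le> N * exp (\<kappa> * t)"
proof -
  have c0: "continuous_on {0..1} (\<lambda>t. norm (y t) * exp (- (\<kappa> * t)))"
    using assms by (intro continuous_intros)
  obtain x0 where x0: "x0 \<in> {0..1}"
    "\<And>t. t \<in> {0..1} \<Longrightarrow> norm (y t) * exp (- (\<kappa> * t)) \<le> norm (y x0) * exp (- (\<kappa> * x0))"
    using continuous_attains_sup[OF compact_Icc _ c0] by auto
  have undo: "norm (y t) = norm (y t) * exp (- (\<kappa> * t)) * exp (\<kappa> * t)" for t
    by (simp add: mult.assoc flip: exp_add)
  show ?thesis
  proof (rule that[OF _ x0(1) undo])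
    fix t :: real assume "t \<in> {0..1}"
    then show "norm (y t) \<le> norm (y x0) * exp (- (\<kappa> * x0)) * exp (\<kappa> * t)"
      by (subst undo) (intro mult_right_mono x0(2), auto)
  qed simp
qed

text \<open>Integrating twice gains a factor \<open>1/\<kappa>\<close> for the potential term and \<open>1/\<kappa>\<^sup>2\<close> for the right-hand side in
  the weighted norm, so \<open>2 \<integral>|p| \<le> \<kappa>\<close> allows the potential term to be absorbed. The explicit \<open>F/\<kappa>\<^sup>2\<close> is what
  makes iterated solutions decay geometrically in \<open>Y_sums\<close>.\<close>

lemma ivp_bound:
  assumes p: "p absolutely_integrable_on {0..1}"
    and sd: "second_deriv y y1 (\<lambda>t. p t * y t + f t)"
    and f: "continuous_on {0..1} f" "\<And>t. t \<in> {0..1} \<Longrightarrow> norm (f t) \<le> F * exp (\<kappa> * t)"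
    and \<kappa>: "1 \<le> \<kappa>" "2 * integral {0..1} (\<lambda>t. norm (p t)) \<le> \<kappa>"
    and x: "x \<in> {0..1}"
  shows "norm (y x) \<le> 2 * (norm (y 0) + norm (y1 0) + F / \<kappa>^2) * exp (\<kappa> * x)"
    and "norm (y1 x) \<le> 2 * \<kappa> * (norm (y 0) + norm (y1 0) + F / \<kappa>^2) * exp (\<kappa> * x)"
proof -
  define P where "P = integral {0..1} (\<lambda>t. norm (p t))"
  have P: "0 \<le> P" "2 * P \<le> \<kappa>" unfolding P_def using \<kappa>
    by (auto intro!: integral_nonneg p[unfolded absolutely_integrable_on_def, THEN conjunct2])
  have F: "0 \<le> F" using f(2)[of 0] by (simp) (meson norm_ge_zero order_trans)
  note cont = second_deriv_continuous[OF sd]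
  obtain N x0 where N0: "0 \<le> N" and x0: "x0 \<in> {0..1}" "norm (y x0) = N * exp (\<kappa> * x0)"
    and yN: "\<And>t. t \<in> {0..1} \<Longrightarrow> norm (y t) \<le> N * exp (\<kappa> * t)"
    using weighted_sup_attained[OF cont(1)] by blast
  define K where "K = norm (y1 0) + P * N + F / \<kappa>"
  have K0: "0 \<le> K" using P N0 F \<kappa> by (auto simp: K_def)
  have y1K: "norm (y1 t) \<le> K * exp (\<kappa> * t)" if t: "t \<in> {0..1}" for t
  proof -
    have sub: "{0..t} \<subseteq> {0..1}" using t by auto
    have p': "p absolutely_integrable_on {0..t}" by (rule absolutely_integrable_subinterval[OF p sub])
    have c': "continuous_on {0..t} y" "continuous_on {0..t} f"
      using cont f sub continuous_on_subset by blast+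
    have "(\<lambda>s. p s * y s) integrable_on {0..t}"
      using absolutely_integrable_mult_continuous[OF p' c'(1)] absolutely_integrable_on_def by blast
    moreover have "f integrable_on {0..t}" using c' integrable_continuous_real by blast
    ultimately have "integral {0..t} (\<lambda>s. p s * y s + f s) =
        integral {0..t} (\<lambda>s. p s * y s) + integral {0..t} f" by (rule integral_add)
    then have eq: "y1 t = y1 0 + integral {0..t} (\<lambda>s. p s * y s) + integral {0..t} f"
      using second_derivD(4)[OF sd t] by simp
    have "norm (integral {0..t} (\<lambda>s. p s * y s)) \<le> (N * exp (\<kappa> * t)) * integral {0..t} (\<lambda>s. norm (p s))"
    proof (rule norm_integral_mult_le[OF p' c'(1)])
      fix s assume s: "s \<in> {0..t}"
      have "norm (y s) \<le> N * exp (\<kappa> * s)" using yN s t by auto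
      also have "\<dots> \<le> N * exp (\<kappa> * t)" using s N0 \<kappa> by (intro mult_left_mono) auto
      finally show "norm (y s) \<le> N * exp (\<kappa> * t)" .
    qed
    also have "\<dots> \<le> (N * exp (\<kappa> * t)) * P"
      using integral_norm_subinterval_le[OF p sub] N0 unfolding P_def by (intro mult_left_mono) auto
    finally have 1: "norm (integral {0..t} (\<lambda>s. p s * y s)) \<le> P * N * exp (\<kappa> * t)" by (simp add: mult_ac)
    have 2: "norm (integral {0..t} f) \<le> F * exp (\<kappa> * t) / \<kappa>"
      using t \<kappa> F f sub \<open>f integrable_on {0..t}\<close> by (intro norm_integral_exp_le) auto
    have "norm (y1 0) * 1 \<le> norm (y1 0) * exp (\<kappa> * t)"
      using t \<kappa> by (intro mult_left_mono) auto
    then have 3: "norm (y1 0) \<le> norm (y1 0) * exp (\<kappa> * t)" by simp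
    have "norm (y1 t) \<le> norm (y1 0) + norm (integral {0..t} (\<lambda>s. p s * y s)) + norm (integral {0..t} f)"
      unfolding eq by (intro norm_triangle_mono order.refl)
    also have "\<dots> \<le> K * exp (\<kappa> * t)" using 1 2 3 by (simp add: K_def algebra_simps)
    finally show ?thesis .
  qed
  have yK: "norm (y t) \<le> (norm (y 0) + K / \<kappa>) * exp (\<kappa> * t)" if t: "t \<in> {0..1}" for t
  proof -
    have sub: "{0..t} \<subseteq> {0..1}" using t by auto
    have "norm (integral {0..t} y1) \<le> K * exp (\<kappa> * t) / \<kappa>"
      using t \<kappa> K0 y1K sub cont
      by (intro norm_integral_exp_le integrable_continuous_real) (auto intro: continuous_on_subset)
    moreover have "norm (y t) \<le> norm (y 0) + norm (integral {0..t} y1)"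
      unfolding second_deriv_integral[OF sd t] by (rule norm_triangle_ineq)
    moreover have "norm (y 0) * 1 \<le> norm (y 0) * exp (\<kappa> * t)"
      using t \<kappa> by (intro mult_left_mono) auto
    ultimately show ?thesis by (simp add: algebra_simps)
  qed
  have "N \<le> norm (y 0) + K / \<kappa>"
    using yK[OF x0(1)] unfolding x0(2) by simp
  also have "\<dots> = norm (y 0) + norm (y1 0) / \<kappa> + (P / \<kappa>) * N + F / \<kappa>^2"
    by (simp add: K_def add_divide_distrib power2_eq_square)
  also have "\<dots> \<le> norm (y 0) + norm (y1 0) + (1/2) * N + F / \<kappa>^2"
    using P \<kappa> N0 mult_left_mono[of 1 \<kappa> "norm (y1 0)"]
    by (intro add_mono mult_right_mono) (auto simp: divide_simps)
  finally have N: "N \<le> 2 * (norm (y 0) + norm (y1 0) + F / \<kappa>^2)" by simp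
  have "norm (y x) \<le> N * exp (\<kappa> * x)" by (rule yN[OF x])
  also have "\<dots> \<le> 2 * (norm (y 0) + norm (y1 0) + F / \<kappa>^2) * exp (\<kappa> * x)"
    using N by (intro mult_right_mono) auto
  finally show "norm (y x) \<le> 2 * (norm (y 0) + norm (y1 0) + F / \<kappa>^2) * exp (\<kappa> * x)" .
  have "2 * P * N \<le> \<kappa> * (2 * (norm (y 0) + norm (y1 0) + F / \<kappa>^2))"
    using P N N0 \<kappa> by (intro mult_mono) auto
  moreover have "F / \<kappa> = \<kappa> * (F / \<kappa>^2)" using \<kappa> by (simp add: power2_eq_square)
  moreover have "norm (y1 0) * 1 \<le> norm (y1 0) * \<kappa>" using \<kappa> by (intro mult_left_mono) auto
  moreover have "0 \<le> \<kappa> * norm (y 0)" using \<kappa> by simp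
  ultimately have "K \<le> 2 * \<kappa> * (norm (y 0) + norm (y1 0) + F / \<kappa>^2)"
    by (simp add: K_def algebra_simps)
  then have "K * exp (\<kappa> * x) \<le> 2 * \<kappa> * (norm (y 0) + norm (y1 0) + F / \<kappa>^2) * exp (\<kappa> * x)"
    by (intro mult_right_mono) auto
  then show "norm (y1 x) \<le> 2 * \<kappa> * (norm (y 0) + norm (y1 0) + F / \<kappa>^2) * exp (\<kappa> * x)"
    using y1K[OF x] by linarith
qed

lemma ivp_unique_zero:
  assumes p: "p absolutely_integrable_on {0..1}"
    and sd: "second_deriv y y1 (\<lambda>t. p t * y t)" and "y 0 = 0" "y1 0 = 0" and x: "x \<in> {0..1}"
  shows "y x = 0" "y1 x = 0"
proof -
  define \<kappa> where "\<kappa> = max 1 (2 * integral {0..1} (\<lambda>t. norm (p t)))"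
  have sd': "second_deriv y y1 (\<lambda>t. p t * y t + 0)" using sd by simp
  have "norm (y x) \<le> 2 * (norm (y 0) + norm (y1 0) + 0 / \<kappa>^2) * exp (\<kappa> * x)"
    by (rule ivp_bound(1)[OF p sd']) (auto simp: \<kappa>_def x[simplified])
  then show "y x = 0" using assms by simp
  have "norm (y1 x) \<le> 2 * \<kappa> * (norm (y 0) + norm (y1 0) + 0 / \<kappa>^2) * exp (\<kappa> * x)"
    by (rule ivp_bound(2)[OF p sd']) (auto simp: \<kappa>_def x[simplified])
  then show "y1 x = 0" using assms by simp
qed

text \<open>Neumann series for \<open>y = g + V y\<close>, where \<open>V y(x) = \<integral>\<^sub>0\<^sup>x \<integral>\<^sub>0\<^sup>t p(s) y(s) ds dt\<close> has norm at most \<open>1/2\<close> in the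
  weighted norm and \<open>g\<close> collects the initial values and the right-hand side.\<close>

lemma ivp_exists:
  fixes p f :: "real \<Rightarrow> complex"
  assumes p: "p absolutely_integrable_on {0..1}" and f: "continuous_on {0..1} f"
  obtains y y1 where "second_deriv y y1 (\<lambda>t. p t * y t + f t)" "y 0 = a" "y1 0 = b"
proof -
  define P where "P = integral {0..1} (\<lambda>t. norm (p t))"
  have P: "0 \<le> P" unfolding P_def
    using p by (intro integral_nonneg) (auto simp: absolutely_integrable_on_def)
  define \<kappa> where "\<kappa> = 2 * P + 1"
  have \<kappa>: "0 < \<kappa>" "1 \<le> \<kappa>" "P / \<kappa> \<le> 1 / 2" using P by (auto simp: \<kappa>_def divide_simps)
  define U where "U y = (\<lambda>t. integral {0..t} (\<lambda>s. p s * y s))" for y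
  define V where "V y = (\<lambda>x. integral {0..x} (U y))" for y
  have py: "(\<lambda>s. p s * y s) integrable_on {0..t}" if "continuous_on {0..1} y" "t \<in> {0..1}" for y t
  proof -
    have "(\<lambda>s. p s * y s) integrable_on {0..1}"
      using absolutely_integrable_mult_continuous[OF p that(1)] by (simp add: absolutely_integrable_on_def)
    then show ?thesis by (rule integrable_on_subinterval) (use that in auto)
  qed
  have U_cont: "continuous_on {0..1} (U y)" if "continuous_on {0..1} y" for y
    unfolding U_def by (intro indefinite_integral_continuous_1 py that) auto
  have U_int: "U y integrable_on {0..x}" if "continuous_on {0..1} y" "x \<in> {0..1}" for y x
    using U_cont[OF that(1)] that(2)
    by (intro integrable_continuous_real) (auto intro: continuous_on_subset)
  have V_cont: "continuous_on {0..1} (V y)" if "continuous_on {0..1} y" for y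
    unfolding V_def by (intro indefinite_integral_continuous_1 U_int that) auto
  have V_diff: "V (\<lambda>x. y x - z x) x = V y x - V z x"
    if "continuous_on {0..1} y" "continuous_on {0..1} z" "x \<in> {0..1}" for y z x
  proof -
    have "U (\<lambda>x. y x - z x) t = U y t - U z t" if "t \<in> {0..x}" for t
      using py[OF \<open>continuous_on _ y\<close>, of t] py[OF \<open>continuous_on _ z\<close>, of t] that \<open>x \<in> {0..1}\<close>
      by (simp add: U_def right_diff_distrib integral_diff)
    then have "V (\<lambda>x. y x - z x) x = integral {0..x} (\<lambda>t. U y t - U z t)"
      unfolding V_def by (intro integral_cong) auto
    also have "\<dots> = V y x - V z x"
      unfolding V_def by (intro integral_diff U_int that)
    finally show ?thesis .
  qed
  have V_bound: "norm (V y x) \<le> N / 2 * exp (\<kappa> * x)"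
    if y: "continuous_on {0..1} y" and N: "\<And>t. t \<in> {0..1} \<Longrightarrow> norm (y t) \<le> N * exp (\<kappa> * t)"
      and x: "x \<in> {0..1}" for y N x
  proof -
    have N0: "0 \<le> N" using N[of 0] by simp (meson norm_ge_zero order_trans)
    have Ub: "norm (U y t) \<le> (N * P) * exp (\<kappa> * t)" if t: "t \<in> {0..x}" for t
    proof -
      have sub: "{0..t} \<subseteq> {0..1}" using t x by auto
      have "norm (U y t) \<le> (N * exp (\<kappa> * t)) * integral {0..t} (\<lambda>s. norm (p s))"
        unfolding U_def
      proof (rule norm_integral_mult_le)
        show "p absolutely_integrable_on {0..t}" by (rule absolutely_integrable_subinterval[OF p sub])
        show "continuous_on {0..t} y" using y sub continuous_on_subset by blast
        fix s assume s: "s \<in> {0..t}"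
        have "norm (y s) \<le> N * exp (\<kappa> * s)" using N s sub by blast
        also have "\<dots> \<le> N * exp (\<kappa> * t)" using s N0 \<kappa> by (intro mult_left_mono) auto
        finally show "norm (y s) \<le> N * exp (\<kappa> * t)" .
      qed
      also have "\<dots> \<le> (N * exp (\<kappa> * t)) * P"
        using integral_norm_subinterval_le[OF p sub] N0 unfolding P_def by (intro mult_left_mono) auto
      finally show ?thesis by (simp add: mult_ac)
    qed
    have "norm (V y x) \<le> (N * P) * exp (\<kappa> * x) / \<kappa>"
      unfolding V_def using x \<kappa> N0 P by (intro norm_integral_exp_le U_int y Ub) auto
    also have "\<dots> = (P / \<kappa>) * (N * exp (\<kappa> * x))" by simp
    also have "\<dots> \<le> (1 / 2) * (N * exp (\<kappa> * x))"
      using \<kappa> N0 by (intro mult_right_mono) auto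
    finally show ?thesis by simp
  qed
  define h where "h = (\<lambda>t. integral {0..t} f)"
  have h: "continuous_on {0..1} h"
    unfolding h_def using f by (intro indefinite_integral_continuous_1 integrable_continuous_real)
  define g where "g = (\<lambda>x. a + b * of_real x + integral {0..x} h)"
  have g: "continuous_on {0..1} g"
    unfolding g_def using h
    by (intro continuous_intros indefinite_integral_continuous_1 integrable_continuous_real)
  have "bounded (g ` {0..1})" using g by (intro compact_imp_bounded compact_continuous_image) auto
  then obtain G where G0: "\<And>t. t \<in> {0..1} \<Longrightarrow> norm (g t) \<le> G" "0 < G"
    unfolding bounded_pos by blast
  define Y where "Y n = (V ^^ n) g" for n
  have Y_Suc: "Y (Suc n) = V (Y n)" for n by (simp add: Y_def)
  have Yc: "continuous_on {0..1} (Y n)" for n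
    by (induction n) (auto simp: Y_def g intro: V_cont)
  have Yb: "t \<in> {0..1} \<Longrightarrow> norm (Y n t) \<le> (G / 2 ^ n) * exp (\<kappa> * t)" for n t
  proof (induction n arbitrary: t)
    case 0
    have "norm (g t) \<le> G * 1" using G0 0 by simp
    also have "\<dots> \<le> G * exp (\<kappa> * t)" using 0 G0 \<kappa> by (intro mult_left_mono) auto
    finally show ?case by (simp add: Y_def)
  next
    case (Suc n)
    show ?case using V_bound[OF Yc Suc.IH Suc.prems] by (simp add: Y_Suc mult_ac)
  qed
  define S where "S n = (\<lambda>x. \<Sum>i<n. Y i x)" for n
  have Sc: "continuous_on {0..1} (S n)" for n
    unfolding S_def by (intro continuous_intros Yc)
  define y where "y = (\<lambda>x. \<Sum>i. Y i x)"
  have unif: "uniform_limit {0..1} S y sequentially"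
    unfolding S_def y_def
  proof (rule Weierstrass_m_test)
    fix n and t :: real assume t: "t \<in> {0..1}"
    have "norm (Y n t) \<le> (G / 2 ^ n) * exp (\<kappa> * t)" by (rule Yb[OF t])
    also have "\<dots> \<le> (G / 2 ^ n) * exp \<kappa>" using t G0 \<kappa> by (intro mult_left_mono) auto
    finally show "norm (Y n t) \<le> (G * exp \<kappa>) * (1 / 2) ^ n" by (simp add: power_divide)
  next
    show "summable (\<lambda>n. (G * exp \<kappa>) * (1 / 2 :: real) ^ n)"
      by (intro summable_mult summable_geometric) auto
  qed
  have yc: "continuous_on {0..1} y"
    by (rule uniform_limit_theorem[OF _ unif]) (auto simp: Sc)
  have y_eq: "y x = g x + V y x" if x: "x \<in> {0..1}" for x
  proof -
    have S_step: "S (Suc n) x = g x + V (S n) x" for n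
    proof (induction n)
      case 0
      have "V (S 0) x = 0" by (simp add: V_def U_def S_def)
      then show ?case by (simp add: S_def Y_def)
    next
      case (Suc n)
      have "S n = (\<lambda>t. S (Suc n) t - Y n t)" by (simp add: S_def)
      then have "V (S n) x = V (S (Suc n)) x - V (Y n) x" using V_diff[OF Sc Yc x] by metis
      moreover have "S (Suc (Suc n)) x = S (Suc n) x + Y (Suc n) x" by (simp add: S_def)
      ultimately show ?case using Suc by (simp add: Y_Suc)
    qed
    have "(\<lambda>n. V (S n) x) \<longlonglongrightarrow> V y x"
    proof (rule LIMSEQ_I)
      fix e :: real assume e: "e > 0"
      define d where "d = e * exp (- \<kappa>)"
      have "d > 0" using e by (simp add: d_def)
      then obtain n0 where n0: "\<And>n t. n \<ge> n0 \<Longrightarrow> t \<in> {0..1} \<Longrightarrow> dist (S n t) (y t) < d"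
        using unif unfolding uniform_limit_iff eventually_sequentially by meson
      show "\<exists>n0. \<forall>n\<ge>n0. norm (V (S n) x - V y x) < e"
      proof (intro exI allI impI)
        fix n assume n: "n \<ge> n0"
        have "norm (S n t - y t) \<le> d * exp (\<kappa> * t)" if "t \<in> {0..1}" for t
        proof -
          have "norm (S n t - y t) \<le> d * 1" using n0[OF n that] by (simp add: dist_norm)
          also have "\<dots> \<le> d * exp (\<kappa> * t)" using that \<open>d > 0\<close> \<kappa> by (intro mult_left_mono) auto
          finally show ?thesis .
        qed
        then have "norm (V (\<lambda>t. S n t - y t) x) \<le> d / 2 * exp (\<kappa> * x)"
          by (intro V_bound x continuous_on_diff Sc yc)
        also have "\<dots> \<le> d / 2 * exp \<kappa>" using x \<kappa> \<open>d > 0\<close> by (intro mult_left_mono) auto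
        also have "\<dots> = e / 2" by (simp add: d_def flip: exp_add)
        finally show "norm (V (S n) x - V y x) < e"
          using V_diff[OF Sc yc x] e by simp
      qed
    qed
    then have "(\<lambda>n. g x + V (S n) x) \<longlonglongrightarrow> g x + V y x" by (intro tendsto_intros)
    moreover have "(\<lambda>n. S (Suc n) x) \<longlonglongrightarrow> y x"
      using tendsto_uniform_limitI[OF unif x] by (rule LIMSEQ_Suc)
    ultimately show ?thesis unfolding S_step by (rule LIMSEQ_unique[symmetric])
  qed
  define y1 where "y1 = (\<lambda>x. b + integral {0..x} (\<lambda>t. p t * y t + f t))"
  have "second_deriv y y1 (\<lambda>t. p t * y t + f t)"
  proof (rule second_derivI)
    fix x :: real assume x: "x \<in> {0..1}"
    have "((\<lambda>x. g x + V y x) has_vector_derivative b + h x + U y x) (at x within {0..1})"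
      unfolding g_def V_def
      by (auto intro!: derivative_eq_intros integral_has_vector_derivative h U_cont yc x)
    moreover have "b + h x + U y x = y1 x"
    proof -
      have "f integrable_on {0..x}"
        using f x by (intro integrable_continuous_real) (auto intro: continuous_on_subset)
      then show ?thesis
        using py[OF yc x] by (simp add: y1_def h_def U_def integral_add)
    qed
    ultimately have "((\<lambda>x. g x + V y x) has_vector_derivative y1 x) (at x within {0..1})" by simp
    then show "(y has_vector_derivative y1 x) (at x within {0..1})"
      by (rule has_vector_derivative_transform[OF x y_eq, rotated])
    show "y1 x = y1 0 + integral {0..x} (\<lambda>t. p t * y t + f t)" by (simp add: y1_def)
  next
    show "(\<lambda>t. p t * y t + f t) absolutely_integrable_on {0..1}"
      by (intro set_integral_add(1) absolutely_integrable_mult_continuous[OF p yc]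
          absolutely_integrable_continuous_real f)
  qed
  moreover have "y 0 = a" using y_eq[of 0] by (simp add: g_def V_def)
  moreover have "y1 0 = b" by (simp add: y1_def)
  ultimately show ?thesis using that by blast
qed

section \<open>Power series in the spectral parameter\<close>

definition ivp_sol :: "(real \<Rightarrow> complex) \<Rightarrow> (real \<Rightarrow> complex) \<Rightarrow> complex \<Rightarrow> complex \<Rightarrow>
    (real \<Rightarrow> complex) \<times> (real \<Rightarrow> complex)" where
  "ivp_sol p f a b = (SOME Y. second_deriv (fst Y) (snd Y) (\<lambda>t. p t * fst Y t + f t) \<and>
     fst Y 0 = a \<and> snd Y 0 = b)"

lemma ivp_sol:
  assumes "p absolutely_integrable_on {0..1}" "continuous_on {0..1} f"
  shows "second_deriv (fst (ivp_sol p f a b)) (snd (ivp_sol p f a b))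
           (\<lambda>t. p t * fst (ivp_sol p f a b) t + f t)"
    and "fst (ivp_sol p f a b) 0 = a" "snd (ivp_sol p f a b) 0 = b"
proof -
  obtain y y1 where "second_deriv y y1 (\<lambda>t. p t * y t + f t)" "y 0 = a" "y1 0 = b"
    using ivp_exists[OF assms] by blast
  then have "\<exists>Y. second_deriv (fst Y) (snd Y) (\<lambda>t. p t * fst Y t + f t) \<and> fst Y 0 = a \<and> snd Y 0 = b"
    by (intro exI[of _ "(y, y1)"]) simp
  from someI_ex[OF this]
  show "second_deriv (fst (ivp_sol p f a b)) (snd (ivp_sol p f a b))
           (\<lambda>t. p t * fst (ivp_sol p f a b) t + f t)"
    and "fst (ivp_sol p f a b) 0 = a" "snd (ivp_sol p f a b) 0 = b"
    unfolding ivp_sol_def by blast+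
qed

text \<open>Formally \<open>y\<^sub>\<lambda> = \<Sum>\<^sub>k (\<lambda> - \<mu>)\<^sup>k W\<^sub>k\<close> solves \<open>y'' = (q - \<lambda>) y\<close> if and only if \<open>W\<^sub>0\<close> does so for \<open>\<lambda> = \<mu>\<close> and
  \<open>W\<^bsub>k+1\<^esub>'' = (q - \<mu>) W\<^bsub>k+1\<^esub> - W\<^sub>k\<close>. The initial values are carried by \<open>W\<^sub>0\<close>. These functions are Taylor
  coefficients and, with respect to the differential expression minus \<open>\<mu>\<close>, a Jordan chain at the same time.\<close>

primrec ivp_chain :: "(real \<Rightarrow> complex) \<Rightarrow> complex \<Rightarrow> complex \<Rightarrow> complex \<Rightarrow> nat \<Rightarrow>
    (real \<Rightarrow> complex) \<times> (real \<Rightarrow> complex)" where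
  "ivp_chain q a b \<mu> 0 = ivp_sol (\<lambda>t. q t - \<mu>) (\<lambda>_. 0) a b"
| "ivp_chain q a b \<mu> (Suc k) = ivp_sol (\<lambda>t. q t - \<mu>) (\<lambda>t. - fst (ivp_chain q a b \<mu> k) t) 0 0"

locale potential =
  fixes q :: "real \<Rightarrow> complex"
  assumes q_L1: "q absolutely_integrable_on {0..1}"
begin

text \<open>\<open>Y 1 0 l 0\<close> and \<open>Y 0 1 l 0\<close> are the fundamental solutions for the spectral parameter \<open>l\<close>, and \<open>Y'\<close> holds
  their derivatives; a larger last index gives the Taylor coefficients with respect to \<open>l\<close>.\<close>

definition Y :: "complex \<Rightarrow> complex \<Rightarrow> complex \<Rightarrow> nat \<Rightarrow> real \<Rightarrow> complex" where
  "Y a b \<mu> k = fst (ivp_chain q a b \<mu> k)"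

definition Y' :: "complex \<Rightarrow> complex \<Rightarrow> complex \<Rightarrow> nat \<Rightarrow> real \<Rightarrow> complex" where
  "Y' a b \<mu> k = snd (ivp_chain q a b \<mu> k)"

lemma q_minus_L1: "(\<lambda>t. q t - \<mu>) absolutely_integrable_on {0..1}"
  by (rule set_integral_diff(1)[OF q_L1 absolutely_integrable_continuous_real[OF continuous_on_const]])

lemma Y_base:
  "second_deriv (Y a b \<mu> 0) (Y' a b \<mu> 0) (\<lambda>t. (q t - \<mu>) * Y a b \<mu> 0 t)"
  "Y a b \<mu> 0 0 = a" "Y' a b \<mu> 0 0 = b"
  using ivp_sol[OF q_minus_L1[of \<mu>], of "\<lambda>_. 0" a b] by (simp_all add: Y_def Y'_def)

lemma Y_continuous: "continuous_on {0..1} (Y a b \<mu> k)"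
proof (induction k)
  case 0
  show ?case by (rule second_deriv_continuous(1)[OF Y_base(1)])
next
  case (Suc k)
  then have "continuous_on {0..1} (\<lambda>t. - Y a b \<mu> k t)" by (intro continuous_intros)
  from second_deriv_continuous(1)[OF ivp_sol(1)[OF q_minus_L1 this]]
  show ?case by (simp add: Y_def)
qed

lemma Y_step:
  "second_deriv (Y a b \<mu> (Suc k)) (Y' a b \<mu> (Suc k))
     (\<lambda>t. (q t - \<mu>) * Y a b \<mu> (Suc k) t + - Y a b \<mu> k t)"
  "Y a b \<mu> (Suc k) 0 = 0" "Y' a b \<mu> (Suc k) 0 = 0"
proof -
  have "continuous_on {0..1} (\<lambda>t. - Y a b \<mu> k t)" using Y_continuous by (intro continuous_intros)
  from ivp_sol[OF q_minus_L1[of \<mu>] this, of 0 0]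
  show "second_deriv (Y a b \<mu> (Suc k)) (Y' a b \<mu> (Suc k))
     (\<lambda>t. (q t - \<mu>) * Y a b \<mu> (Suc k) t + - Y a b \<mu> k t)"
  "Y a b \<mu> (Suc k) 0 = 0" "Y' a b \<mu> (Suc k) 0 = 0"
    by (simp_all add: Y_def Y'_def)
qed

text \<open>The defining equations of the chain telescope: a partial sum solves the equation for \<open>l\<close> up to a single
  term, which is small for \<open>l\<close> near \<open>\<mu>\<close>.\<close>

lemma Y_partial_sum:
  "second_deriv (\<lambda>t. \<Sum>k\<le>K. (l - \<mu>) ^ k * Y a b \<mu> k t) (\<lambda>t. \<Sum>k\<le>K. (l - \<mu>) ^ k * Y' a b \<mu> k t)
     (\<lambda>t. (q t - l) * (\<Sum>k\<le>K. (l - \<mu>) ^ k * Y a b \<mu> k t) + (l - \<mu>) ^ Suc K * Y a b \<mu> K t)"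
proof (induction K)
  case 0
  show ?case by (rule second_deriv_cong[OF Y_base(1)[of a b \<mu>]]) (auto simp: algebra_simps)
next
  case (Suc K)
  show ?case
    by (rule second_deriv_cong[OF second_deriv_add[OF Suc
            second_deriv_scale[OF Y_step(1)[of a b \<mu> K], of "(l - \<mu>) ^ Suc K"]]])
       (auto simp: algebra_simps)
qed

text \<open>The remainder solves an inhomogeneous problem with zero initial values whose right-hand side is at most
  of order \<open>2\<^bsup>-K\<^esup>\<close>, so the a priori bound sends it to zero.\<close>

lemma Y_sums:
  assumes l: "norm (l - \<mu>) < 1" and x: "x \<in> {0..1}"
  shows "(\<lambda>k. (l - \<mu>) ^ k * Y a b \<mu> k x) sums Y a b l 0 x"
    and "(\<lambda>k. (l - \<mu>) ^ k * Y' a b \<mu> k x) sums Y' a b l 0 x"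
proof -
  define P where "P = integral {0..1} (\<lambda>t. norm (q t - \<mu>))"
  have P: "0 \<le> P" unfolding P_def
    using q_minus_L1 by (intro integral_nonneg) (auto simp: absolutely_integrable_on_def)
  \<comment> \<open>Large enough for both potentials \<open>q - \<mu>\<close> and \<open>q - l\<close>, and \<open>\<kappa>\<^sup>2 \<ge> 4\<close> halves each step of the chain.\<close>
  define \<kappa> where "\<kappa> = 2 * (P + 1) + 2"
  have \<kappa>: "1 \<le> \<kappa>" "2 * P \<le> \<kappa>" "4 \<le> \<kappa>^2" using P power_mono[of 2 \<kappa> 2] by (auto simp: \<kappa>_def)
  have Pl: "2 * integral {0..1} (\<lambda>t. norm (q t - l)) \<le> \<kappa>"
  proof -
    have "integral {0..1} (\<lambda>t. norm (q t - l)) \<le> integral {0..1} (\<lambda>t. norm (q t - \<mu>) + 1)"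
    proof (rule integral_le)
      show "(\<lambda>t. norm (q t - l)) integrable_on {0..1}" "(\<lambda>t. norm (q t - \<mu>) + 1) integrable_on {0..1}"
        using q_minus_L1 by (auto simp: absolutely_integrable_on_def intro!: integrable_add)
      fix t show "norm (q t - l) \<le> norm (q t - \<mu>) + 1"
        using norm_triangle_ineq4[of "q t - \<mu>" "l - \<mu>"] l by simp
    qed
    also have "\<dots> = P + 1"
      using q_minus_L1 unfolding P_def
      by (subst integral_add) (auto simp: absolutely_integrable_on_def)
    finally show ?thesis by (simp add: \<kappa>_def)
  qed
  define N where "N = 2 * (norm a + norm b)"
  have N0: "0 \<le> N" by (simp add: N_def)
  have Yb: "t \<in> {0..1} \<Longrightarrow> norm (Y a b \<mu> k t) \<le> N / 2 ^ k * exp (\<kappa> * t)" for k t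
  proof (induction k arbitrary: t)
    case 0
    have sd: "second_deriv (Y a b \<mu> 0) (Y' a b \<mu> 0) (\<lambda>t. (q t - \<mu>) * Y a b \<mu> 0 t + 0)"
      using Y_base(1) by simp
    have "norm (Y a b \<mu> 0 t) \<le> 2 * (norm (Y a b \<mu> 0 0) + norm (Y' a b \<mu> 0 0) + 0 / \<kappa>\<^sup>2) * exp (\<kappa> * t)"
      by (rule ivp_bound(1)[OF q_minus_L1 sd]) (use \<kappa> 0 in \<open>auto simp: P_def\<close>)
    then show ?case by (simp add: Y_base N_def)
  next
    case (Suc k)
    have "norm (Y a b \<mu> (Suc k) t) \<le> 2 * (norm (Y a b \<mu> (Suc k) 0) + norm (Y' a b \<mu> (Suc k) 0)
            + (N / 2 ^ k) / \<kappa>\<^sup>2) * exp (\<kappa> * t)"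
      by (rule ivp_bound(1)[OF q_minus_L1 Y_step(1)])
         (use \<kappa> Suc in \<open>auto simp: P_def intro!: continuous_intros Y_continuous\<close>)
    also have "\<dots> = 2 * ((N / 2 ^ k) / \<kappa>\<^sup>2) * exp (\<kappa> * t)" by (simp add: Y_step)
    also have "\<dots> \<le> 2 * ((N / 2 ^ k) / 4) * exp (\<kappa> * t)"
      using \<kappa> N0 by (intro mult_right_mono mult_left_mono divide_left_mono) auto
    finally show ?case by simp
  qed
  define R where "R K t = Y a b l 0 t - (\<Sum>k\<le>K. (l - \<mu>) ^ k * Y a b \<mu> k t)" for K t
  define R1 where "R1 K t = Y' a b l 0 t - (\<Sum>k\<le>K. (l - \<mu>) ^ k * Y' a b \<mu> k t)" for K t
  have R0: "R K 0 = 0" for K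
    unfolding R_def by (induction K) (auto simp: Y_base Y_step)
  have R10: "R1 K 0 = 0" for K
    unfolding R1_def by (induction K) (auto simp: Y_base Y_step)
  have sdR: "second_deriv (R K) (R1 K) (\<lambda>t. (q t - l) * R K t + - ((l - \<mu>) ^ Suc K * Y a b \<mu> K t))" for K
    by (rule second_deriv_cong[OF second_deriv_add[OF Y_base(1)[of a b l]
            second_deriv_scale[OF Y_partial_sum[where K = K and a = a and b = b and \<mu> = \<mu> and l = l], of "-1"]]])
       (auto simp: R_def R1_def algebra_simps)
  have F: "norm (- ((l - \<mu>) ^ Suc K * Y a b \<mu> K t)) \<le> N / 2 ^ K * exp (\<kappa> * t)" if "t \<in> {0..1}" for K t
  proof -
    have "norm (l - \<mu>) ^ Suc K \<le> 1" using l by (intro power_le_one) auto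
    then have "norm (l - \<mu>) ^ Suc K * norm (Y a b \<mu> K t) \<le> 1 * norm (Y a b \<mu> K t)"
      by (intro mult_right_mono) auto
    then show ?thesis using Yb[OF that, of K] by (simp add: norm_mult norm_power)
  qed
  have cF: "continuous_on {0..1} (\<lambda>t. - ((l - \<mu>) ^ Suc K * Y a b \<mu> K t))" for K
    by (intro continuous_intros Y_continuous)
  have Rb: "norm (R K x) \<le> 2 * (norm (R K 0) + norm (R1 K 0) + (N / 2 ^ K) / \<kappa>\<^sup>2) * exp (\<kappa> * x)"
    and R1b: "norm (R1 K x) \<le> 2 * \<kappa> * (norm (R K 0) + norm (R1 K 0) + (N / 2 ^ K) / \<kappa>\<^sup>2) * exp (\<kappa> * x)" for K
    by (rule ivp_bound[OF q_minus_L1 sdR cF F \<kappa>(1) Pl x]; simp)+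
  have lim: "(\<lambda>K. c * (N / 2 ^ K) / \<kappa>\<^sup>2 * exp (\<kappa> * x)) \<longlonglongrightarrow> 0" for c :: real
    using tendsto_mult_right_zero[OF LIMSEQ_power_zero[of "1 / 2 :: real"],
        of "c * N / \<kappa>\<^sup>2 * exp (\<kappa> * x)"]
    by (simp add: field_simps power_divide)
  have "(\<lambda>K. R K x) \<longlonglongrightarrow> 0"
    by (rule Lim_null_comparison[OF _ lim[of 2]]) (use Rb in \<open>simp add: R0 R10\<close>)
  from tendsto_diff[OF tendsto_const[of "Y a b l 0 x"] this]
  show "(\<lambda>k. (l - \<mu>) ^ k * Y a b \<mu> k x) sums Y a b l 0 x"
    by (simp add: R_def sums_def_le)
  have "(\<lambda>K. R1 K x) \<longlonglongrightarrow> 0"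
    by (rule Lim_null_comparison[OF _ lim[of "2 * \<kappa>"]]) (use R1b in \<open>simp add: R0 R10\<close>)
  from tendsto_diff[OF tendsto_const[of "Y' a b l 0 x"] this]
  show "(\<lambda>k. (l - \<mu>) ^ k * Y' a b \<mu> k x) sums Y' a b l 0 x"
    by (simp add: R1_def sums_def_le)
qed

lemma Y_has_fps_expansion:
  assumes x: "x \<in> {0..1}"
  shows "(\<lambda>u. Y a b (\<mu> + u) 0 x) has_fps_expansion Abs_fps (\<lambda>k. Y a b \<mu> k x)"
    and "(\<lambda>u. Y' a b (\<mu> + u) 0 x) has_fps_expansion Abs_fps (\<lambda>k. Y' a b \<mu> k x)"
proof -
  have ev: "eventually (\<lambda>u :: complex. norm u < 1) (nhds 0)"
    using eventually_nhds_in_open[of "ball (0::complex) 1" 0] by (simp add: dist_norm)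
  show "(\<lambda>u. Y a b (\<mu> + u) 0 x) has_fps_expansion Abs_fps (\<lambda>k. Y a b \<mu> k x)"
    using ev
    by (intro has_fps_expansionI, elim eventually_mono)
       (use Y_sums(1)[OF _ x, of "\<mu> + u" \<mu> a b for u] in \<open>simp add: mult.commute\<close>)
  show "(\<lambda>u. Y' a b (\<mu> + u) 0 x) has_fps_expansion Abs_fps (\<lambda>k. Y' a b \<mu> k x)"
    using ev
    by (intro has_fps_expansionI, elim eventually_mono)
       (use Y_sums(2)[OF _ x, of "\<mu> + u" \<mu> a b for u] in \<open>simp add: mult.commute\<close>)
qed

end

section \<open>Products, the Wronskian and uniqueness\<close>

text \<open>Increments bounded by \<open>(b - a)\<close> times an increment of a continuous function are \<open>o(b - a)\<close>, so \<open>H\<close> has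
  derivative zero everywhere. This replaces differentiation almost everywhere for the product rule
  below.\<close>

lemma constant_if_increment_le:
  fixes H :: "real \<Rightarrow> complex" and \<Phi> :: "real \<Rightarrow> real"
  assumes \<Phi>: "continuous_on {0..1} \<Phi>"
    and le: "\<And>a b. 0 \<le> a \<Longrightarrow> a \<le> b \<Longrightarrow> b \<le> 1 \<Longrightarrow> norm (H b - H a) \<le> (b - a) * (K * (\<Phi> b - \<Phi> a))"
    and x: "x \<in> {0..1}"
  shows "H x = H 0"
proof -
  have le': "norm (H v - H u) \<le> \<bar>v - u\<bar> * (\<bar>K\<bar> * \<bar>\<Phi> v - \<Phi> u\<bar>)"
    if uv: "u \<in> {0..1}" "v \<in> {0..1}" for u v
  proof -
    have "(b - a) * (K * (\<Phi> b - \<Phi> a)) \<le> \<bar>b - a\<bar> * (\<bar>K\<bar> * \<bar>\<Phi> b - \<Phi> a\<bar>)" for a b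
      by (metis abs_ge_self abs_mult)
    note * = order_trans[OF le this]
    show ?thesis
    proof (cases "u \<le> v")
      case True
      then show ?thesis using *[of u v] uv by simp
    next
      case False
      then show ?thesis using *[of v u] uv by (simp add: norm_minus_commute abs_minus_commute)
    qed
  qed
  have deriv: "(H has_vector_derivative 0) (at u within {0..1})" if u: "u \<in> {0..1}" for u
  proof -
    have "((\<lambda>v. \<Phi> v) \<longlongrightarrow> \<Phi> u) (at u within {0..1})"
      using \<Phi> u by (simp add: continuous_on)
    then have "((\<lambda>v. \<bar>K\<bar> * \<bar>\<Phi> v - \<Phi> u\<bar>) \<longlongrightarrow> \<bar>K\<bar> * \<bar>\<Phi> u - \<Phi> u\<bar>) (at u within {0..1})"
      by (intro tendsto_intros)
    then have "((\<lambda>v. \<bar>K\<bar> * \<bar>\<Phi> v - \<Phi> u\<bar>) \<longlongrightarrow> 0) (at u within {0..1})"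
      by simp
    then have "((\<lambda>v. norm (H v - H u - (v - u) *\<^sub>R 0) / norm (v - u)) \<longlongrightarrow> 0) (at u within {0..1})"
    proof (rule Lim_null_comparison[rotated])
      show "\<forall>\<^sub>F v in at u within {0..1}. norm (norm (H v - H u - (v - u) *\<^sub>R 0) / norm (v - u)) \<le> \<bar>K\<bar> * \<bar>\<Phi> v - \<Phi> u\<bar>"
        unfolding eventually_at_filter
        by (rule always_eventually) (use le'[OF u] in \<open>auto simp: divide_le_eq mult.commute\<close>)
    qed
    then show ?thesis
      unfolding has_vector_derivative_def has_derivative_iff_norm by simp
  qed
  have "(H has_derivative (\<lambda>h. 0)) (at u within {0..1})" if "u \<in> {0..1}" for u
    using deriv[OF that] by (simp add: has_vector_derivative_def)
  then obtain c where "\<And>u. u \<in> {0..1} \<Longrightarrow> H u = c"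
    using has_derivative_zero_constant[of "{0..1::real}" H] by auto
  then show ?thesis using x by simp
qed

text \<open>Integration by parts for an absolutely continuous \<open>y1\<close> and a continuously differentiable \<open>g\<close>. On a short
  interval both factors may be frozen at an endpoint, with an error of the kind covered by
  \<open>constant_if_increment_le\<close>.\<close>

lemma second_deriv_product:
  assumes sd: "second_deriv y y1 h"
    and g: "\<And>x. x \<in> {0..1} \<Longrightarrow> (g has_vector_derivative g1 x) (at x within {0..1})"
    and g1: "continuous_on {0..1} g1" and x: "x \<in> {0..1}"
  shows "y1 x * g x = y1 0 * g 0 + integral {0..x} (\<lambda>t. h t * g t + y1 t * g1 t)"
proof -
  note cont = second_deriv_continuous[OF sd]
  have gc: "continuous_on {0..1} g"
    using g by (meson continuous_on_eq_continuous_within has_vector_derivative_continuous)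
  have "bounded (g1 ` {0..1})" using g1 by (intro compact_imp_bounded compact_continuous_image) auto
  then obtain L where L: "\<And>t. t \<in> {0..1} \<Longrightarrow> norm (g1 t) \<le> L" "0 < L"
    unfolding bounded_pos by blast
  have hI: "h absolutely_integrable_on {0..1}" by (rule second_derivD(2)[OF sd])
  have nhI: "(\<lambda>t. norm (h t)) integrable_on {0..1}" using hI by (simp add: absolutely_integrable_on_def)
  define F where "F = (\<lambda>t. h t * g t + y1 t * g1 t)"
  have I1: "(\<lambda>t. h t * g t) integrable_on {0..1}"
    using absolutely_integrable_mult_continuous[OF hI gc] by (simp add: absolutely_integrable_on_def)
  have I2: "(\<lambda>t. y1 t * g1 t) integrable_on {0..1}"
    using cont g1 by (intro integrable_continuous_real continuous_intros)
  have FI: "F integrable_on {0..1}" unfolding F_def by (rule integrable_add[OF I1 I2])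
  define H where "H = (\<lambda>x. y1 x * g x - integral {0..x} F)"
  define \<Phi> where "\<Phi> = (\<lambda>x. integral {0..x} (\<lambda>t. norm (h t)))"
  have "H x = H 0"
  proof (rule constant_if_increment_le[OF _ _ x, where \<Phi> = \<Phi> and K = "2 * L"])
    show "continuous_on {0..1} \<Phi>" unfolding \<Phi>_def by (rule indefinite_integral_continuous_1[OF nhI])
  next
    fix a b :: real assume ab: "0 \<le> a" "a \<le> b" "b \<le> 1"
    have sub: "{a..b} \<subseteq> {0..1}" using ab by auto
    have comb: "integral {0..v} f - integral {0..u} f = integral {u..v} f"
      if "f integrable_on {0..1}" "0 \<le> u" "u \<le> v" "v \<le> 1" for u v and f :: "real \<Rightarrow> 'a :: banach"
    proof -
      have "f integrable_on {0..v}" using that(1) by (rule integrable_on_subinterval) (use that in auto)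
      from Henstock_Kurzweil_Integration.integral_combine[OF that(2,3) this] show ?thesis by (simp add: algebra_simps)
    qed
    have y1d: "y1 v - y1 u = integral {u..v} h" if "0 \<le> u" "u \<le> v" "v \<le> 1" for u v
    proof -
      have "y1 v - y1 u = integral {0..v} h - integral {0..u} h"
        using second_derivD(4)[OF sd, of v] second_derivD(4)[OF sd, of u] that by simp
      then show ?thesis using comb[OF second_derivD(3)[OF sd] that] by simp
    qed
    have gd: "g v - g u = integral {u..v} g1" if "0 \<le> u" "u \<le> v" "v \<le> 1" for u v
    proof -
      have "(g1 has_integral (g v - g u)) {u..v}"
      proof (rule fundamental_theorem_of_calculus[OF that(2)])
        fix t assume t: "t \<in> {u..v}"
        then show "(g has_vector_derivative g1 t) (at t within {u..v})"
          using g[of t] that by (auto intro: has_vector_derivative_within_subset)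
      qed
      then show ?thesis by (simp add: integral_unique)
    qed
    define \<phi> where "\<phi> = integral {a..b} (\<lambda>t. norm (h t))"
    have \<phi>0: "0 \<le> \<phi>" unfolding \<phi>_def
      by (intro integral_nonneg integrable_on_subinterval[OF nhI sub]) auto
    have \<phi>: "\<phi> = \<Phi> b - \<Phi> a" unfolding \<phi>_def \<Phi>_def by (rule comb[OF nhI ab, symmetric])
    have hab: "h absolutely_integrable_on {a..b}" by (rule absolutely_integrable_subinterval[OF hI sub])
    have cab: "continuous_on {a..b} g" "continuous_on {a..b} g1" "continuous_on {a..b} y1"
      using gc g1 cont sub continuous_on_subset by blast+
    have gL: "norm (g b - g t) \<le> L * (b - a)" if "t \<in> {a..b}" for t
    proof -
      have "continuous_on {t..b} g1" using cab(2) by (rule continuous_on_subset) (use that in auto)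
      then have "norm (integral {t..b} g1) \<le> integral {t..b} (\<lambda>_. L)"
        by (intro integral_norm_bound_integral integrable_continuous_real continuous_intros L(1))
           (use that ab in auto)
      then have "norm (g b - g t) \<le> integral {t..b} (\<lambda>_. L)"
        using gd[of t b] that ab by simp
      also have "\<dots> = L * (b - t)" using that by simp
      also have "\<dots> \<le> L * (b - a)" using that L by (intro mult_left_mono) auto
      finally show ?thesis .
    qed
    have 1: "norm (integral {a..b} (\<lambda>t. h t * (g b - g t))) \<le> L * (b - a) * \<phi>"
      unfolding \<phi>_def by (rule norm_integral_mult_le[OF hab _ gL]) (intro continuous_intros cab)
    have y1\<phi>: "norm (y1 a - y1 t) \<le> \<phi>" if t: "t \<in> {a..b}" for t
    proof -
      have "h absolutely_integrable_on {a..t}"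
        using t ab by (intro absolutely_integrable_subinterval[OF hI]) auto
      then have "norm (integral {a..t} h) \<le> integral {a..t} (\<lambda>t. norm (h t))"
        by (intro integral_norm_bound_integral) (simp_all add: absolutely_integrable_on_def)
      then have "norm (y1 t - y1 a) \<le> integral {a..t} (\<lambda>t. norm (h t))"
        using y1d[of a t] t ab by simp
      also have "\<dots> \<le> \<phi>" unfolding \<phi>_def using t by (intro integral_norm_subinterval_le[OF hab]) auto
      finally show ?thesis by (simp add: norm_minus_commute)
    qed
    have "norm (integral {a..b} (\<lambda>t. g1 t * (y1 a - y1 t))) \<le> \<phi> * integral {a..b} (\<lambda>t. norm (g1 t))"
      using cab by (intro norm_integral_mult_le y1\<phi> absolutely_integrable_continuous_real continuous_intros)
    also have "\<dots> \<le> \<phi> * integral {a..b} (\<lambda>t. L)"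
      using sub by (intro mult_left_mono[OF _ \<phi>0] integral_le integrable_continuous_real continuous_intros cab L) auto
    finally have 2: "norm (integral {a..b} (\<lambda>t. g1 t * (y1 a - y1 t))) \<le> L * (b - a) * \<phi>"
      using ab by (simp add: mult_ac)
    have J: "(\<lambda>t. h t * g t) integrable_on {a..b}" "(\<lambda>t. y1 t * g1 t) integrable_on {a..b}"
       "h integrable_on {a..b}" "g1 integrable_on {a..b}"
      using integrable_on_subinterval[OF I1 sub] integrable_on_subinterval[OF I2 sub]
        hab cab(2) integrable_continuous_real by (simp_all add: absolutely_integrable_on_def)
    have e1: "integral {a..b} (\<lambda>t. h t * (g b - g t)) = (y1 b - y1 a) * g b - integral {a..b} (\<lambda>t. h t * g t)"
      using J by (simp add: right_diff_distrib integral_diff y1d[OF ab] integrable_on_mult_left)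
    have e2: "integral {a..b} (\<lambda>t. g1 t * (y1 a - y1 t)) = (g b - g a) * y1 a - integral {a..b} (\<lambda>t. y1 t * g1 t)"
      using J by (simp add: right_diff_distrib integral_diff gd[OF ab] integrable_on_mult_left mult.commute)
    have e3: "integral {0..b} F = integral {0..a} F
        + (integral {a..b} (\<lambda>t. h t * g t) + integral {a..b} (\<lambda>t. y1 t * g1 t))"
      using comb[OF FI ab] J by (simp add: F_def integral_add algebra_simps)
    have e4: "H b - H a = integral {a..b} (\<lambda>t. h t * (g b - g t)) + integral {a..b} (\<lambda>t. g1 t * (y1 a - y1 t))"
      unfolding e1 e2 H_def e3 by (simp add: algebra_simps)
    have "norm (H b - H a) \<le> L * (b - a) * \<phi> + L * (b - a) * \<phi>"
      unfolding e4 by (rule norm_triangle_mono[OF 1 2])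
    then show "norm (H b - H a) \<le> (b - a) * (2 * L * (\<Phi> b - \<Phi> a))"
      by (simp add: \<phi> algebra_simps)
  qed
  then show ?thesis by (simp add: H_def F_def algebra_simps)
qed

lemma (in potential) wronskian:
  assumes x: "x \<in> {0..1}"
  shows "Y 1 0 l 0 x * Y' 0 1 l 0 x - Y' 1 0 l 0 x * Y 0 1 l 0 x = 1"
proof -
  note C = Y_base[of 1 0 l] and S = Y_base[of 0 1 l]
  have "Y' 0 1 l 0 x * Y 1 0 l 0 x = Y' 0 1 l 0 0 * Y 1 0 l 0 0 +
      integral {0..x} (\<lambda>t. (q t - l) * Y 0 1 l 0 t * Y 1 0 l 0 t + Y' 0 1 l 0 t * Y' 1 0 l 0 t)"
    by (rule second_deriv_product[OF S(1) second_derivD(1)[OF C(1)] second_deriv_continuous(2)[OF C(1)] x])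
  moreover have "Y' 1 0 l 0 x * Y 0 1 l 0 x = Y' 1 0 l 0 0 * Y 0 1 l 0 0 +
      integral {0..x} (\<lambda>t. (q t - l) * Y 1 0 l 0 t * Y 0 1 l 0 t + Y' 1 0 l 0 t * Y' 0 1 l 0 t)"
    by (rule second_deriv_product[OF C(1) second_derivD(1)[OF S(1)] second_deriv_continuous(2)[OF S(1)] x])
  ultimately show ?thesis using C S by (simp add: mult_ac)
qed

text \<open>The difference of the two sides has zero initial values.\<close>

lemma (in potential) ivp_homogeneous:
  assumes sd: "second_deriv y y1 (\<lambda>t. (q t - l) * y t)" and x: "x \<in> {0..1}"
  shows "y x = y 0 * Y 1 0 l 0 x + y1 0 * Y 0 1 l 0 x"
    and "y1 x = y 0 * Y' 1 0 l 0 x + y1 0 * Y' 0 1 l 0 x"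
proof -
  note C = Y_base[of 1 0 l] and S = Y_base[of 0 1 l]
  define v where "v = (\<lambda>x. y x + (- y 0 * Y 1 0 l 0 x + - y1 0 * Y 0 1 l 0 x))"
  define v1 where "v1 = (\<lambda>x. y1 x + (- y 0 * Y' 1 0 l 0 x + - y1 0 * Y' 0 1 l 0 x))"
  have "second_deriv v v1 (\<lambda>t. (q t - l) * v t)"
    by (rule second_deriv_cong[OF second_deriv_add[OF sd second_deriv_add[OF
            second_deriv_scale[OF C(1), of "- y 0"] second_deriv_scale[OF S(1), of "- y1 0"]]]])
       (auto simp: v_def v1_def algebra_simps)
  moreover have "v 0 = 0" "v1 0 = 0" using C S by (auto simp: v_def v1_def)
  ultimately have "v x = 0" "v1 x = 0" using ivp_unique_zero[OF q_minus_L1 _ _ _ x] by blast+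
  moreover have "v x = y x - (y 0 * Y 1 0 l 0 x + y1 0 * Y 0 1 l 0 x)"
    "v1 x = y1 x - (y 0 * Y' 1 0 l 0 x + y1 0 * Y' 0 1 l 0 x)"
    by (simp_all add: v_def v1_def)
  ultimately show "y x = y 0 * Y 1 0 l 0 x + y1 0 * Y 0 1 l 0 x"
    "y1 x = y 0 * Y' 1 0 l 0 x + y1 0 * Y' 0 1 l 0 x"
    by simp_all
qed

section \<open>The characteristic function and Jordan chains\<close>

lemma L2_eq_imp_negligible:
  assumes "L2_eq f g"
  obtains N where "negligible N" "\<And>x. x \<in> {0..1} - N \<Longrightarrow> f x = g x"
proof -
  have "AE x in lebesgue. x \<in> {0..1} \<longrightarrow> f x = g x"
    using assms unfolding L2_eq_def by (subst (asm) AE_restrict_space_iff) auto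
  then obtain N where "N \<in> null_sets lebesgue" "{x. \<not> (x \<in> {0..1} \<longrightarrow> f x = g x)} \<subseteq> N"
    by (auto simp: eventually_ae_filter)
  then show ?thesis using that[of N] negligible_iff_null_sets by blast
qed

lemma continuous_imp_L2:
  assumes "continuous_on {0..1} f"
  shows "f \<in> L2"
  unfolding L2_def
proof (intro CollectI conjI)
  show "f \<in> borel_measurable (lebesgue_on {0..1})"
    using assms by (intro continuous_imp_measurable_on_sets_lebesgue) auto
  show "(\<lambda>x. (cmod (f x))\<^sup>2) absolutely_integrable_on {0..1}"
    using assms by (intro absolutely_integrable_continuous_real continuous_intros)
qed

locale T1_operator = potential +
  fixes \<beta> :: complex
  assumes \<beta>_ne: "\<beta> \<noteq> 1" "\<beta> \<noteq> -1"
begin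

text \<open>The boundary determinant, already simplified by means of the Wronskian.\<close>

definition char_fun :: "complex \<Rightarrow> complex" where
  "char_fun l = 1 - \<beta> + \<beta> * Y' 0 1 l 0 1 - Y 1 0 l 0 1"

lemma char_fun_holomorphic: "char_fun holomorphic_on UNIV"
proof -
  have an: "f analytic_on {\<mu>}" if "(\<lambda>u. f (\<mu> + u)) has_fps_expansion F" for f :: "complex \<Rightarrow> complex" and \<mu> F
    using has_fps_expansion_imp_analytic[OF that] .
  have "(\<lambda>l. Y 1 0 l 0 1) analytic_on {\<mu>}" "(\<lambda>l. Y' 0 1 l 0 1) analytic_on {\<mu>}" for \<mu>
    by (rule an[OF Y_has_fps_expansion(1)] an[OF Y_has_fps_expansion(2)]; simp)+
  then have "(\<lambda>l. 1 - \<beta> + \<beta> * Y' 0 1 l 0 1 - Y 1 0 l 0 1) analytic_on {\<mu>}" for \<mu>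
    by (intro analytic_intros)
  then have "char_fun analytic_on UNIV"
    unfolding char_fun_def[abs_def] by (subst analytic_on_analytic_at) blast
  then show ?thesis by (rule analytic_imp_holomorphic)
qed

definition bc1 :: "(real \<Rightarrow> complex) \<Rightarrow> complex" where "bc1 y = y 0 - y 1"

definition bc2 :: "(real \<Rightarrow> complex) \<Rightarrow> complex" where "bc2 y1 = y1 0 + \<beta> * y1 1"

text \<open>For continuous \<open>z\<close> the \<open>L\<^sub>2\<close>-classes in the definition of the operator can be dispensed with: the second
  derivative may be changed on a null set to satisfy the equation pointwise.\<close>

lemma T1_graph_iff:
  assumes z: "continuous_on {0..1} z"
  shows "T1_graph q \<beta> y (cfun_scale \<mu> y + z) \<longleftrightarrow>
    (\<forall>x. x \<notin> {0..1} \<longrightarrow> y x = 0) \<and>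
    (\<exists>y1. second_deriv y y1 (\<lambda>t. (q t - \<mu>) * y t - z t) \<and> bc1 y = 0 \<and> bc2 y1 = 0)"
  (is "?L \<longleftrightarrow> ?R")
proof
  assume ?L
  then obtain y1 y2 where supp: "\<forall>x. x \<notin> {0..1} \<longrightarrow> y x = 0"
    and d: "\<And>x. x\<in>{0..1} \<Longrightarrow> (y has_vector_derivative y1 x) (at x within {0..1})"
    and y2: "y2 absolutely_integrable_on {0..1}" "\<And>x. x\<in>{0..1} \<Longrightarrow> y1 x = y1 0 + integral {0..x} y2"
    and bc: "y1 0 + \<beta> * y1 1 = 0" "y 0 - y 1 = 0"
    and eq: "L2_eq (cfun_scale \<mu> y + z) (\<lambda>x. - y2 x + q x * y x)"
    unfolding T1_graph_def by blast
  obtain N where N: "negligible N"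
    "\<And>x. x \<in> {0..1} - N \<Longrightarrow> (cfun_scale \<mu> y + z) x = - y2 x + q x * y x"
    using L2_eq_imp_negligible[OF eq] by blast
  have h: "(q x - \<mu>) * y x - z x = y2 x" if "x \<in> {0..1} - N" for x
    using N(2)[OF that] by (simp add: cfun_scale_def algebra_simps)
  have "second_deriv y y1 (\<lambda>t. (q t - \<mu>) * y t - z t)"
  proof (rule second_derivI[OF d])
    show "(\<lambda>t. (q t - \<mu>) * y t - z t) absolutely_integrable_on {0..1}"
      using absolutely_integrable_spike[OF y2(1) N(1) h] .
  next
    fix x :: real assume x: "x \<in> {0..1}"
    have "integral {0..x} y2 = integral {0..x} (\<lambda>t. (q t - \<mu>) * y t - z t)"
      by (rule integral_spike[OF N(1)]) (use h x in auto)
    then show "y1 x = y1 0 + integral {0..x} (\<lambda>t. (q t - \<mu>) * y t - z t)" using y2(2)[OF x] by simp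
  qed
  then show ?R using supp bc unfolding bc1_def bc2_def by blast
next
  assume ?R
  then obtain y1 where supp: "\<forall>x. x \<notin> {0..1} \<longrightarrow> y x = 0"
    and sd: "second_deriv y y1 (\<lambda>t. (q t - \<mu>) * y t - z t)" and bc: "bc1 y = 0" "bc2 y1 = 0" by blast
  have "continuous_on {0..1} (cfun_scale \<mu> y + z)"
    unfolding cfun_scale_def plus_fun_def
    using second_deriv_continuous(1)[OF sd] z by (intro continuous_intros)
  then have L2: "cfun_scale \<mu> y + z \<in> L2" by (rule continuous_imp_L2)
  have "L2_eq (cfun_scale \<mu> y + z) (\<lambda>x. - ((q x - \<mu>) * y x - z x) + q x * y x)"
    by (simp add: L2_eq_def cfun_scale_def algebra_simps)
  with supp sd bc L2 show ?L
    unfolding T1_graph_def second_deriv_def bc1_def bc2_def by blast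
qed

lemma T1_ker_continuous: "z \<in> T1_ker q \<beta> \<mu> k \<Longrightarrow> continuous_on {0..1} z"
proof (cases k)
  case (Suc j)
  assume "z \<in> T1_ker q \<beta> \<mu> k"
  then obtain w where "T1_graph q \<beta> z w" using Suc by auto
  then show ?thesis
    unfolding T1_graph_def by (meson continuous_on_eq_continuous_within has_vector_derivative_continuous)
qed (simp add: zero_fun_def)

definition Y_fps :: "complex \<Rightarrow> complex \<Rightarrow> complex \<Rightarrow> real \<Rightarrow> complex fps" where
  "Y_fps a b \<mu> x = Abs_fps (\<lambda>k. Y a b \<mu> k x)"

definition Y'_fps :: "complex \<Rightarrow> complex \<Rightarrow> complex \<Rightarrow> real \<Rightarrow> complex fps" where
  "Y'_fps a b \<mu> x = Abs_fps (\<lambda>k. Y' a b \<mu> k x)"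

lemma Y_fps_0: "Y_fps a b \<mu> 0 = fps_const a" "Y'_fps a b \<mu> 0 = fps_const b"
proof -
  have "Y a b \<mu> k 0 = fps_const a $ k" "Y' a b \<mu> k 0 = fps_const b $ k" for k
    by (cases k; simp add: Y_base Y_step)+
  then show "Y_fps a b \<mu> 0 = fps_const a" "Y'_fps a b \<mu> 0 = fps_const b"
    by (simp_all add: Y_fps_def Y'_fps_def fps_eq_iff)
qed

text \<open>The boundary functional \<open>R = bc1 + \<theta> bc2\<close> applied to the two fundamental solutions at \<open>\<mu> + t\<close>, expanded
  in powers of \<open>t\<close>. Since \<open>bc2\<close> alone or \<open>bc1\<close> alone may vanish on all solutions at \<open>\<mu>\<close>, the parameter \<open>\<theta>\<close> is
  used to obtain a functional that does not; replacing \<open>bc1\<close> by \<open>R\<close> does not change the determinant.\<close>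

definition row1 :: "complex \<Rightarrow> complex \<Rightarrow> complex fps" where
  "row1 \<theta> \<mu> = (1 - Y_fps 1 0 \<mu> 1) + fps_const \<theta> * (fps_const \<beta> * Y'_fps 1 0 \<mu> 1)"

definition row2 :: "complex \<Rightarrow> complex \<Rightarrow> complex fps" where
  "row2 \<theta> \<mu> = - Y_fps 0 1 \<mu> 1 + fps_const \<theta> * (1 + fps_const \<beta> * Y'_fps 0 1 \<mu> 1)"

text \<open>The Taylor coefficients at \<open>\<mu>\<close> of \<open>-R(s) c + R(c) s\<close>, the solution on which \<open>R = bc1 + \<theta> bc2\<close> vanishes
  identically in the spectral parameter.\<close>

definition jordan :: "complex \<Rightarrow> complex \<Rightarrow> nat \<Rightarrow> real \<Rightarrow> complex" where
  "jordan \<theta> \<mu> k x = (- row2 \<theta> \<mu> * Y_fps 1 0 \<mu> x + row1 \<theta> \<mu> * Y_fps 0 1 \<mu> x) $ k"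

definition jordan' :: "complex \<Rightarrow> complex \<Rightarrow> nat \<Rightarrow> real \<Rightarrow> complex" where
  "jordan' \<theta> \<mu> k x = (- row2 \<theta> \<mu> * Y'_fps 1 0 \<mu> x + row1 \<theta> \<mu> * Y'_fps 0 1 \<mu> x) $ k"

definition char_fps :: "complex \<Rightarrow> complex fps" where
  "char_fps \<mu> = fps_const (1 - \<beta>) + fps_const \<beta> * Y'_fps 0 1 \<mu> 1 - Y_fps 1 0 \<mu> 1"

lemma char_fun_fps: "(\<lambda>u. char_fun (\<mu> + u)) has_fps_expansion char_fps \<mu>"
  unfolding char_fun_def char_fps_def Y_fps_def Y'_fps_def
  by (intro fps_expansion_intros Y_has_fps_expansion) auto

text \<open>The Wronskian identity holds for every spectral parameter, hence for the power series.\<close>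

lemma wronskian_fps:
  "Y_fps 1 0 \<mu> 1 * Y'_fps 0 1 \<mu> 1 - Y'_fps 1 0 \<mu> 1 * Y_fps 0 1 \<mu> 1 = 1"
proof -
  have "(\<lambda>u. Y 1 0 (\<mu> + u) 0 1 * Y' 0 1 (\<mu> + u) 0 1 - Y' 1 0 (\<mu> + u) 0 1 * Y 0 1 (\<mu> + u) 0 1)
     has_fps_expansion Y_fps 1 0 \<mu> 1 * Y'_fps 0 1 \<mu> 1 - Y'_fps 1 0 \<mu> 1 * Y_fps 0 1 \<mu> 1"
    unfolding Y_fps_def Y'_fps_def by (intro fps_expansion_intros Y_has_fps_expansion) auto
  then have "(\<lambda>u. 1) has_fps_expansion Y_fps 1 0 \<mu> 1 * Y'_fps 0 1 \<mu> 1 - Y'_fps 1 0 \<mu> 1 * Y_fps 0 1 \<mu> 1"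
    by (simp add: wronskian)
  then show ?thesis using fps_expansion_unique_complex has_fps_expansion_1 by blast
qed

text \<open>On the family \<open>-R(s) c + R(c) s\<close> the functional \<open>R\<close> vanishes, and \<open>bc2\<close> takes the value of the boundary
  determinant. Comparing Taylor coefficients gives the two statements.\<close>

lemma jordan_bc:
  "bc1 (jordan \<theta> \<mu> k) + \<theta> * bc2 (jordan' \<theta> \<mu> k) = 0"
  "bc2 (jordan' \<theta> \<mu> k) = char_fps \<mu> $ k"
proof -
  define C where "C = Y_fps 1 0 \<mu> 1" define S where "S = Y_fps 0 1 \<mu> 1"
  define C1 where "C1 = Y'_fps 1 0 \<mu> 1" define S1 where "S1 = Y'_fps 0 1 \<mu> 1"
  define a where "a = - row2 \<theta> \<mu>" define b where "b = row1 \<theta> \<mu>"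
  have W: "C * S1 - C1 * S = 1" using wronskian_fps by (simp add: C_def S_def C1_def S1_def)
  have ab: "a = S - fps_const \<theta> * (1 + fps_const \<beta> * S1)" "b = (1 - C) + fps_const \<theta> * (fps_const \<beta> * C1)"
    by (simp_all add: a_def b_def row1_def row2_def C_def S_def C1_def S1_def)
  have j0: "jordan \<theta> \<mu> k 0 = a $ k" "jordan' \<theta> \<mu> k 0 = b $ k"
    by (simp_all add: jordan_def jordan'_def Y_fps_0 a_def b_def)
  have j1: "jordan \<theta> \<mu> k 1 = (a * C + b * S) $ k" "jordan' \<theta> \<mu> k 1 = (a * C1 + b * S1) $ k"
    by (simp_all add: jordan_def jordan'_def C_def S_def C1_def S1_def a_def b_def)
  have b2: "bc2 (jordan' \<theta> \<mu> k) = (b + fps_const \<beta> * (a * C1 + b * S1)) $ k"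
    by (simp add: bc2_def j0 j1)
  have "bc1 (jordan \<theta> \<mu> k) + \<theta> * bc2 (jordan' \<theta> \<mu> k) =
     (a - (a * C + b * S) + fps_const \<theta> * (b + fps_const \<beta> * (a * C1 + b * S1))) $ k"
    unfolding b2 by (simp add: bc1_def j0 j1)
  also have "a - (a * C + b * S) + fps_const \<theta> * (b + fps_const \<beta> * (a * C1 + b * S1)) = 0"
    unfolding ab by algebra
  finally show "bc1 (jordan \<theta> \<mu> k) + \<theta> * bc2 (jordan' \<theta> \<mu> k) = 0" by simp
  have "b + fps_const \<beta> * (a * C1 + b * S1)
     = 1 - fps_const \<beta> * (C * S1 - C1 * S) + fps_const \<beta> * S1 - C"
    unfolding ab by algebra
  also have "\<dots> = char_fps \<mu>"
    unfolding W char_fps_def by (simp add: C_def S1_def flip: fps_const_sub)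
  finally show "bc2 (jordan' \<theta> \<mu> k) = char_fps \<mu> $ k" using b2 by simp
qed

lemma jordan_0:
  "jordan \<theta> \<mu> 0 x = - (row2 \<theta> \<mu> $ 0) * Y 1 0 \<mu> 0 x + (row1 \<theta> \<mu> $ 0) * Y 0 1 \<mu> 0 x"
  "jordan' \<theta> \<mu> 0 x = - (row2 \<theta> \<mu> $ 0) * Y' 1 0 \<mu> 0 x + (row1 \<theta> \<mu> $ 0) * Y' 0 1 \<mu> 0 x"
  by (simp_all add: jordan_def jordan'_def Y_fps_def Y'_fps_def)

lemma jordan_second_deriv:
  "second_deriv (jordan \<theta> \<mu> 0) (jordan' \<theta> \<mu> 0) (\<lambda>t. (q t - \<mu>) * jordan \<theta> \<mu> 0 t)"
  "second_deriv (jordan \<theta> \<mu> (Suc k)) (jordan' \<theta> \<mu> (Suc k))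
     (\<lambda>t. (q t - \<mu>) * jordan \<theta> \<mu> (Suc k) t - jordan \<theta> \<mu> k t)"
proof -
  define P where "P a b k t = (case k of 0 \<Rightarrow> 0 | Suc j \<Rightarrow> Y a b \<mu> j t)" for a b k t
  have Ysd: "second_deriv (Y a b \<mu> k) (Y' a b \<mu> k) (\<lambda>t. (q t - \<mu>) * Y a b \<mu> k t - P a b k t)" for a b k
    using Y_base(1)[of a b \<mu>] Y_step(1)[of a b \<mu>] by (cases k) (simp_all add: P_def)
  define \<alpha> where "\<alpha> = - row2 \<theta> \<mu>" define \<gamma> where "\<gamma> = row1 \<theta> \<mu>"
  define G where "G k t = (\<Sum>i=0..k. \<alpha> $ i * P 1 0 (k - i) t + \<gamma> $ i * P 0 1 (k - i) t)" for k t
  have J: "jordan \<theta> \<mu> k x = (\<Sum>i=0..k. \<alpha> $ i * Y 1 0 \<mu> (k - i) x + \<gamma> $ i * Y 0 1 \<mu> (k - i) x)"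
    "jordan' \<theta> \<mu> k x = (\<Sum>i=0..k. \<alpha> $ i * Y' 1 0 \<mu> (k - i) x + \<gamma> $ i * Y' 0 1 \<mu> (k - i) x)" for k x
    unfolding jordan_def jordan'_def \<alpha>_def \<gamma>_def Y_fps_def Y'_fps_def
    by (simp_all add: fps_mult_nth sum.distrib sum_subtractf)
  have sd: "second_deriv (jordan \<theta> \<mu> k) (jordan' \<theta> \<mu> k) (\<lambda>t. (q t - \<mu>) * jordan \<theta> \<mu> k t - G k t)" for k
  proof (rule second_deriv_cong[OF second_deriv_sum[of "{0..k}"]])
    fix i assume "i \<in> {0..k}"
    show "second_deriv (\<lambda>t. \<alpha> $ i * Y 1 0 \<mu> (k - i) t + \<gamma> $ i * Y 0 1 \<mu> (k - i) t)
       (\<lambda>t. \<alpha> $ i * Y' 1 0 \<mu> (k - i) t + \<gamma> $ i * Y' 0 1 \<mu> (k - i) t)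
       (\<lambda>t. \<alpha> $ i * ((q t - \<mu>) * Y 1 0 \<mu> (k - i) t - P 1 0 (k - i) t)
          + \<gamma> $ i * ((q t - \<mu>) * Y 0 1 \<mu> (k - i) t - P 0 1 (k - i) t))"
      by (intro second_deriv_add second_deriv_scale Ysd)
  next
    fix t
    show "(\<Sum>i=0..k. \<alpha> $ i * ((q t - \<mu>) * Y 1 0 \<mu> (k - i) t - P 1 0 (k - i) t)
          + \<gamma> $ i * ((q t - \<mu>) * Y 0 1 \<mu> (k - i) t - P 0 1 (k - i) t))
        = (q t - \<mu>) * jordan \<theta> \<mu> k t - G k t"
      unfolding J G_def sum_distrib_left sum_subtractf[symmetric]
      by (intro sum.cong refl) (simp add: algebra_simps)
  qed (auto simp: J)
  have "G 0 t = 0" for t by (simp add: G_def P_def)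
  then show "second_deriv (jordan \<theta> \<mu> 0) (jordan' \<theta> \<mu> 0) (\<lambda>t. (q t - \<mu>) * jordan \<theta> \<mu> 0 t)"
    using sd[of 0] by simp
  have "G (Suc k) t = jordan \<theta> \<mu> k t" for t
  proof -
    have "G (Suc k) t = (\<Sum>i=0..k. \<alpha> $ i * P 1 0 (Suc k - i) t + \<gamma> $ i * P 0 1 (Suc k - i) t)"
      by (simp add: G_def P_def)
    also have "\<dots> = jordan \<theta> \<mu> k t"
      unfolding J by (intro sum.cong refl) (auto simp: P_def Suc_diff_le)
    finally show ?thesis .
  qed
  then show "second_deriv (jordan \<theta> \<mu> (Suc k)) (jordan' \<theta> \<mu> (Suc k))
     (\<lambda>t. (q t - \<mu>) * jordan \<theta> \<mu> (Suc k) t - jordan \<theta> \<mu> k t)"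
    using sd[of "Suc k"] by simp
qed

end

section \<open>Root spaces and algebraic multiplicities\<close>

lemma second_deriv_vanish:
  assumes sd: "second_deriv y y1 h" and y: "\<And>x. x \<in> {0..1} \<Longrightarrow> y x = 0"
  shows "x \<in> {0..1} \<Longrightarrow> y1 x = 0" and "x \<in> {0..1} \<Longrightarrow> integral {0..x} h = 0"
proof -
  have *: "y1 x = 0" if x: "x \<in> {0..1}" for x
  proof (rule vector_derivative_unique_within)
    show "(y has_vector_derivative y1 x) (at x within {0..1})" by (rule second_derivD(1)[OF sd x])
    show "(y has_vector_derivative 0) (at x within {0..1})"
      by (rule has_vector_derivative_transform[OF x _ has_vector_derivative_const]) (simp add: y)
    show "at x within {0..1} \<noteq> bot" using x by (simp add: trivial_limit_within islimpt_Icc)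
  qed
  then show "x \<in> {0..1} \<Longrightarrow> y1 x = 0" .
  show "integral {0..x} h = 0" if x: "x \<in> {0..1}"
    using second_derivD(4)[OF sd x] *[OF x] *[of 0] by simp
qed

lemma continuous_integral_vanish:
  fixes g :: "real \<Rightarrow> complex"
  assumes g: "continuous_on {0..1} g" and 0: "\<And>x. x \<in> {0..1} \<Longrightarrow> integral {0..x} g = 0" and x: "x \<in> {0..1}"
  shows "g x = 0"
proof (rule vector_derivative_unique_within)
  show "((\<lambda>u. integral {0..u} g) has_vector_derivative g x) (at x within {0..1})"
    by (rule integral_has_vector_derivative[OF g x])
  show "((\<lambda>u. integral {0..u} g) has_vector_derivative 0) (at x within {0..1})"
    by (rule has_vector_derivative_transform[OF x _ has_vector_derivative_const]) (simp add: 0)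
  show "at x within {0..1} \<noteq> bot" using x by (simp add: trivial_limit_within islimpt_Icc)
qed

definition unit_ext :: "(real \<Rightarrow> complex) \<Rightarrow> real \<Rightarrow> complex" where
  "unit_ext y x = (if x \<in> {0..1} then y x else 0)"

context T1_operator
begin

text \<open>If \<open>R\<close> annihilated both fundamental solutions for all \<open>\<theta>\<close>, then \<open>c(1) = 1\<close> and \<open>s(1) = 0\<close>, so \<open>s'(1) = 1\<close> by
  the Wronskian, and \<open>1 + \<beta> s'(1) = 0\<close> contradicts \<open>\<beta> \<noteq> -1\<close>.\<close>

lemma row_nonzero: "\<exists>\<theta>. row1 \<theta> \<mu> $ 0 \<noteq> 0 \<or> row2 \<theta> \<mu> $ 0 \<noteq> 0"
proof (rule ccontr)
  assume "\<not> ?thesis"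
  then have r: "row1 \<theta> \<mu> $ 0 = 0" "row2 \<theta> \<mu> $ 0 = 0" for \<theta> by auto
  from r[of 0] have "Y 1 0 \<mu> 0 1 = 1" "Y 0 1 \<mu> 0 1 = 0"
    by (auto simp: row1_def row2_def Y_fps_def)
  moreover from this r(2)[of 1] have "1 + \<beta> * Y' 0 1 \<mu> 0 1 = 0"
    by (auto simp: row2_def Y_fps_def Y'_fps_def)
  moreover from calculation wronskian[of 1 \<mu>] have "Y' 0 1 \<mu> 0 1 = 1" by simp
  ultimately show False using \<beta>_ne by (simp add: add_eq_0_iff)
qed

text \<open>One nontrivial linear condition on the initial values leaves a line of solutions.\<close>

lemma jordan_0_unique:
  assumes row: "row1 \<theta> \<mu> $ 0 \<noteq> 0 \<or> row2 \<theta> \<mu> $ 0 \<noteq> 0"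
    and sd: "second_deriv y y1 (\<lambda>t. (q t - \<mu>) * y t)" and bc: "bc1 y + \<theta> * bc2 y1 = 0"
  obtains \<kappa> where "\<And>x. x \<in> {0..1} \<Longrightarrow> y x = \<kappa> * jordan \<theta> \<mu> 0 x"
    "\<And>x. x \<in> {0..1} \<Longrightarrow> y1 x = \<kappa> * jordan' \<theta> \<mu> 0 x"
proof -
  note hom = ivp_homogeneous[OF sd]
  define A where "A = y 0" define B where "B = y1 0"
  define r1 where "r1 = row1 \<theta> \<mu> $ 0" define r2 where "r2 = row2 \<theta> \<mu> $ 0"
  have r: "r1 = 1 - Y 1 0 \<mu> 0 1 + \<theta> * (\<beta> * Y' 1 0 \<mu> 0 1)" "r2 = - Y 0 1 \<mu> 0 1 + \<theta> * (1 + \<beta> * Y' 0 1 \<mu> 0 1)"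
    by (simp_all add: r1_def r2_def row1_def row2_def Y_fps_def Y'_fps_def)
  have "bc1 y + \<theta> * bc2 y1 = A * r1 + B * r2"
    unfolding bc1_def bc2_def r using hom(1)[of 1] hom(2)[of 1] by (simp add: A_def B_def algebra_simps)
  then have AB: "A * r1 + B * r2 = 0" using bc by simp
  have "\<exists>\<kappa>. A = - \<kappa> * r2 \<and> B = \<kappa> * r1"
  proof (cases "r1 = 0")
    case True
    then have "B = 0" "r2 \<noteq> 0" using AB row by (auto simp: r1_def r2_def)
    then show ?thesis using True by (intro exI[of _ "- A / r2"]) auto
  next
    case False
    then have "A = - (B / r1) * r2" using AB by (simp add: field_simps add_eq_0_iff2)
    then show ?thesis using False by (intro exI[of _ "B / r1"]) auto
  qed
  then obtain \<kappa> where \<kappa>: "A = - \<kappa> * r2" "B = \<kappa> * r1" by blast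
  show ?thesis
  proof (rule that)
    fix x :: real assume x: "x \<in> {0..1}"
    show "y x = \<kappa> * jordan \<theta> \<mu> 0 x" "y1 x = \<kappa> * jordan' \<theta> \<mu> 0 x"
      using hom[OF x] by (simp_all add: jordan_0 A_def[symmetric] B_def[symmetric]
         r1_def[symmetric] r2_def[symmetric] \<kappa> algebra_simps)
  qed
qed

text \<open>Image of the chain under the differential expression minus \<open>\<mu>\<close>.\<close>

definition jordan_prev :: "complex \<Rightarrow> complex \<Rightarrow> nat \<Rightarrow> real \<Rightarrow> complex" where
  "jordan_prev \<theta> \<mu> k t = (case k of 0 \<Rightarrow> 0 | Suc j \<Rightarrow> jordan \<theta> \<mu> j t)"

lemma jordan_sum_second_deriv:
  "second_deriv (\<lambda>t. \<Sum>i<n. \<alpha> i * jordan \<theta> \<mu> i t) (\<lambda>t. \<Sum>i<n. \<alpha> i * jordan' \<theta> \<mu> i t)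
     (\<lambda>t. (q t - \<mu>) * (\<Sum>i<n. \<alpha> i * jordan \<theta> \<mu> i t) - (\<Sum>i<n. \<alpha> i * jordan_prev \<theta> \<mu> i t))"
proof (rule second_deriv_cong[OF second_deriv_sum[of "{..<n}"]])
  fix i assume "i \<in> {..<n}"
  have "second_deriv (jordan \<theta> \<mu> i) (jordan' \<theta> \<mu> i) (\<lambda>t. (q t - \<mu>) * jordan \<theta> \<mu> i t - jordan_prev \<theta> \<mu> i t)"
    using jordan_second_deriv[of \<theta> \<mu>] by (cases i) (simp_all add: jordan_prev_def)
  then show "second_deriv (\<lambda>t. \<alpha> i * jordan \<theta> \<mu> i t) (\<lambda>t. \<alpha> i * jordan' \<theta> \<mu> i t)
      (\<lambda>t. \<alpha> i * ((q t - \<mu>) * jordan \<theta> \<mu> i t - jordan_prev \<theta> \<mu> i t))"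
    by (rule second_deriv_scale)
next
  fix t
  show "(\<Sum>i<n. \<alpha> i * ((q t - \<mu>) * jordan \<theta> \<mu> i t - jordan_prev \<theta> \<mu> i t)) =
    (q t - \<mu>) * (\<Sum>i<n. \<alpha> i * jordan \<theta> \<mu> i t) - (\<Sum>i<n. \<alpha> i * jordan_prev \<theta> \<mu> i t)"
    unfolding sum_distrib_left sum_subtractf[symmetric]
    by (intro sum.cong refl) (simp add: algebra_simps)
qed auto

lemma jordan_prev_sum: "(\<Sum>i<Suc n. \<alpha> i * jordan_prev \<theta> \<mu> i t) = (\<Sum>i<n. \<alpha> (Suc i) * jordan \<theta> \<mu> i t)"
  by (subst sum.lessThan_Suc_shift) (simp add: jordan_prev_def)

lemma bc_sum:
  "bc1 (\<lambda>t. \<Sum>i\<in>A. \<alpha> i * f i t) = (\<Sum>i\<in>A. \<alpha> i * bc1 (f i))"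
  "bc2 (\<lambda>t. \<Sum>i\<in>A. \<alpha> i * f i t) = (\<Sum>i\<in>A. \<alpha> i * bc2 (f i))"
  by (simp_all add: bc1_def bc2_def sum_subtractf right_diff_distrib sum.distrib distrib_left
      sum_distrib_left mult.left_commute)

lemma bc_diff:
  "bc1 (\<lambda>t. f t + (-1) * g t) = bc1 f - bc1 g"
  "bc2 (\<lambda>t. f t + (-1) * g t) = bc2 f - bc2 g"
  by (simp_all add: bc1_def bc2_def algebra_simps)

lemma jordan_continuous: "continuous_on {0..1} (jordan \<theta> \<mu> k)"
  using second_deriv_continuous(1)[OF jordan_second_deriv(1)] second_deriv_continuous(1)[OF jordan_second_deriv(2)]
  by (cases k) auto

text \<open>Applying the differential expression to a vanishing combination shifts the coefficients by one, so the
  induction hypothesis removes all but the first, and the first chain element is not zero.\<close>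

lemma jordan_independent:
  assumes row: "row1 \<theta> \<mu> $ 0 \<noteq> 0 \<or> row2 \<theta> \<mu> $ 0 \<noteq> 0"
  shows "(\<And>x. x \<in> {0..1} \<Longrightarrow> (\<Sum>i<n. \<alpha> i * jordan \<theta> \<mu> i x) = 0) \<Longrightarrow> i < n \<Longrightarrow> \<alpha> i = 0"
proof (induction n arbitrary: \<alpha> i)
  case (Suc n)
  note sd = jordan_sum_second_deriv[of \<alpha> \<theta> \<mu> "Suc n"]
  define g where "g t = (\<Sum>i<n. \<alpha> (Suc i) * jordan \<theta> \<mu> i t)" for t
  have "g x = 0" if x: "x \<in> {0..1}" for x
  proof (rule continuous_integral_vanish[OF _ _ x])
    show "continuous_on {0..1} g" unfolding g_def by (intro continuous_intros jordan_continuous)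
    fix x :: real assume x: "x \<in> {0..1}"
    have "integral {0..x} (\<lambda>t. (q t - \<mu>) * (\<Sum>i<Suc n. \<alpha> i * jordan \<theta> \<mu> i t) - (\<Sum>i<Suc n. \<alpha> i * jordan_prev \<theta> \<mu> i t)) = 0"
      by (rule second_deriv_vanish(2)[OF sd Suc.prems(1) x])
    also have "integral {0..x} (\<lambda>t. (q t - \<mu>) * (\<Sum>i<Suc n. \<alpha> i * jordan \<theta> \<mu> i t) - (\<Sum>i<Suc n. \<alpha> i * jordan_prev \<theta> \<mu> i t))
       = integral {0..x} (\<lambda>t. - g t)"
    proof (rule integral_cong)
      fix t assume "t \<in> {0..x}"
      then have "(\<Sum>i<Suc n. \<alpha> i * jordan \<theta> \<mu> i t) = 0" using x by (intro Suc.prems(1)) auto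
      then show "(q t - \<mu>) * (\<Sum>i<Suc n. \<alpha> i * jordan \<theta> \<mu> i t) - (\<Sum>i<Suc n. \<alpha> i * jordan_prev \<theta> \<mu> i t) = - g t"
        by (simp only: jordan_prev_sum g_def) simp
    qed
    finally show "integral {0..x} g = 0" by simp
  qed
  then have IH: "\<alpha> (Suc j) = 0" if "j < n" for j
    using Suc.IH[of "\<lambda>i. \<alpha> (Suc i)", OF _ that] by (simp add: g_def)
  have "\<alpha> 0 = 0"
  proof (rule ccontr)
    assume a0: "\<alpha> 0 \<noteq> 0"
    have J0: "jordan \<theta> \<mu> 0 x = 0" if "x \<in> {0..1}" for x
      using Suc.prems(1)[OF that] IH a0 by (subst (asm) sum.lessThan_Suc_shift) simp
    have "jordan' \<theta> \<mu> 0 0 = 0" by (rule second_deriv_vanish(1)[OF jordan_second_deriv(1) J0]) auto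
    then show False using J0[of 0] row by (auto simp: jordan_0 Y_base)
  qed
  then show ?case using IH Suc.prems(2) by (cases i) auto
qed simp

text \<open>If \<open>y\<close> is mapped by the operator minus \<open>\<mu>\<close> to a combination of chain elements, then subtracting the
  shifted combination leaves a homogeneous solution with \<open>R = 0\<close>, a multiple of the first chain element. So
  \<open>y\<close> is a combination of the first \<open>m + 1\<close> elements, and the remaining boundary condition, which holds for
  the first \<open>m\<close> elements and fails for the next one, removes the last coefficient.\<close>

lemma T1_ker_eq:
  assumes row: "row1 \<theta> \<mu> $ 0 \<noteq> 0 \<or> row2 \<theta> \<mu> $ 0 \<noteq> 0" and nz: "char_fps \<mu> \<noteq> 0"
  defines "m \<equiv> subdegree (char_fps \<mu>)"
  shows "T1_ker q \<beta> \<mu> k =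
    {y. \<exists>\<alpha>. (\<forall>i\<ge>k. \<alpha> i = 0) \<and> y = unit_ext (\<lambda>x. \<Sum>i<m. \<alpha> i * jordan \<theta> \<mu> i x)}"
proof (induction k)
  case 0
  have "unit_ext (\<lambda>x. 0) = 0" by (auto simp: unit_ext_def)
  then show ?case by (auto intro!: exI[of _ "\<lambda>_. 0"])
next
  case (Suc k)
  have D: "char_fps \<mu> $ i = 0" if "i < m" for i using that unfolding m_def by (rule nth_less_subdegree_zero)
  have Dm: "char_fps \<mu> $ m \<noteq> 0" using nz by (simp add: m_def)
  show ?case
  proof (intro equalityI subsetI)
    fix y assume "y \<in> T1_ker q \<beta> \<mu> (Suc k)"
    then obtain z where z: "z \<in> T1_ker q \<beta> \<mu> k" and gr: "T1_graph q \<beta> y (cfun_scale \<mu> y + z)" by auto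
    obtain \<alpha> where \<alpha>: "\<And>i. i \<ge> k \<Longrightarrow> \<alpha> i = 0" and z_eq: "z = unit_ext (\<lambda>x. \<Sum>i<m. \<alpha> i * jordan \<theta> \<mu> i x)"
      using z Suc by auto
    obtain y1 where supp: "\<And>x. x \<notin> {0..1} \<Longrightarrow> y x = 0"
      and sd: "second_deriv y y1 (\<lambda>t. (q t - \<mu>) * y t - z t)" and bc: "bc1 y = 0" "bc2 y1 = 0"
      using gr unfolding T1_graph_iff[OF T1_ker_continuous[OF z]] by blast
    \<comment> \<open>The shifted combination is a preimage of \<open>z\<close> under the differential expression minus \<open>\<mu>\<close>.\<close>
    define \<delta> where "\<delta> i = (case i of 0 \<Rightarrow> 0 | Suc j \<Rightarrow> \<alpha> j)" for i
    define v where "v t = y t + (-1) * (\<Sum>i<Suc m. \<delta> i * jordan \<theta> \<mu> i t)" for t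
    define v1 where "v1 t = y1 t + (-1) * (\<Sum>i<Suc m. \<delta> i * jordan' \<theta> \<mu> i t)" for t
    have "second_deriv v v1 (\<lambda>t. (q t - \<mu>) * v t)"
    proof (rule second_deriv_cong[OF second_deriv_add[OF sd second_deriv_scale[OF jordan_sum_second_deriv[of \<delta> \<theta> \<mu> "Suc m"], of "-1"]]])
      fix t :: real assume t: "t \<in> {0..1}"
      have "(\<Sum>i<Suc m. \<delta> i * jordan_prev \<theta> \<mu> i t) = z t"
        unfolding jordan_prev_sum using t by (simp add: \<delta>_def z_eq unit_ext_def)
      then show "(q t - \<mu>) * y t - z t + (-1) * ((q t - \<mu>) * (\<Sum>i<Suc m. \<delta> i * jordan \<theta> \<mu> i t)
         - (\<Sum>i<Suc m. \<delta> i * jordan_prev \<theta> \<mu> i t)) = (q t - \<mu>) * v t"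
        unfolding v_def by (simp only:) (simp only: algebra_simps, simp)
    qed (simp_all add: v_def v1_def)
    moreover have "bc1 v + \<theta> * bc2 v1 = 0"
    proof -
      have "bc1 v = bc1 y - bc1 (\<lambda>t. \<Sum>i<Suc m. \<delta> i * jordan \<theta> \<mu> i t)"
        "bc2 v1 = bc2 y1 - bc2 (\<lambda>t. \<Sum>i<Suc m. \<delta> i * jordan' \<theta> \<mu> i t)"
        unfolding bc_diff[symmetric] by (simp_all only: v_def[abs_def] v1_def[abs_def])
      moreover have "(\<Sum>i<Suc m. \<delta> i * (bc1 (jordan \<theta> \<mu> i) + \<theta> * bc2 (jordan' \<theta> \<mu> i)))
          = (\<Sum>i<Suc m. \<delta> i * bc1 (jordan \<theta> \<mu> i)) + \<theta> * (\<Sum>i<Suc m. \<delta> i * bc2 (jordan' \<theta> \<mu> i))"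
        by (simp only: distrib_left sum.distrib sum_distrib_left mult.left_commute[of \<theta>])
      ultimately have "bc1 v + \<theta> * bc2 v1 = - (\<Sum>i<Suc m. \<delta> i * (bc1 (jordan \<theta> \<mu> i) + \<theta> * bc2 (jordan' \<theta> \<mu> i)))"
        unfolding bc_sum bc by (simp del: sum.lessThan_Suc)
      then show ?thesis unfolding jordan_bc(1) by simp
    qed
    ultimately obtain \<kappa> where \<kappa>: "\<And>x. x \<in> {0..1} \<Longrightarrow> v x = \<kappa> * jordan \<theta> \<mu> 0 x"
      "\<And>x. x \<in> {0..1} \<Longrightarrow> v1 x = \<kappa> * jordan' \<theta> \<mu> 0 x" using jordan_0_unique[OF row] by blast
    define \<gamma> where "\<gamma> = \<delta>(0 := \<kappa>)"
    have \<gamma>: "\<gamma> 0 = \<kappa>" "\<gamma> (Suc i) = \<alpha> i" for i by (simp_all add: \<gamma>_def \<delta>_def)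
    have y: "y x = (\<Sum>i<Suc m. \<gamma> i * jordan \<theta> \<mu> i x)" "y1 x = (\<Sum>i<Suc m. \<gamma> i * jordan' \<theta> \<mu> i x)"
      if x: "x \<in> {0..1}" for x
      using \<kappa>[OF x] unfolding v_def v1_def sum.lessThan_Suc_shift
      by (simp_all add: \<gamma> \<delta>_def algebra_simps)
    have "bc2 y1 = bc2 (\<lambda>x. \<Sum>i<Suc m. \<gamma> i * jordan' \<theta> \<mu> i x)" using y(2) by (simp add: bc2_def)
    then have "(\<Sum>i<Suc m. \<gamma> i * char_fps \<mu> $ i) = 0" unfolding bc_sum jordan_bc(2) bc by simp
    then have "\<gamma> m = 0" using D Dm by simp
    then have "y = unit_ext (\<lambda>x. \<Sum>i<m. \<gamma> i * jordan \<theta> \<mu> i x)"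
      using y(1) supp by (auto simp: unit_ext_def)
    moreover have "\<gamma> i = 0" if "i \<ge> Suc k" for i using that \<alpha> by (cases i) (auto simp: \<gamma>)
    ultimately show "y \<in> {y. \<exists>\<alpha>. (\<forall>i\<ge>Suc k. \<alpha> i = 0) \<and> y = unit_ext (\<lambda>x. \<Sum>i<m. \<alpha> i * jordan \<theta> \<mu> i x)}"
      by blast
  next
    fix y assume "y \<in> {y. \<exists>\<alpha>. (\<forall>i\<ge>Suc k. \<alpha> i = 0) \<and> y = unit_ext (\<lambda>x. \<Sum>i<m. \<alpha> i * jordan \<theta> \<mu> i x)}"
    then obtain \<alpha> where \<alpha>: "\<And>i. i \<ge> Suc k \<Longrightarrow> \<alpha> i = 0"
      and y_eq: "y = unit_ext (\<lambda>x. \<Sum>i<m. \<alpha> i * jordan \<theta> \<mu> i x)" by blast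
    define \<gamma> where "\<gamma> i = (if Suc i < m then \<alpha> (Suc i) else 0)" for i
    define z where "z = unit_ext (\<lambda>x. \<Sum>i<m. \<gamma> i * jordan \<theta> \<mu> i x)"
    have z: "z \<in> T1_ker q \<beta> \<mu> k"
      unfolding Suc z_def using \<alpha> by (auto simp: \<gamma>_def intro!: exI[of _ \<gamma>])
    have prev: "(\<Sum>i<m. \<alpha> i * jordan_prev \<theta> \<mu> i t) = (\<Sum>i<m. \<gamma> i * jordan \<theta> \<mu> i t)" for t
    proof (cases m)
      case (Suc m')
      show ?thesis unfolding Suc jordan_prev_sum using Suc by (simp add: \<gamma>_def)
    qed simp
    have "second_deriv y (\<lambda>t. \<Sum>i<m. \<alpha> i * jordan' \<theta> \<mu> i t) (\<lambda>t. (q t - \<mu>) * y t - z t)"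
      by (rule second_deriv_cong[OF jordan_sum_second_deriv[of \<alpha> \<theta> \<mu> m]])
         (simp_all add: y_eq z_def prev unit_ext_def)
    moreover have b2: "bc2 (jordan' \<theta> \<mu> i) = 0" "bc1 (jordan \<theta> \<mu> i) = 0" if "i < m" for i
      using jordan_bc[of \<theta> \<mu> i] D[OF that] by auto
    have "bc2 (\<lambda>t. \<Sum>i<m. \<alpha> i * jordan' \<theta> \<mu> i t) = 0" "bc1 (\<lambda>t. \<Sum>i<m. \<alpha> i * jordan \<theta> \<mu> i t) = 0"
      unfolding bc_sum using b2 by simp_all
    moreover have "bc1 y = bc1 (\<lambda>t. \<Sum>i<m. \<alpha> i * jordan \<theta> \<mu> i t)"
      by (simp add: y_eq bc1_def unit_ext_def)
    moreover have "\<forall>x. x \<notin> {0..1} \<longrightarrow> y x = 0" by (simp add: y_eq unit_ext_def)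
    ultimately have "T1_graph q \<beta> y (cfun_scale \<mu> y + z)"
      unfolding T1_graph_iff[OF T1_ker_continuous[OF z]] by metis
    then show "y \<in> T1_ker q \<beta> \<mu> (Suc k)" using z by auto
  qed
qed

lemma sum_cfun_apply: "(\<Sum>i\<in>A. f i :: real \<Rightarrow> complex) x = (\<Sum>i\<in>A. f i x)"
  by (induction A rule: infinite_finite_induct) auto

lemma T1_multiplicity_subdegree:
  assumes nz: "char_fps \<mu> \<noteq> 0"
  shows "T1_alg_multiplicity q \<beta> \<mu> (subdegree (char_fps \<mu>))"
    and "T1_root_space q \<beta> \<mu> = T1_ker q \<beta> \<mu> (subdegree (char_fps \<mu>))"
proof -
  obtain \<theta> where row: "row1 \<theta> \<mu> $ 0 \<noteq> 0 \<or> row2 \<theta> \<mu> $ 0 \<noteq> 0" using row_nonzero by blast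
  define m where "m = subdegree (char_fps \<mu>)"
  note ker = T1_ker_eq[OF row nz, folded m_def]
  define e where "e i = unit_ext (jordan \<theta> \<mu> i)" for i
  define B where "B = e ` {..<m}"
  have comb: "(\<Sum>i<n. cfun_scale (\<alpha> i) (e i)) = unit_ext (\<lambda>x. \<Sum>i<n. \<alpha> i * jordan \<theta> \<mu> i x)" for \<alpha> n
    by (rule ext) (auto simp: sum_cfun_apply cfun_scale_def e_def unit_ext_def intro!: sum.neutral)
  have indep: "\<alpha> i = 0" if "(\<Sum>i<n. cfun_scale (\<alpha> i) (e i)) = 0" "i < n" for \<alpha> n i
  proof (rule jordan_independent[OF row _ that(2)])
    fix x :: real assume "x \<in> {0..1}"
    then show "(\<Sum>i<n. \<alpha> i * jordan \<theta> \<mu> i x) = 0"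
      using fun_cong[OF that(1)[unfolded comb], of x] by (simp add: unit_ext_def)
  qed
  have neq: "e i \<noteq> e j" if "i < j" for i j
  proof
    assume "e i = e j"
    define \<alpha> where "\<alpha> k = (if k = j then 1 else if k = i then - 1 else (0 :: complex))" for k
    have "(\<Sum>k<j. cfun_scale (\<alpha> k) (e k)) = (\<Sum>k\<in>{i}. cfun_scale (\<alpha> k) (e k))"
      using that by (intro sum.mono_neutral_right) (auto simp: \<alpha>_def cfun_scale_def fun_eq_iff)
    then have "(\<Sum>k<Suc j. cfun_scale (\<alpha> k) (e k)) = cfun_scale (-1) (e i) + cfun_scale 1 (e j)"
      using that by (simp add: \<alpha>_def)
    also have "\<dots> = 0" using \<open>e i = e j\<close> by (simp add: cfun_scale_def fun_eq_iff)
    finally have "\<alpha> j = 0" using indep[of \<alpha> "Suc j" j] by simp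
    then show False by (simp add: \<alpha>_def)
  qed
  have inj: "inj_on e {..<m}" using neq by (intro linorder_inj_onI) auto
  have sumB: "(\<Sum>v\<in>B. cfun_scale (u v) v) = (\<Sum>i<m. cfun_scale (u (e i)) (e i))" for u
    unfolding B_def using inj by (simp add: sum.reindex)
  have "cfun.independent B"
    unfolding cfun.dependent_finite[OF finite_imageI[OF finite_lessThan], of e m, folded B_def] sumB
    using indep[where n = m and \<alpha> = "\<lambda>i. u (e i)" for u] by (auto simp: B_def)
  moreover define R where "R = range (\<lambda>\<alpha>. unit_ext (\<lambda>x. \<Sum>i<m. \<alpha> i * jordan \<theta> \<mu> i x))"
  have root: "T1_root_space q \<beta> \<mu> = R" and root': "T1_ker q \<beta> \<mu> m = R"
  proof -
    show *: "T1_ker q \<beta> \<mu> m = R"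
    proof -
      have "unit_ext (\<lambda>x. \<Sum>i<m. \<alpha> i * jordan \<theta> \<mu> i x) \<in> T1_ker q \<beta> \<mu> m" for \<alpha>
        unfolding ker
        by (intro CollectI exI[of _ "\<lambda>i. if i < m then \<alpha> i else 0"] conjI
            arg_cong[where f = unit_ext] ext sum.cong) auto
      then show ?thesis unfolding ker R_def by auto
    qed
    have "T1_ker q \<beta> \<mu> k \<subseteq> R" for k unfolding ker R_def by auto
    then show "T1_root_space q \<beta> \<mu> = R" unfolding T1_root_space_def using * by blast
  qed
  moreover have span: "cfun.span B = R"
  proof -
    have "cfun.span B = range (\<lambda>u. \<Sum>i<m. cfun_scale (u (e i)) (e i))"
      by (subst cfun.span_finite) (auto simp: sumB B_def[symmetric], auto simp: B_def)
    also have "\<dots> = range (\<lambda>\<alpha>. \<Sum>i<m. cfun_scale (\<alpha> i) (e i))"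
    proof (intro equalityI subsetI)
      fix y assume "y \<in> range (\<lambda>\<alpha>. \<Sum>i<m. cfun_scale (\<alpha> i) (e i))"
      then obtain \<alpha> where \<alpha>: "y = (\<Sum>i<m. cfun_scale (\<alpha> i) (e i))" by blast
      have "y = (\<Sum>i<m. cfun_scale ((\<lambda>v. \<alpha> (the_inv_into {..<m} e v)) (e i)) (e i))"
        unfolding \<alpha> by (intro sum.cong refl) (simp add: the_inv_into_f_f[OF inj])
      then show "y \<in> range (\<lambda>u. \<Sum>i<m. cfun_scale (u (e i)) (e i))"
        by (rule range_eqI[where x = "\<lambda>v. \<alpha> (the_inv_into {..<m} e v)"])
    qed auto
    finally show ?thesis unfolding comb R_def .
  qed
  moreover have "finite B" "card B = m" using inj by (auto simp: B_def card_image)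
  ultimately show "T1_alg_multiplicity q \<beta> \<mu> (subdegree (char_fps \<mu>))"
    unfolding T1_alg_multiplicity_def m_def[symmetric] root by blast
  show "T1_root_space q \<beta> \<mu> = T1_ker q \<beta> \<mu> (subdegree (char_fps \<mu>))"
    unfolding m_def[symmetric] root root' ..
qed

lemma zorder_char_fun:
  assumes "char_fps \<mu> \<noteq> 0"
  shows "zorder char_fun \<mu> = int (subdegree (char_fps \<mu>))"
  by (rule has_fps_expansion_zorder[OF char_fun_fps assms])

lemma char_fps_nonzero:
  assumes "char_fun l \<noteq> 0"
  shows "char_fps \<mu> \<noteq> 0"
proof
  assume "char_fps \<mu> = 0"
  then have "(\<lambda>u. char_fun (\<mu> + u)) has_fps_expansion 0" using char_fun_fps by metis
  then have "char_fun (\<mu> + (l - \<mu>)) = 0"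
    by (rule has_fps_expansion_0_analytic_continuation[where A = UNIV])
       (auto intro!: holomorphic_on_compose_gen[OF _ char_fun_holomorphic, unfolded o_def] holomorphic_intros)
  then show False using assms by simp
qed

end

section \<open>Solutions for a large spectral parameter\<close>

lemma norm_sin_cos_le:
  fixes z :: complex
  shows "norm (sin z) \<le> exp \<bar>Im z\<bar>" "norm (cos z) \<le> exp \<bar>Im z\<bar>"
proof -
  have e: "norm (exp (\<i> * z)) \<le> exp \<bar>Im z\<bar>" "norm (exp (- (\<i> * z))) \<le> exp \<bar>Im z\<bar>"
    by (simp_all add: norm_exp_eq_Re)
  have "norm (exp (\<i> * z) - exp (- (\<i> * z))) \<le> exp \<bar>Im z\<bar> + exp \<bar>Im z\<bar>"
    using norm_triangle_ineq4[of "exp (\<i> * z)" "exp (- (\<i> * z))"] e by linarith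
  then show "norm (sin z) \<le> exp \<bar>Im z\<bar>"
    by (simp add: sin_exp_eq norm_divide norm_mult)
  have "norm (exp (\<i> * z) + exp (- (\<i> * z))) \<le> exp \<bar>Im z\<bar> + exp \<bar>Im z\<bar>"
    using norm_triangle_ineq[of "exp (\<i> * z)" "exp (- (\<i> * z))"] e by linarith
  then show "norm (cos z) \<le> exp \<bar>Im z\<bar>"
    by (simp add: cos_exp_eq norm_divide)
qed

lemma sin_cos_lipschitz:
  assumes z: "norm (z :: complex) \<le> 1"
  shows "norm (sin (of_real a + z) - sin (complex_of_real a)) \<le> 3 * norm z"
    and "norm (cos (of_real a + z) - cos (complex_of_real a)) \<le> 3 * norm z"
proof -
  define U where "U = {w. \<bar>Im w\<bar> \<le> 1}"
  have "U = {w. Im w \<le> 1} \<inter> {w. Im w \<ge> -1}" by (auto simp: U_def)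
  then have U: "convex U" by (simp add: convex_Int convex_halfspace_Im_le convex_halfspace_Im_ge)
  have U3: "norm (sin w) \<le> 3" "norm (cos w) \<le> 3" if "w \<in> U" for w
  proof -
    have "exp \<bar>Im w\<bar> \<le> exp 1" using that by (simp add: U_def)
    then show "norm (sin w) \<le> 3" "norm (cos w) \<le> 3"
      using norm_sin_cos_le[of w] exp_le by linarith+
  qed
  have mem: "of_real a + z \<in> U" "of_real a \<in> U"
    using z abs_Im_le_cmod[of z] by (auto simp: U_def)
  have "norm (sin (of_real a + z) - sin (complex_of_real a)) \<le> 3 * norm (of_real a + z - of_real a)"
    by (rule field_differentiable_bound[OF U DERIV_subset[OF DERIV_sin subset_UNIV] _ mem]) (rule U3)
  then show "norm (sin (of_real a + z) - sin (complex_of_real a)) \<le> 3 * norm z" by simp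
  have "norm (cos (of_real a + z) - cos (complex_of_real a)) \<le> 3 * norm (of_real a + z - of_real a)"
    by (rule field_differentiable_bound[OF U DERIV_subset[OF DERIV_cos subset_UNIV] _ mem]) (simp add: U3)
  then show "norm (cos (of_real a + z) - cos (complex_of_real a)) \<le> 3 * norm z" by simp
qed

lemma norm_sin_cos_scaled_le:
  assumes "0 \<le> t"
  shows "norm (sin (w * of_real t)) \<le> exp (\<bar>Im w\<bar> * t)" "norm (cos (w * of_real t)) \<le> exp (\<bar>Im w\<bar> * t)"
  using norm_sin_cos_le[of "w * of_real t"] assms by (simp_all add: abs_mult)

context potential
begin

definition Q :: real where "Q = integral {0..1} (\<lambda>t. norm (q t))"

lemma Q_nonneg: "0 \<le> Q"
  unfolding Q_def using q_L1 by (intro integral_nonneg) (auto simp: absolutely_integrable_on_def)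

lemma q_integral_le:
  assumes "continuous_on {0..x} f" "\<And>t. t \<in> {0..x} \<Longrightarrow> norm (f t) \<le> B" "x \<in> {0..1}"
  shows "norm (integral {0..x} (\<lambda>t. q t * f t)) \<le> B * Q"
proof -
  have sub: "{0..x} \<subseteq> {0..1}" using assms(3) by auto
  have B: "0 \<le> B" using assms(2)[of 0] assms(3) norm_ge_zero[of "f 0"] by (auto simp del: norm_ge_zero)
  have "norm (integral {0..x} (\<lambda>t. q t * f t)) \<le> B * integral {0..x} (\<lambda>t. norm (q t))"
    by (rule norm_integral_mult_le[OF absolutely_integrable_subinterval[OF q_L1 sub] assms(1,2)])
  also have "\<dots> \<le> B * Q"
    unfolding Q_def by (intro mult_left_mono integral_norm_subinterval_le[OF q_L1 sub] B)
  finally show ?thesis .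
qed

lemma q_mult_integrable:
  assumes "continuous_on {0..x} f" "x \<in> {0..1}"
  shows "(\<lambda>t. q t * f t) integrable_on {0..x}"
proof -
  have "{0..x} \<subseteq> {0..1}" using assms(2) by auto
  then have "q absolutely_integrable_on {0..x}" by (rule absolutely_integrable_subinterval[OF q_L1])
  from absolutely_integrable_mult_continuous[OF this assms(1)] show ?thesis
    by (simp add: absolutely_integrable_on_def)
qed

text \<open>Variation of constants without solving for \<open>y\<close>: \<open>y' g - y g'\<close> has derivative \<open>q y g\<close> when \<open>g\<close> solves
  the free equation.\<close>

lemma green_identity:
  assumes sd: "second_deriv y y1 (\<lambda>t. (q t - l) * y t)"
    and g: "\<And>t. (g has_vector_derivative g1 t) (at t)"
    and g1: "\<And>t. (g1 has_vector_derivative - l * g t) (at t)"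
    and x: "x \<in> {0..1}"
  shows "y1 x * g x - y x * g1 x = y1 0 * g 0 - y 0 * g1 0 + integral {0..x} (\<lambda>t. q t * (y t * g t))"
proof -
  note yc = second_deriv_continuous[OF sd]
  have gc: "continuous_on A g" "continuous_on A g1" for A
    using g g1 by (meson continuous_on_eq_continuous_within has_vector_derivative_at_within has_vector_derivative_continuous)+
  have sub: "{0..x} \<subseteq> {0..1}" using x by auto
  have yx: "continuous_on {0..x} y" "continuous_on {0..x} y1" using yc sub continuous_on_subset by blast+
  have 1: "y1 x * g x = y1 0 * g 0 + integral {0..x} (\<lambda>t. (q t - l) * y t * g t + y1 t * g1 t)"
    by (rule second_deriv_product[OF sd has_vector_derivative_at_within[OF g] gc(2) x])
  have "((\<lambda>t. y1 t * g1 t - l * (y t * g t)) has_integral (y x * g1 x - y 0 * g1 0)) {0..x}"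
  proof (rule fundamental_theorem_of_calculus)
    fix t assume t: "t \<in> {0..x}"
    have "(y has_vector_derivative y1 t) (at t within {0..x})"
      using second_derivD(1)[OF sd, of t] t sub by (auto intro: has_vector_derivative_within_subset)
    from has_vector_derivative_mult[OF this has_vector_derivative_at_within[OF g1]]
    show "((\<lambda>t. y t * g1 t) has_vector_derivative y1 t * g1 t - l * (y t * g t)) (at t within {0..x})"
      by (simp add: algebra_simps)
  qed (use x in simp)
  then have 2: "y x * g1 x - y 0 * g1 0 = integral {0..x} (\<lambda>t. y1 t * g1 t - l * (y t * g t))"
    by (simp add: integral_unique)
  have i1: "(\<lambda>t. q t * (y t * g t)) integrable_on {0..x}"
    by (intro q_mult_integrable continuous_intros yx gc x)
  have i2: "(\<lambda>t. y1 t * g1 t - l * (y t * g t)) integrable_on {0..x}"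
    by (intro integrable_continuous_real continuous_intros yx gc)
  have "integral {0..x} (\<lambda>t. (q t - l) * y t * g t + y1 t * g1 t)
      = integral {0..x} (\<lambda>t. q t * (y t * g t) + (y1 t * g1 t - l * (y t * g t)))"
    by (intro integral_cong) (simp add: algebra_simps)
  also have "\<dots> = integral {0..x} (\<lambda>t. q t * (y t * g t)) + integral {0..x} (\<lambda>t. y1 t * g1 t - l * (y t * g t))"
    by (rule integral_add[OF i1 i2])
  finally show ?thesis using 1 2 by (simp add: algebra_simps)
qed

text \<open>\<open>green_identity\<close> with \<open>g(t) = sin w(x - t)\<close> and \<open>g(t) = cos w(x - t)\<close>.\<close>

lemma sine_kernel:
  assumes sd: "second_deriv y y1 (\<lambda>t. (q t - w^2) * y t)" and x: "x \<in> {0..1}"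
  shows "w * y x = w * (y 0 * cos (w * of_real x)) + y1 0 * sin (w * of_real x)
           + integral {0..x} (\<lambda>t. q t * (y t * sin (w * of_real (x - t))))"
    and "y1 x = y1 0 * cos (w * of_real x) - w * (y 0 * sin (w * of_real x))
           + integral {0..x} (\<lambda>t. q t * (y t * cos (w * of_real (x - t))))"
proof -
  have d: "((\<lambda>t. sin (w * of_real (x - t))) has_vector_derivative - w * cos (w * of_real (x - t))) (at t)"
    "((\<lambda>t. cos (w * of_real (x - t))) has_vector_derivative w * sin (w * of_real (x - t))) (at t)" for t
  proof -
    have 1: "((\<lambda>t. w * of_real (x - t)) has_vector_derivative - w) (at t)"
      by (auto intro!: derivative_eq_intros)
    show "((\<lambda>t. sin (w * of_real (x - t))) has_vector_derivative - w * cos (w * of_real (x - t))) (at t)"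
      using field_vector_diff_chain_at[OF 1 DERIV_sin] by (simp add: o_def)
    show "((\<lambda>t. cos (w * of_real (x - t))) has_vector_derivative w * sin (w * of_real (x - t))) (at t)"
      using field_vector_diff_chain_at[OF 1 DERIV_cos] by (simp add: o_def)
  qed
  have "((\<lambda>t. - w * cos (w * of_real (x - t))) has_vector_derivative - (w^2) * sin (w * of_real (x - t))) (at t)" for t
    using has_vector_derivative_mult_right[OF d(2)[of t], of "- w"] by (simp add: power2_eq_square mult.assoc)
  from green_identity[OF sd d(1) this x]
  show "w * y x = w * (y 0 * cos (w * of_real x)) + y1 0 * sin (w * of_real x)
           + integral {0..x} (\<lambda>t. q t * (y t * sin (w * of_real (x - t))))"
    by (simp add: algebra_simps)
  have "((\<lambda>t. w * sin (w * of_real (x - t))) has_vector_derivative - (w^2) * cos (w * of_real (x - t))) (at t)" for t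
    using has_vector_derivative_mult_right[OF d(1)[of t], of "w"] by (simp add: power2_eq_square mult.assoc)
  from green_identity[OF sd d(2) this x]
  show "y1 x = y1 0 * cos (w * of_real x) - w * (y 0 * sin (w * of_real x))
           + integral {0..x} (\<lambda>t. q t * (y t * cos (w * of_real (x - t))))"
    by (simp add: algebra_simps)
qed

text \<open>The weight \<open>e\<^bsup>-|Im w|x\<^esup>\<close> matches the growth of the kernel, so in the corresponding norm the integral
  term of \<open>sine_kernel\<close> has norm at most \<open>Q / |w| \<le> 1/2\<close>.\<close>

lemma large_frequency_bound:
  assumes sd: "second_deriv y y1 (\<lambda>t. (q t - w^2) * y t)" and w: "2 * Q \<le> norm w" "w \<noteq> 0"
    and A: "\<And>x. x \<in> {0..1} \<Longrightarrow> norm (y 0 * cos (w * of_real x) + y1 0 * sin (w * of_real x) / w) \<le> A * exp (\<bar>Im w\<bar> * x)"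
    and x: "x \<in> {0..1}"
  shows "norm (y x) \<le> 2 * A * exp (\<bar>Im w\<bar> * x)"
    and "norm (y x - (y 0 * cos (w * of_real x) + y1 0 * sin (w * of_real x) / w))
           \<le> 2 * A * Q / norm w * exp (\<bar>Im w\<bar> * x)"
proof -
  define \<tau> where "\<tau> = \<bar>Im w\<bar>"
  note yc = second_deriv_continuous(1)[OF sd]
  obtain N x0 where N0: "0 \<le> N" and x0: "x0 \<in> {0..1}" "norm (y x0) = N * exp (\<tau> * x0)"
    and yN: "\<And>t. t \<in> {0..1} \<Longrightarrow> norm (y t) \<le> N * exp (\<tau> * t)"
    using weighted_sup_attained[OF yc] by blast
  have diff: "norm (y x - (y 0 * cos (w * of_real x) + y1 0 * sin (w * of_real x) / w))
      \<le> N * Q / norm w * exp (\<tau> * x)" if x: "x \<in> {0..1}" for x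
  proof -
    have "norm (integral {0..x} (\<lambda>t. q t * (y t * sin (w * of_real (x - t))))) \<le> (N * exp (\<tau> * x)) * Q"
    proof (rule q_integral_le[OF _ _ x])
      show "continuous_on {0..x} (\<lambda>t. y t * sin (w * of_real (x - t)))"
        using x by (intro continuous_intros continuous_on_subset[OF yc]) auto
      fix t assume t: "t \<in> {0..x}"
      have "norm (y t * sin (w * of_real (x - t))) \<le> (N * exp (\<tau> * t)) * exp (\<tau> * (x - t))"
        unfolding norm_mult \<tau>_def
        using t x yN[of t] norm_sin_cos_scaled_le(1)[of "x - t" w] by (intro mult_mono) (auto simp: \<tau>_def N0)
      also have "\<dots> = N * exp (\<tau> * x)" by (simp add: algebra_simps flip: exp_add)
      finally show "norm (y t * sin (w * of_real (x - t))) \<le> N * exp (\<tau> * x)" .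
    qed
    moreover have "y x - (y 0 * cos (w * of_real x) + y1 0 * sin (w * of_real x) / w)
       = integral {0..x} (\<lambda>t. q t * (y t * sin (w * of_real (x - t)))) / w"
      using sine_kernel(1)[OF sd x] w(2) by (simp add: field_simps)
    ultimately show ?thesis
      using w(2) by (simp add: norm_divide divide_right_mono mult_ac)
  qed
  have Qw: "Q / norm w \<le> 1 / 2" using w by (simp add: divide_simps)
  have "norm (y x0) \<le> (A + N * Q / norm w) * exp (\<tau> * x0)"
    using norm_triangle_mono[OF A[OF x0(1)] diff[OF x0(1)]] by (simp add: \<tau>_def algebra_simps)
  then have "N \<le> A + N * (Q / norm w)" unfolding x0(2) by simp
  also have "\<dots> \<le> A + N * (1 / 2)" using N0 Qw by (intro add_left_mono mult_left_mono) auto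
  finally have N: "N \<le> 2 * A" by simp
  show "norm (y x) \<le> 2 * A * exp (\<bar>Im w\<bar> * x)"
    using order_trans[OF yN[OF x] mult_right_mono[OF N, of "exp (\<tau> * x)"]] by (simp add: \<tau>_def)
  have "N * (Q / norm w * exp (\<tau> * x)) \<le> 2 * A * (Q / norm w * exp (\<tau> * x))"
    using N Q_nonneg by (intro mult_right_mono) auto
  then show "norm (y x - (y 0 * cos (w * of_real x) + y1 0 * sin (w * of_real x) / w))
           \<le> 2 * A * Q / norm w * exp (\<bar>Im w\<bar> * x)"
    using order_trans[OF diff[OF x]] by (simp add: \<tau>_def)
qed

lemma cosine_solution_bound:
  assumes w: "2 * Q \<le> norm w" "w \<noteq> 0" and x: "x \<in> {0..1}"
  shows "norm (Y 1 0 (w^2) 0 x) \<le> 2 * exp (\<bar>Im w\<bar> * x)"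
    "norm (Y 1 0 (w^2) 0 x - cos (w * of_real x)) \<le> 2 * Q / norm w * exp (\<bar>Im w\<bar> * x)"
proof -
  note b = large_frequency_bound[OF Y_base(1)[of 1 0 "w^2"] w _ x, of 1]
  show "norm (Y 1 0 (w^2) 0 x) \<le> 2 * exp (\<bar>Im w\<bar> * x)"
    "norm (Y 1 0 (w^2) 0 x - cos (w * of_real x)) \<le> 2 * Q / norm w * exp (\<bar>Im w\<bar> * x)"
    using b norm_sin_cos_scaled_le(2)[of _ w] by (simp_all add: Y_base)
qed

lemma sine_solution_bound:
  assumes w: "2 * Q \<le> norm w" "w \<noteq> 0" and x: "x \<in> {0..1}"
  shows "norm (Y 0 1 (w^2) 0 x) \<le> 2 / norm w * exp (\<bar>Im w\<bar> * x)"
    "norm (Y 0 1 (w^2) 0 x - sin (w * of_real x) / w) \<le> 2 * Q / (norm w)^2 * exp (\<bar>Im w\<bar> * x)"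
proof -
  note b = large_frequency_bound[OF Y_base(1)[of 0 1 "w^2"] w _ x, of "1 / norm w"]
  show "norm (Y 0 1 (w^2) 0 x) \<le> 2 / norm w * exp (\<bar>Im w\<bar> * x)"
    "norm (Y 0 1 (w^2) 0 x - sin (w * of_real x) / w) \<le> 2 * Q / (norm w)^2 * exp (\<bar>Im w\<bar> * x)"
    using b norm_sin_cos_scaled_le(1)[of _ w]
    by (simp_all add: Y_base norm_divide divide_right_mono power2_eq_square)
qed

end

section \<open>Asymptotics of the characteristic function\<close>

locale T1_mean_zero = T1_operator +
  assumes q_mean: "integral {0..1} q = 0"
begin

text \<open>The first-order contribution of the potential to the characteristic function; at \<open>w = 2\<pi>n\<close> it equals
  \<open>-s\<^bsub>2n\<^esub>\<close>.\<close>

definition osc :: "complex \<Rightarrow> complex" where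
  "osc w = integral {0..1} (\<lambda>t. q t * sin (w * of_real (1 - 2 * t)))"

text \<open>Inserting the free solutions under the integrals of \<open>sine_kernel\<close> costs an error of second order. The
  products of sines and cosines that remain split into \<open>sin w\<close>, which is annihilated because \<open>q\<close> has mean
  zero, and \<open>\<plusminus>sin w(1 - 2t)\<close>.\<close>

lemma char_fun_expansion:
  assumes w: "2 * Q \<le> norm w" "w \<noteq> 0"
  shows "norm (char_fun (w^2) - ((1 - \<beta>) * (1 - cos w) - (1 + \<beta>) * osc w / (2 * w)))
           \<le> 2 * Q^2 * (1 + norm \<beta>) / (norm w)^2 * exp \<bar>Im w\<bar>"
proof -
  define C where "C = Y 1 0 (w^2) 0" define S where "S = Y 0 1 (w^2) 0"
  note cont = Y_continuous[of 1 0 "w^2" 0, folded C_def] Y_continuous[of 0 1 "w^2" 0, folded S_def]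
  define sn where "sn t = sin (w * of_real (1 - t))" for t
  define cs where "cs t = cos (w * of_real (1 - t))" for t
  define sn0 where "sn0 t = sin (w * of_real t)" for t
  define cs0 where "cs0 t = cos (w * of_real t)" for t
  have cn: "continuous_on A sn" "continuous_on A cs" "continuous_on A sn0" "continuous_on A cs0" for A
    unfolding sn_def cs_def sn0_def cs0_def by (intro continuous_intros)+
  define r1 where "r1 = integral {0..1} (\<lambda>t. q t * ((C t - cs0 t) * sn t))"
  define r2 where "r2 = integral {0..1} (\<lambda>t. q t * ((S t - sn0 t / w) * cs t))"
  have r1: "norm r1 \<le> (2 * Q / norm w * exp \<bar>Im w\<bar>) * Q"
    unfolding r1_def
  proof (rule q_integral_le)
    fix t :: real assume t: "t \<in> {0..1}"
    have "norm ((C t - cs0 t) * sn t) \<le> (2 * Q / norm w * exp (\<bar>Im w\<bar> * t)) * exp (\<bar>Im w\<bar> * (1 - t))"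
      unfolding norm_mult C_def cs0_def sn_def
      using t cosine_solution_bound(2)[OF w t] norm_sin_cos_scaled_le(1)[of "1 - t" w] Q_nonneg
      by (intro mult_mono) auto
    also have "\<dots> = 2 * Q / norm w * exp \<bar>Im w\<bar>" by (simp add: algebra_simps flip: exp_add)
    finally show "norm ((C t - cs0 t) * sn t) \<le> 2 * Q / norm w * exp \<bar>Im w\<bar>" .
  qed (auto intro!: continuous_intros cont cn)
  have r2: "norm r2 \<le> (2 * Q / (norm w)^2 * exp \<bar>Im w\<bar>) * Q"
    unfolding r2_def
  proof (rule q_integral_le)
    fix t :: real assume t: "t \<in> {0..1}"
    have "norm ((S t - sn0 t / w) * cs t) \<le> (2 * Q / (norm w)^2 * exp (\<bar>Im w\<bar> * t)) * exp (\<bar>Im w\<bar> * (1 - t))"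
      unfolding norm_mult S_def sn0_def cs_def
      using t sine_solution_bound(2)[OF w t] norm_sin_cos_scaled_le(2)[of "1 - t" w] Q_nonneg
      by (intro mult_mono) auto
    also have "\<dots> = 2 * Q / (norm w)^2 * exp \<bar>Im w\<bar>" by (simp add: algebra_simps flip: exp_add)
    finally show "norm ((S t - sn0 t / w) * cs t) \<le> 2 * Q / (norm w)^2 * exp \<bar>Im w\<bar>" .
  qed (use w in \<open>auto intro!: continuous_intros cont cn\<close>)
  define so where "so t = sin (w * of_real (1 - 2 * t))" for t
  have so: "continuous_on A so" for A unfolding so_def by (intro continuous_intros)
  have int: "(\<lambda>t. q t * f t) integrable_on {0..1}" if "continuous_on {0..1} f" for f
    using q_mult_integrable[OF that] by simp
  have 1: "integral {0..1} (\<lambda>t. q t * (cs0 t * sn t)) = osc w / 2"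
  proof -
    have "cs0 t * sn t = sin w / 2 + so t / 2" for t
    proof -
      have e: "w * of_real t + w * of_real (1 - t) = w" "w * of_real t - w * of_real (1 - t) = - (w * of_real (1 - 2 * t))"
        by (simp_all add: algebra_simps)
      show ?thesis unfolding cs0_def sn_def so_def cos_times_sin e sin_minus by simp
    qed
    then have "integral {0..1} (\<lambda>t. q t * (cs0 t * sn t)) = integral {0..1} (\<lambda>t. q t * (sin w / 2) + q t * (so t / 2))"
      by (simp add: distrib_left)
    also have "\<dots> = integral {0..1} (\<lambda>t. q t * (sin w / 2)) + integral {0..1} (\<lambda>t. q t * (so t / 2))"
      by (intro integral_add int continuous_intros so) auto
    finally show ?thesis by (simp add: q_mean osc_def so_def)
  qed
  have 2: "integral {0..1} (\<lambda>t. q t * (sn0 t * cs t)) = - osc w / 2"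
  proof -
    have "sn0 t * cs t = sin w / 2 - so t / 2" for t
    proof -
      have e: "w * of_real t + w * of_real (1 - t) = w" "w * of_real t - w * of_real (1 - t) = - (w * of_real (1 - 2 * t))"
        by (simp_all add: algebra_simps)
      show ?thesis unfolding sn0_def cs_def so_def sin_times_cos e sin_minus by simp
    qed
    then have "integral {0..1} (\<lambda>t. q t * (sn0 t * cs t)) = integral {0..1} (\<lambda>t. q t * (sin w / 2) - q t * (so t / 2))"
      by (simp add: right_diff_distrib)
    also have "\<dots> = integral {0..1} (\<lambda>t. q t * (sin w / 2)) - integral {0..1} (\<lambda>t. q t * (so t / 2))"
      by (intro integral_diff int continuous_intros so) auto
    finally show ?thesis by (simp add: q_mean osc_def so_def)
  qed
  have "integral {0..1} (\<lambda>t. q t * (C t * sn t)) = integral {0..1} (\<lambda>t. q t * (cs0 t * sn t) + q t * ((C t - cs0 t) * sn t))"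
    by (simp add: algebra_simps)
  also have "\<dots> = osc w / 2 + r1"
    unfolding 1[symmetric] r1_def by (intro integral_add int continuous_intros cn cont)
  finally have C1: "w * C 1 = w * cos w + osc w / 2 + r1"
    using sine_kernel(1)[OF Y_base(1)[of 1 0 "w^2"], of 1] by (simp add: C_def sn_def Y_base)
  have "integral {0..1} (\<lambda>t. q t * (S t * cs t)) = integral {0..1} (\<lambda>t. q t * (sn0 t * cs t) / w + q t * ((S t - sn0 t / w) * cs t))"
    using w by (intro integral_cong) (simp add: field_simps)
  also have "\<dots> = integral {0..1} (\<lambda>t. q t * (sn0 t * cs t) / w) + r2"
    unfolding r2_def using w
    by (intro integral_add integrable_on_divide int continuous_intros cn cont) auto
  also have "integral {0..1} (\<lambda>t. q t * (sn0 t * cs t) / w) = - osc w / 2 / w"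
    unfolding 2[symmetric] by simp
  finally have S1: "Y' 0 1 (w^2) 0 1 = cos w + (- osc w / 2 / w + r2)"
    using sine_kernel(2)[OF Y_base(1)[of 0 1 "w^2"], of 1] by (simp add: S_def cs_def Y_base)
  have C1': "Y 1 0 (w^2) 0 1 = cos w + osc w / (2 * w) + r1 / w"
    using C1 w by (simp add: C_def field_simps)
  have "char_fun (w^2) - ((1 - \<beta>) * (1 - cos w) - (1 + \<beta>) * osc w / (2 * w)) = \<beta> * r2 - r1 / w"
    unfolding char_fun_def S1 C1' using w by (simp add: field_simps)
  also have "norm \<dots> \<le> norm \<beta> * norm r2 + norm r1 / norm w"
    using norm_triangle_ineq4[of "\<beta> * r2" "r1 / w"] by (simp add: norm_mult norm_divide)
  also have "\<dots> \<le> norm \<beta> * (2 * Q / (norm w)^2 * exp \<bar>Im w\<bar> * Q) + (2 * Q / norm w * exp \<bar>Im w\<bar> * Q) / norm w"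
    by (intro add_mono mult_left_mono divide_right_mono r1 r2) auto
  also have "\<dots> = 2 * Q^2 * (1 + norm \<beta>) / (norm w)^2 * exp \<bar>Im w\<bar>"
    by (simp add: power2_eq_square algebra_simps add_divide_distrib)
  finally show ?thesis .
qed

lemma osc_le: "norm (osc w) \<le> exp \<bar>Im w\<bar> * Q"
  unfolding osc_def
proof (rule q_integral_le)
  fix t :: real assume t: "t \<in> {0..1}"
  have "\<bar>Im w\<bar> * \<bar>1 - 2 * t\<bar> \<le> \<bar>Im w\<bar> * 1" using t by (intro mult_left_mono) auto
  then have "exp \<bar>Im (w * of_real (1 - 2 * t))\<bar> \<le> exp \<bar>Im w\<bar>" by (simp add: abs_mult)
  then show "norm (sin (w * of_real (1 - 2 * t))) \<le> exp \<bar>Im w\<bar>"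
    using norm_sin_cos_le(1) order_trans by blast
qed (auto intro!: continuous_intros)

lemma char_fun_leading:
  assumes w: "2 * Q \<le> norm w" "w \<noteq> 0"
  shows "norm (char_fun (w^2) - (1 - \<beta>) * (1 - cos w)) \<le> 2 * Q * (1 + norm \<beta>) / norm w * exp \<bar>Im w\<bar>"
proof -
  define E where "E = exp \<bar>Im w\<bar>"
  have E: "0 < E" by (simp add: E_def)
  have b: "norm (1 + \<beta>) \<le> 1 + norm \<beta>" using norm_triangle_ineq[of 1 \<beta>] by simp
  have "norm ((1 + \<beta>) * osc w / (2 * w)) \<le> (1 + norm \<beta>) * (E * Q) / (2 * norm w)"
    unfolding norm_divide norm_mult E_def using osc_le[of w] b
    by (auto intro!: divide_right_mono mult_mono)
  moreover have "2 * Q^2 * (1 + norm \<beta>) / (norm w)^2 * E \<le> Q * (1 + norm \<beta>) / norm w * E"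
  proof -
    have "(2 * Q) * (Q * (1 + norm \<beta>)) \<le> norm w * (Q * (1 + norm \<beta>))"
      using w Q_nonneg by (intro mult_right_mono) auto
    then have "2 * Q^2 * (1 + norm \<beta>) / (norm w)^2 \<le> Q * (1 + norm \<beta>) / norm w"
      using w(2) by (simp add: divide_simps power2_eq_square mult_ac)
    then show ?thesis using E by (intro mult_right_mono) auto
  qed
  moreover define D where "D = char_fun (w^2) - ((1 - \<beta>) * (1 - cos w) - (1 + \<beta>) * osc w / (2 * w))"
  moreover have "norm D \<le> 2 * Q^2 * (1 + norm \<beta>) / (norm w)^2 * E"
    unfolding D_def E_def by (rule char_fun_expansion[OF w])
  ultimately have "norm (D - (1 + \<beta>) * osc w / (2 * w))
      \<le> Q * (1 + norm \<beta>) / norm w * E + (1 + norm \<beta>) * (E * Q) / (2 * norm w)"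
    by (intro order_trans[OF norm_triangle_ineq4 add_mono]) (auto intro: order_trans)
  moreover have "D - (1 + \<beta>) * osc w / (2 * w) = char_fun (w^2) - (1 - \<beta>) * (1 - cos w)"
    by (simp add: D_def)
  ultimately have "norm (char_fun (w^2) - (1 - \<beta>) * (1 - cos w))
     \<le> Q * (1 + norm \<beta>) / norm w * E + (1 + norm \<beta>) * (E * Q) / (2 * norm w)" by simp
  also have "\<dots> = (3 / 2) * (Q * (1 + norm \<beta>) / norm w * E)" by simp
  also have "\<dots> \<le> 2 * (Q * (1 + norm \<beta>) / norm w * E)"
    using Q_nonneg E by (intro mult_right_mono) auto
  finally show ?thesis by (simp add: E_def)
qed

end

section \<open>Counting zeros\<close>

text \<open>Rouche's theorem for entire functions on a disc, with the winding numbers evaluated.\<close>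

lemma Rouche_disc:
  assumes f: "f holomorphic_on UNIV" and g: "g holomorphic_on UNIV" and R: "0 < R"
    and less: "\<And>z. norm z = R \<Longrightarrow> norm (g z) < norm (f z)"
  shows "finite {z. norm z < R \<and> f z + g z = 0}" "finite {z. norm z < R \<and> f z = 0}"
    "(\<Sum>z | norm z < R \<and> f z + g z = 0. zorder (\<lambda>z. f z + g z) z) = (\<Sum>z | norm z < R \<and> f z = 0. zorder f z)"
proof -
  define s where "s = ball (0::complex) (R + 1)"
  have fin: "finite {z \<in> s. h z = 0}" if h: "h holomorphic_on UNIV" "h (of_real R) \<noteq> 0" for h
  proof (cases "h constant_on UNIV")
    case True
    then show ?thesis using h(2) by (auto simp: constant_on_def)
  next
    case False
    then have "finite {z \<in> cball 0 (R + 1). h z = 0}"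
      by (intro holomorphic_compact_finite_zeros[OF h(1)]) auto
    then show ?thesis by (rule rev_finite_subset) (auto simp: s_def)
  qed
  have nz: "f z \<noteq> 0" "f z + g z \<noteq> 0" if "norm z = R" for z
    using less[OF that] by (auto simp: add_eq_0_iff2 norm_minus_cancel)
  have fg: "(\<lambda>z. f z + g z) holomorphic_on UNIV" by (intro holomorphic_intros f g)
  have F: "finite {z \<in> s. f z + g z = 0}" "finite {z \<in> s. f z = 0}"
    using fin[OF fg] fin[OF f] nz[of "of_real R"] R by auto
  show "finite {z. norm z < R \<and> f z + g z = 0}" "finite {z. norm z < R \<and> f z = 0}"
    by (rule rev_finite_subset[OF F(1)] rev_finite_subset[OF F(2)]; auto simp: s_def)+
  define \<gamma> where "\<gamma> = circlepath (0::complex) R"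
  have R': "(\<Sum>p | p \<in> s \<and> f p + g p = 0. winding_number \<gamma> p * zorder (\<lambda>p. f p + g p) p) =
      (\<Sum>p | p \<in> s \<and> f p = 0. winding_number \<gamma> p * zorder f p)"
  proof (rule Rouche_theorem)
    show "f holomorphic_on s" "g holomorphic_on s" using f g holomorphic_on_subset by blast+
    show "path_image \<gamma> \<subseteq> s" using R by (auto simp: \<gamma>_def s_def)
    show "\<forall>z\<in>path_image \<gamma>. cmod (g z) < cmod (f z)" using R less by (auto simp: \<gamma>_def)
    show "\<forall>z. z \<notin> s \<longrightarrow> winding_number \<gamma> z = 0"
    proof (intro allI impI)
      fix z assume z: "z \<notin> s"
      show "winding_number \<gamma> z = 0"
        by (rule winding_number_zero_outside[of \<gamma> "cball 0 R"]) (use z R in \<open>auto simp: \<gamma>_def s_def\<close>)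
    qed
  qed (use F in \<open>auto simp: \<gamma>_def s_def\<close>)
  have red: "(\<Sum>p | p \<in> s \<and> h p = 0. winding_number \<gamma> p * zorder h p) = of_int (\<Sum>z | norm z < R \<and> h z = 0. zorder h z)"
    if F: "finite {z \<in> s. h z = 0}" and nz: "\<And>z. norm z = R \<Longrightarrow> h z \<noteq> 0" for h
  proof -
    have "(\<Sum>p | p \<in> s \<and> h p = 0. winding_number \<gamma> p * zorder h p)
        = (\<Sum>p | norm p < R \<and> h p = 0. winding_number \<gamma> p * zorder h p)"
    proof (rule sum.mono_neutral_right)
      show "\<forall>i\<in>{p. p \<in> s \<and> h p = 0} - {p. norm p < R \<and> h p = 0}. winding_number \<gamma> i * of_int (zorder h i) = 0"
      proof
        fix i assume "i \<in> {p. p \<in> s \<and> h p = 0} - {p. norm p < R \<and> h p = 0}"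
        then have "norm i > R" using nz[of i] by fastforce
        then have "winding_number \<gamma> i = 0"
          by (intro winding_number_zero_outside[of \<gamma> "cball 0 R"]) (use R in \<open>auto simp: \<gamma>_def\<close>)
        then show "winding_number \<gamma> i * of_int (zorder h i) = 0" by simp
      qed
    qed (use F in \<open>auto simp: s_def\<close>)
    also have "\<dots> = (\<Sum>p | norm p < R \<and> h p = 0. of_int (zorder h p))"
    proof (rule sum.cong)
      fix p assume "p \<in> {p. norm p < R \<and> h p = 0}"
      then have "winding_number \<gamma> p = 1" unfolding \<gamma>_def by (intro winding_number_circlepath) auto
      then show "winding_number \<gamma> p * of_int (zorder h p) = of_int (zorder h p)" by simp
    qed simp
    finally show ?thesis by simp
  qed
  have "complex_of_int (\<Sum>z | norm z < R \<and> f z + g z = 0. zorder (\<lambda>z. f z + g z) z)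
      = of_int (\<Sum>z | norm z < R \<and> f z = 0. zorder f z)"
    by (rule trans[OF trans[OF red[of "\<lambda>z. f z + g z", OF F(1) nz(2), symmetric] R'] red[of f, OF F(2) nz(1)]])
  then show "(\<Sum>z | norm z < R \<and> f z + g z = 0. zorder (\<lambda>z. f z + g z) z) = (\<Sum>z | norm z < R \<and> f z = 0. zorder f z)"
    by (simp only: of_int_eq_iff)
qed

text \<open>\<open>|1 - cos(u + iv)| = cosh v - cos u\<close>. For \<open>|v| \<ge> 1\<close> the hyperbolic cosine dominates; for \<open>|v| < 1\<close> the
  point \<open>|u|\<close> is within \<open>1 < \<pi>/2\<close> of an odd multiple of \<open>\<pi>\<close>, so \<open>cos u \<le> 0\<close>.\<close>

lemma one_minus_cos_lower_bound:
  fixes w :: complex and N :: nat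
  assumes "norm w = pi * (2 * real N + 1)"
  shows "exp \<bar>Im w\<bar> / 8 \<le> norm (1 - cos w)"
proof -
  define u where "u = Re w" define v where "v = Im w"
  define R where "R = pi * (2 * real N + 1)"
  have eq: "norm (1 - cos w) = (exp v + exp (- v)) / 2 - cos u"
  proof -
    have "1 - cos w = 2 * (sin (w / 2))^2"
      using cos_double_sin[of "w / 2"] by simp
    then have "norm (1 - cos w) = 2 * (norm (sin (w / 2)))^2" by (simp add: norm_mult norm_power)
    then show ?thesis unfolding norm_sin_squared by (simp add: u_def v_def exp_minus field_simps)
  qed
  show ?thesis
  proof (cases "1 \<le> \<bar>v\<bar>")
    case True
    define s where "s = exp \<bar>v\<bar>"
    have "exp 1 \<ge> (2::real)" using exp_ge_add_one_self[of 1] by simp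
    then have s: "2 \<le> s" using True unfolding s_def by (meson exp_le_cancel_iff order_trans)
    have "exp v + exp (- v) = s + 1 / s" unfolding s_def by (cases "v \<ge> 0") (auto simp: exp_minus field_simps)
    moreover have "cos u \<le> 1" by simp
    moreover have "s / 8 \<le> (s + 1 / s) / 2 - 1"
    proof -
      have "0 \<le> (s - 2) * (3 * s - 2)" using s by (intro mult_nonneg_nonneg) auto
      then have "s * s + 8 * s \<le> 4 * (s * s) + 4" by (simp add: algebra_simps)
      then show ?thesis using s by (simp add: field_simps)
    qed
    ultimately have "s / 8 \<le> (exp v + exp (- v)) / 2 - cos u" by (metis diff_left_mono order_trans)
    then show ?thesis unfolding eq by (simp add: s_def v_def)
  next
    case False
    have R0: "pi \<le> R" unfolding R_def using mult_left_mono[of 1 "2 * real N + 1" pi] by simp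
    have uv: "u^2 + v^2 = R^2"
      using assms cmod_power2[of w] by (simp add: u_def v_def R_def)
    have "v^2 \<le> 1" using False by (simp add: abs_square_le_1)
    have "u^2 \<le> R^2" using uv zero_le_power2[of v] by linarith
    moreover have "0 \<le> R" using R0 pi_gt_zero by linarith
    ultimately have uR: "\<bar>u\<bar> \<le> R" by (metis abs_le_square_iff abs_of_nonneg)
    have "(R - \<bar>u\<bar>) * (R + \<bar>u\<bar>) = R^2 - \<bar>u\<bar>^2" by (simp add: algebra_simps power2_eq_square)
    then have "(R - \<bar>u\<bar>) * (R + \<bar>u\<bar>) = v^2" using uv by simp
    then have "(R - \<bar>u\<bar>) * (R + \<bar>u\<bar>) \<le> 1" using \<open>v^2 \<le> 1\<close> by simp
    moreover have "(R - \<bar>u\<bar>) * 1 \<le> (R - \<bar>u\<bar>) * (R + \<bar>u\<bar>)"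
      using uR R0 pi_gt3 by (intro mult_left_mono) auto
    ultimately have "R - \<bar>u\<bar> \<le> 1" by simp
    then have c: "0 \<le> cos (R - \<bar>u\<bar>)" using uR pi_gt3 by (intro cos_ge_zero) auto
    have "R = real (2 * N + 1) * pi" by (simp add: R_def mult.commute)
    then have "cos R = -1" "sin R = 0"
      using cos_npi[of "2 * N + 1"] sin_npi[of "2 * N + 1"] by simp_all
    then have "cos (R - \<bar>u\<bar>) = - cos u" by (simp add: cos_diff)
    then have "cos u \<le> 0" using c by simp
    moreover define p where "p = (exp v + exp (- v)) / 2"
    moreover have "1 \<le> p"
      using add_mono[OF exp_ge_add_one_self[of v] exp_ge_add_one_self[of "-v"]] by (simp add: p_def)
    moreover have "exp \<bar>v\<bar> \<le> exp 1" using False by simp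
    moreover have "exp 1 \<le> (3::real)" using exp_le by simp
    ultimately show ?thesis unfolding eq v_def[symmetric] p_def[symmetric] by linarith
  qed
qed

lemma cos_quadratic:
  assumes "norm (w :: complex) \<le> 1"
  shows "norm (1 - cos w - w^2 / 2) \<le> norm w ^ 4"
proof -
  have "norm (cos w - (\<Sum>k\<le>3. complex_of_real (cos_coeff k) * w ^ k)) \<le> exp \<bar>Im w\<bar> * norm w ^ Suc 3 / fact 3"
    by (rule Taylor_cos)
  also have "(\<Sum>k\<le>3. complex_of_real (cos_coeff k) * w ^ k) = 1 - w^2 / 2"
  proof -
    have "{..3 :: nat} = {0, 1, 2, 3}" by auto
    then show ?thesis by (simp add: cos_coeff_def)
  qed
  finally have 1: "norm (cos w - (1 - w^2 / 2)) \<le> exp \<bar>Im w\<bar> * norm w ^ 4 / 6"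
    by (simp add: numeral_eq_Suc)
  have "exp \<bar>Im w\<bar> \<le> exp 1" using abs_Im_le_cmod[of w] assms by simp
  also have "\<dots> \<le> 3" by (rule exp_le)
  finally have "exp \<bar>Im w\<bar> * norm w ^ 4 / 6 \<le> 6 * norm w ^ 4 / 6"
    by (intro divide_right_mono mult_right_mono) auto
  with 1 show ?thesis using norm_minus_commute[of "cos w" "1 - w^2 / 2"] by (simp add: algebra_simps)
qed

definition free_char :: "complex \<Rightarrow> complex" where "free_char l = 1 - cos (csqrt l)"

lemma free_char_square: "free_char (w^2) = 1 - cos w"
proof -
  have "csqrt (w^2) = w \<or> csqrt (w^2) = - w"
    by (metis power2_csqrt power2_eq_iff)
  then show ?thesis by (auto simp: free_char_def)
qed

text \<open>\<open>1 - cos \<surd>\<lambda>\<close> is the characteristic function for \<open>q = 0\<close>, \<open>\<beta> = 0\<close>: there \<open>Q = 0\<close>, and for \<open>\<lambda> \<noteq> 0\<close>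
  the estimate of \<open>char_fun_leading\<close> becomes an equality. Hence it is entire in spite of the branch cut of the root.\<close>

lemma free_char_holomorphic: "free_char holomorphic_on UNIV"
proof -
  interpret Z: T1_mean_zero "\<lambda>_. 0" 0
    by unfold_locales (auto simp: absolutely_integrable_on_def)
  have Q0: "Z.Q = 0" by (simp add: Z.Q_def)
  have "Z.char_fun l = free_char l" for l
  proof (cases "l = 0")
    case True
    have 1: "Z.Y' 1 0 0 0 x = 0" if "x \<in> {0..1}" for x
      using Z.sine_kernel(2)[of "Z.Y 1 0 0 0" "Z.Y' 1 0 0 0" 0, OF _ that] Z.Y_base[of 1 0 0] by simp
    have "Z.Y 1 0 0 0 1 = 1 + integral {0..1} (Z.Y' 1 0 0 0)"
      using second_deriv_integral[OF Z.Y_base(1)[of 1 0 0], of 1] by (simp add: Z.Y_base)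
    also have "integral {0..1} (Z.Y' 1 0 0 0) = integral {0..1} (\<lambda>_ :: real. 0)"
      by (intro integral_cong 1)
    finally show ?thesis using True by (simp add: Z.char_fun_def free_char_def)
  next
    case False
    define w where "w = csqrt l"
    have w: "w \<noteq> 0" "w^2 = l" using False by (simp_all add: w_def)
    show ?thesis using Z.char_fun_leading[of w] w free_char_square[of w] by (simp add: Q0)
  qed
  then show ?thesis using Z.char_fun_holomorphic by presburger
qed

lemma free_char_eq_0_iff: "free_char l = 0 \<longleftrightarrow> (\<exists>n :: nat. l = of_real ((2 * pi * real n)^2))"
proof
  assume "free_char l = 0"
  then have "cos (csqrt l) = 1" by (simp add: free_char_def)
  then obtain k :: int where k: "csqrt l = of_real (2 * of_int k * pi)" unfolding cos_eq_1 by auto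
  have "l = (csqrt l)^2" by simp
  also have "\<dots> = of_real ((2 * pi * real (nat \<bar>k\<bar>))^2)"
    unfolding k by (simp add: power_mult_distrib)
  finally show "\<exists>n :: nat. l = of_real ((2 * pi * real n)^2)" by blast
next
  assume "\<exists>n :: nat. l = of_real ((2 * pi * real n)^2)"
  then obtain n :: nat where n: "l = (of_real (2 * pi * real n))^2" by auto
  have "cos (complex_of_real (2 * pi * real n)) = of_real (cos (2 * pi * real n))"
    by (rule cos_of_real)
  also have "\<dots> = 1" using cos_2npi[of n] by (simp add: mult.commute mult.left_commute)
  finally show "free_char l = 0" unfolding n free_char_square by simp
qed

text \<open>The root is not differentiable at \<open>0\<close>; the derivative is obtained as the limit of
  \<open>(1 - cos w) / w\<^sup>2\<close> after the substitution \<open>\<lambda> = w\<^sup>2\<close>.\<close>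

lemma zorder_free_char_0: "zorder free_char 0 = 1"
proof (rule zorder_zero_eqI')
  show an: "free_char analytic_on {0}"
    using free_char_holomorphic analytic_on_holomorphic by blast
  have "free_char 0 = 0" by (simp add: free_char_def)
  then show "(deriv ^^ i) free_char 0 = 0" if "i < nat 1" for i using that by simp
  have "(free_char has_field_derivative deriv free_char 0) (at 0)"
    using free_char_holomorphic by (intro holomorphic_derivI[of _ UNIV]) auto
  then have "((\<lambda>z. free_char z / z) \<longlongrightarrow> deriv free_char 0) (at 0)"
    using \<open>free_char 0 = 0\<close> by (simp add: has_field_derivative_iff)
  moreover have "filterlim (\<lambda>w :: complex. w^2) (at 0) (at 0)"
    unfolding filterlim_at
    by (auto intro!: tendsto_eq_intros simp: eventually_at_filter)
  ultimately have lim1: "((\<lambda>w. free_char (w^2) / w^2) \<longlongrightarrow> deriv free_char 0) (at 0)"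
    by (rule filterlim_compose)
  have "((\<lambda>w. (1 - cos w) / w^2 - 1 / 2) \<longlongrightarrow> 0) (at (0::complex))"
  proof (rule Lim_null_comparison)
    have "eventually (\<lambda>w. norm (w :: complex) \<le> 1 \<and> w \<noteq> 0) (at 0)"
      unfolding eventually_at by (intro exI[of _ 1]) (auto simp: dist_norm)
    then show "eventually (\<lambda>w. norm ((1 - cos w) / w^2 - 1 / 2) \<le> norm w ^ 2) (at (0::complex))"
    proof (rule eventually_mono)
      fix w :: complex assume w: "norm w \<le> 1 \<and> w \<noteq> 0"
      have "(1 - cos w) / w^2 - 1 / 2 = (1 - cos w - w^2 / 2) / w^2" using w by (simp add: field_simps)
      also have "norm \<dots> \<le> norm w ^ 4 / norm w ^ 2"
        unfolding norm_divide norm_power using cos_quadratic w by (intro divide_right_mono) auto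
      also have "\<dots> = norm w ^ 2" using w by (simp add: power_eq_if)
      finally show "norm ((1 - cos w) / w^2 - 1 / 2) \<le> norm w ^ 2" .
    qed
    show "((\<lambda>w :: complex. norm w ^ 2) \<longlongrightarrow> 0) (at 0)" by (auto intro!: tendsto_eq_intros)
  qed
  then have "((\<lambda>w. (1 - cos w) / w^2) \<longlongrightarrow> 1 / 2) (at (0::complex))"
    by (simp add: LIM_zero_iff)
  then have D: "deriv free_char 0 = 1 / 2"
    using lim1 unfolding free_char_square by (intro tendsto_unique[of "at (0::complex)"]) auto
  show "(deriv ^^ nat 1) free_char 0 \<noteq> 0" by (simp add: D)
qed simp

lemma zorder_free_char:
  assumes n: "1 \<le> (n :: nat)"
  shows "zorder free_char (of_real ((2 * pi * real n)^2)) = 2"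
proof -
  define l where "l = complex_of_real ((2 * pi * real n)^2)"
  define c where "c = complex_of_real (2 * pi * real n)"
  have c0: "c \<noteq> 0" using n by (simp add: c_def)
  have csl: "csqrt l = c" unfolding l_def c_def by (subst of_real_sqrt[symmetric]) (auto simp del: of_real_power)
  have cc: "cos c = 1" "sin c = 0"
    unfolding c_def cos_of_real sin_of_real using cos_2npi[of n] sin_2npi[of n]
    by (simp_all add: mult.commute mult.left_commute)
  have pos: "z \<notin> \<real>\<^sub>\<le>\<^sub>0" if "0 < Re z" for z using that by (auto simp: complex_nonpos_Reals_iff)
  have "0 < Re l" using n by (simp add: l_def)
  have d1: "deriv free_char z = sin (csqrt z) / (2 * csqrt z)" if "0 < Re z" for z
    unfolding free_char_def[abs_def] using pos[OF that]
    by (intro DERIV_imp_deriv) (auto intro!: derivative_eq_intros simp: field_simps)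
  have ev: "eventually (\<lambda>z. 0 < Re z) (nhds l)"
    using eventually_nhds_in_open[of "{z. 0 < Re z}" l] \<open>0 < Re l\<close> by (simp add: open_halfspace_Re_gt)
  have "deriv (deriv free_char) l = deriv (\<lambda>z. sin (csqrt z) / (2 * csqrt z)) l"
    using ev d1 by (intro deriv_cong_ev) (auto elim: eventually_mono)
  also have "\<dots> = 1 / (4 * c^2)"
    using pos[OF \<open>0 < Re l\<close>] c0
    by (intro DERIV_imp_deriv) (auto intro!: derivative_eq_intros simp: csl cc power2_eq_square)
  finally have d2: "deriv (deriv free_char) l \<noteq> 0" using c0 by simp
  have "zorder free_char l = 2"
  proof (rule zorder_zero_eqI')
    show "free_char analytic_on {l}" using free_char_holomorphic analytic_on_holomorphic by blast
    fix i assume "i < nat 2"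
    then have "i = 0 \<or> i = 1" by auto
    then show "(deriv ^^ i) free_char l = 0"
      using d1[OF \<open>0 < Re l\<close>] by (auto simp: csl cc free_char_def)
  qed (use d2 in \<open>auto simp: numeral_2_eq_2\<close>)
  then show ?thesis by (simp add: l_def)
qed

text \<open>Radius of a circle that separates the zeros \<open>(2\<pi>N)\<^sup>2\<close> and \<open>(2\<pi>(N + 1))\<^sup>2\<close> of \<open>free_char\<close>.\<close>

definition circle_radius :: "nat \<Rightarrow> real" where "circle_radius N = (pi * (2 * real N + 1))^2"

lemma circle_radius_pos: "0 < circle_radius N"
  by (auto simp: circle_radius_def add_eq_0_iff)

lemma free_char_count:
  "(\<Sum>l | norm l < circle_radius N \<and> free_char l = 0. zorder free_char l) = 2 * int N + 1"
proof -
  define z where "z n = complex_of_real ((2 * pi * real n)^2)" for n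
  have nz: "norm (z n) = (2 * pi * real n)^2" for n unfolding z_def norm_of_real by simp
  have iff: "norm (z n) < circle_radius N \<longleftrightarrow> n \<le> N" for n
  proof -
    have "norm (z n) < circle_radius N \<longleftrightarrow> 2 * pi * real n < pi * (2 * real N + 1)"
      unfolding nz circle_radius_def not_le[symmetric] by (subst power_mono_iff) auto
    also have "\<dots> \<longleftrightarrow> pi * (2 * real n) < pi * (2 * real N + 1)" by (simp add: mult_ac)
    also have "\<dots> \<longleftrightarrow> n \<le> N" unfolding mult_less_cancel_left_pos[OF pi_gt_zero] by linarith
    finally show ?thesis .
  qed
  have inj: "inj z"
  proof (rule injI)
    fix a b assume "z a = z b"
    then have "(2 * pi * real a)^2 = (2 * pi * real b)^2" unfolding z_def of_real_eq_iff .
    then show "a = b" by (simp add: power_mult_distrib)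
  qed
  have "{l. norm l < circle_radius N \<and> free_char l = 0} = z ` {..N}"
    using iff by (auto simp: free_char_eq_0_iff z_def)
  then have "(\<Sum>l | norm l < circle_radius N \<and> free_char l = 0. zorder free_char l) = (\<Sum>n\<le>N. zorder free_char (z n))"
    using inj by (simp add: sum.reindex inj_on_subset)
  also have "\<dots> = (\<Sum>n\<le>N. if n = 0 then 1 else 2)"
    by (intro sum.cong) (auto simp: z_def zorder_free_char zorder_free_char_0 simp del: of_real_power)
  also have "\<dots> = 2 * int N + 1" by (induction N) auto
  finally show ?thesis .
qed

context T1_mean_zero
begin

text \<open>The algebraic multiplicity of \<open>l\<close>, and the order of \<open>char_fun\<close> at \<open>l\<close>.\<close>

definition ord :: "complex \<Rightarrow> nat" where "ord l = subdegree (char_fps l)"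

definition zeros_below :: "nat \<Rightarrow> complex set" where
  "zeros_below N = {l. norm l < circle_radius N \<and> char_fun l = 0}"

text \<open>On the circle the difference to the free characteristic function is \<open>O(e\<^bsup>|Im w|\<^esup> / |w|)\<close> while the latter
  is at least of size \<open>e\<^bsup>|Im w|\<^esup>\<close>.\<close>

lemma zeros_below_count:
  "\<exists>N0. (\<forall>N\<ge>N0. finite (zeros_below N) \<and> (\<Sum>l\<in>zeros_below N. ord l) = 2 * N + 1) \<and>
     (\<exists>l. char_fun l \<noteq> 0)"
proof -
  \<comment> \<open>Beyond this frequency the error in \<open>char_fun_leading\<close> is below \<open>|1 - \<beta>| / 8\<close> times the exponential.\<close>
  define K where "K = 16 * Q * (1 + norm \<beta>) / norm (1 - \<beta>) + 2 * Q"
  define N0 where "N0 = nat \<lceil>K\<rceil> + 1"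
  define f where "f l = (1 - \<beta>) * free_char l" for l
  define g where "g l = char_fun l - f l" for l
  have b0: "0 < norm (1 - \<beta>)" using \<beta>_ne by simp
  have f: "f holomorphic_on UNIV" unfolding f_def by (intro holomorphic_intros free_char_holomorphic)
  have g: "g holomorphic_on UNIV" unfolding g_def by (intro holomorphic_intros f char_fun_holomorphic)
  have less: "norm (g l) < norm (f l)" if N: "N0 \<le> N" and l: "norm l = circle_radius N" for N l
  proof -
    define w where "w = csqrt l"
    have lw: "l = w^2" by (simp add: w_def)
    have nw: "norm w = pi * (2 * real N + 1)"
    proof -
      have "norm w ^ 2 = (pi * (2 * real N + 1))^2" using l unfolding lw circle_radius_def norm_power .
      then show ?thesis by (rule power2_eq_imp_eq) auto
    qed
    have "K < real N0" unfolding N0_def by linarith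
    also have "\<dots> \<le> 1 * (2 * real N + 1)" using N by simp
    also have "\<dots> \<le> norm w" unfolding nw using pi_gt3 by (intro mult_right_mono) auto
    finally have Kw: "K < norm w" .
    have "0 \<le> 16 * Q * (1 + norm \<beta>) / norm (1 - \<beta>)" using Q_nonneg by simp
    then have w: "2 * Q \<le> norm w" "16 * Q * (1 + norm \<beta>) / norm (1 - \<beta>) < norm w"
      using Kw Q_nonneg unfolding K_def by linarith+
    have w0: "w \<noteq> 0" using nw pi_gt_zero by (auto simp: add_eq_0_iff)
    have "norm (g l) \<le> 2 * Q * (1 + norm \<beta>) / norm w * exp \<bar>Im w\<bar>"
      unfolding g_def f_def lw free_char_square by (rule char_fun_leading[OF w(1) w0])
    also have "\<dots> < norm (1 - \<beta>) / 8 * exp \<bar>Im w\<bar>"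
      using w w0 b0 by (intro mult_strict_right_mono) (auto simp: field_simps)
    also have "\<dots> = norm (1 - \<beta>) * (exp \<bar>Im w\<bar> / 8)" by simp
    also have "\<dots> \<le> norm (f l)"
      unfolding f_def lw free_char_square norm_mult by (intro mult_left_mono one_minus_cos_lower_bound[OF nw]) auto
    finally show ?thesis .
  qed
  have fg: "(\<lambda>z. f z + g z) = char_fun" by (simp add: g_def fun_eq_iff)
  have "f z + g z = char_fun z" for z by (simp add: g_def)
  note R = Rouche_disc[OF f g circle_radius_pos less, unfolded fg this]
  have nz: "\<exists>l. char_fun l \<noteq> 0"
  proof -
    define l where "l = complex_of_real (circle_radius N0)"
    have "norm l = circle_radius N0" using circle_radius_pos[of N0] by (simp add: l_def)
    from less[OF order.refl this] have "char_fun l \<noteq> 0" by (auto simp: g_def)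
    then show ?thesis by blast
  qed
  have fo: "zorder f l = zorder free_char l" for l
    unfolding f_def using \<beta>_ne by (intro zorder_cmult) auto
  have f0: "f l = 0 \<longleftrightarrow> free_char l = 0" for l using \<beta>_ne by (simp add: f_def)
  show ?thesis
  proof (intro exI[of _ N0] conjI allI impI nz)
    fix N assume N: "N0 \<le> N"
    show "finite (zeros_below N)" using R(1)[OF N] unfolding zeros_below_def by blast
    have "int (\<Sum>l\<in>zeros_below N. ord l) = (\<Sum>l\<in>zeros_below N. zorder char_fun l)"
      using nz char_fps_nonzero by (auto simp: ord_def zorder_char_fun)
    also have "\<dots> = (\<Sum>l | norm l < circle_radius N \<and> f l = 0. zorder f l)"
      unfolding zeros_below_def by (rule R(3)[OF N])
    also have "\<dots> = int (2 * N + 1)" unfolding f0 fo free_char_count by simp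
    finally show "(\<Sum>l\<in>zeros_below N. ord l) = 2 * N + 1" by (simp only: of_nat_eq_iff)
  qed
qed

end

section \<open>Zeros near the double eigenvalues of the free operator\<close>

lemma frequency_near:
  fixes \<delta> :: complex
  assumes \<delta>: "norm \<delta> \<le> 1" and n: "1 \<le> real n"
  shows "6 * real n \<le> norm (complex_of_real (2 * pi * real n))"
    and "3 * real n \<le> norm (of_real (2 * pi * real n) + \<delta>)"
    and "exp \<bar>Im (of_real (2 * pi * real n) + \<delta>)\<bar> \<le> 3"
proof -
  have "6 * real n \<le> 2 * pi * real n" using pi_gt3 n by (intro mult_right_mono) auto
  then show 6: "6 * real n \<le> norm (complex_of_real (2 * pi * real n))" unfolding norm_of_real by simp
  have "norm (complex_of_real (2 * pi * real n)) - norm \<delta> \<le> norm (of_real (2 * pi * real n) + \<delta>)"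
    by (rule norm_diff_ineq)
  then show "3 * real n \<le> norm (of_real (2 * pi * real n) + \<delta>)" using 6 n \<delta> by linarith
  have "exp \<bar>Im (of_real (2 * pi * real n) + \<delta>)\<bar> \<le> exp 1" using abs_Im_le_cmod[of \<delta>] \<delta> by simp
  then show "exp \<bar>Im (of_real (2 * pi * real n) + \<delta>)\<bar> \<le> 3" using exp_le by linarith
qed

context T1_mean_zero
begin

lemma osc_near:
  assumes \<delta>: "norm \<delta> \<le> 1"
  shows "norm (osc (of_real (2 * pi * real n) + \<delta>) + sine_coeff q (2 * n)) \<le> 3 * norm \<delta> * Q"
proof -
  define a where "a t = - (2 * pi * real (2 * n) * t)" for t :: real
  have *: "sin ((of_real (2 * pi * real n) + \<delta>) * of_real (1 - 2 * t)) = sin (of_real (a t) + \<delta> * of_real (1 - 2 * t))" for t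
  proof -
    have "(of_real (2 * pi * real n) + \<delta>) * of_real (1 - 2 * t)
        = of_real (a t) + \<delta> * of_real (1 - 2 * t) + 2 * of_int (int n) * of_real pi"
      by (simp add: a_def algebra_simps)
    then show ?thesis using sin.plus_of_int[of "of_real (a t) + \<delta> * of_real (1 - 2 * t)" "int n"] by (simp add: mult_ac)
  qed
  have sa: "sin (complex_of_real (a t)) = - of_real (sin (2 * pi * real (2 * n) * t))" for t
    unfolding a_def by (simp flip: sin_of_real)
  define D where "D t = sin (of_real (a t) + \<delta> * of_real (1 - 2 * t)) - sin (complex_of_real (a t))" for t
  have "osc (of_real (2 * pi * real n) + \<delta>) + sine_coeff q (2 * n)
     = integral {0..1} (\<lambda>t. q t * sin (of_real (a t) + \<delta> * of_real (1 - 2 * t)) - q t * sin (complex_of_real (a t)))"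
  proof -
    have "integral {0..1} (\<lambda>t. q t * sin (of_real (a t) + \<delta> * of_real (1 - 2 * t)) - q t * sin (complex_of_real (a t)))
      = integral {0..1} (\<lambda>t. q t * sin (of_real (a t) + \<delta> * of_real (1 - 2 * t))) - integral {0..1} (\<lambda>t. q t * sin (complex_of_real (a t)))"
      unfolding a_def by (intro integral_diff q_mult_integrable continuous_intros) auto
    then show ?thesis unfolding osc_def * sa sine_coeff_def by simp
  qed
  also have "\<dots> = integral {0..1} (\<lambda>t. q t * D t)" by (simp add: D_def right_diff_distrib)
  also have "norm \<dots> \<le> (3 * norm \<delta>) * Q"
  proof (rule q_integral_le)
    show "continuous_on {0..1} D" unfolding D_def a_def by (intro continuous_intros)
    fix t :: real assume t: "t \<in> {0..1}"
    define z where "z = \<delta> * of_real (1 - 2 * t)"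
    have "norm \<delta> * \<bar>1 - 2 * t\<bar> \<le> norm \<delta> * 1" using t by (intro mult_left_mono) auto
    then have z: "norm z \<le> norm \<delta>"
      unfolding z_def norm_mult norm_of_real by simp
    have "norm (sin (of_real (a t) + z) - sin (complex_of_real (a t))) \<le> 3 * norm z"
      using z \<delta> by (intro sin_cos_lipschitz(1)) linarith
    also have "\<dots> \<le> 3 * norm \<delta>" using z by simp
    finally show "norm (D t) \<le> 3 * norm \<delta>" by (simp add: D_def z_def)
  qed simp
  finally show ?thesis by simp
qed

text \<open>The approximate value \<open>\<sigma>\<^sub>n\<close> of \<open>\<delta>\<^sup>2\<close> for the zeros \<open>(2\<pi>n + \<delta>)\<^sup>2\<close>, obtained by equating the quadratic part
  of \<open>(1 - \<beta>)(1 - cos \<delta>)\<close> with the first-order contribution of the potential.\<close>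

definition gap_square :: "nat \<Rightarrow> complex" where
  "gap_square n = (1 + \<beta>) / (\<beta> - 1) * sine_coeff q (2 * n) / of_real (2 * pi * real n)"

lemma sine_coeff_le: "norm (sine_coeff q n) \<le> Q"
proof -
  have "norm (sine_coeff q n) \<le> 1 * Q"
    unfolding sine_coeff_def
    by (rule q_integral_le) (auto intro!: continuous_intros)
  then show ?thesis by simp
qed

text \<open>Three errors add up: the second order in \<open>char_fun_expansion\<close>, the quartic remainder of the cosine, and
  the replacement of \<open>osc w / w\<close> by its value at \<open>2\<pi>n\<close>.\<close>

lemma char_fun_near:
  obtains C n0 where "0 < C"
    "\<And>n \<delta>. n0 \<le> n \<Longrightarrow> norm \<delta> \<le> 1 \<Longrightarrow>
      norm (char_fun ((of_real (2 * pi * real n) + \<delta>)^2) - (1 - \<beta>) / 2 * (\<delta>^2 - gap_square n))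
        \<le> C * (norm \<delta> ^ 4 + norm \<delta> / real n + 1 / (real n)^2)"
proof -
  define B where "B = 1 + norm \<beta>"
  have B: "1 \<le> B" "norm (1 + \<beta>) \<le> B" using norm_triangle_ineq[of 1 \<beta>] by (simp_all add: B_def)
  define C where "C = 6 * Q^2 * B + norm (1 - \<beta>) + 3 * Q * B + 1"
  define n0 where "n0 = nat \<lceil>Q\<rceil> + 1"
  have C: "0 < C" using B Q_nonneg by (auto simp: C_def intro!: add_nonneg_pos)
  have main: "norm (char_fun ((of_real (2 * pi * real n) + \<delta>)^2) - (1 - \<beta>) / 2 * (\<delta>^2 - gap_square n))
        \<le> C * (norm \<delta> ^ 4 + norm \<delta> / real n + 1 / (real n)^2)" if n: "n0 \<le> n" and \<delta>: "norm \<delta> \<le> 1" for n \<delta>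
  proof -
    define W where "W = complex_of_real (2 * pi * real n)"
    define w where "w = W + \<delta>"
    have n1: "1 \<le> real n" and nQ: "Q \<le> real n" using n unfolding n0_def by linarith+
    note W6 = frequency_near(1)[OF \<delta> n1, folded W_def]
    note w3 = frequency_near(2)[OF \<delta> n1, folded W_def w_def]
    note E = frequency_near(3)[OF \<delta> n1, folded W_def w_def]
    have w0: "w \<noteq> 0" "W \<noteq> 0" using w3 W6 n1 by auto
    have wQ: "2 * Q \<le> norm w" using w3 nQ n1 by linarith
    define s where "s = sine_coeff q (2 * n)"
    define R1 where "R1 = char_fun (w^2) - ((1 - \<beta>) * (1 - cos w) - (1 + \<beta>) * osc w / (2 * w))"
    define R2 where "R2 = (1 - \<beta>) * (1 - cos \<delta> - \<delta>^2 / 2)"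
    define R3 where "R3 = (1 + \<beta>) * ((osc w + s) / (2 * w) + s * \<delta> / (2 * W * w))"
    have R1: "norm R1 \<le> 6 * Q^2 * B * (1 / (real n)^2)"
    proof -
      have "norm R1 \<le> 2 * Q^2 * B / (norm w)^2 * exp \<bar>Im w\<bar>"
        unfolding R1_def B_def by (rule char_fun_expansion[OF wQ w0(1)])
      also have "\<dots> \<le> 2 * Q^2 * B / (real n)^2 * 3"
        using w3 n1 B E w0 by (intro mult_mono divide_left_mono power_mono) auto
      finally show ?thesis by simp
    qed
    have R2: "norm R2 \<le> norm (1 - \<beta>) * norm \<delta> ^ 4"
      unfolding R2_def norm_mult by (intro mult_left_mono cos_quadratic \<delta>) auto
    have R3: "norm R3 \<le> 3 * Q * B * (norm \<delta> / real n)"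
    proof -
      have "norm ((osc w + s) / (2 * w)) \<le> (3 * norm \<delta> * Q) / (2 * real n)"
      proof -
        have "norm (osc w + s) \<le> 3 * norm \<delta> * Q"
          unfolding w_def W_def s_def by (rule osc_near[OF \<delta>])
        then show ?thesis unfolding norm_divide norm_mult using w3 n1 Q_nonneg by (intro frac_le) auto
      qed
      moreover have "norm (s * \<delta> / (2 * W * w)) \<le> (Q * norm \<delta>) / (2 * (1 * real n))"
        unfolding norm_divide norm_mult s_def using W6 w3 n1 sine_coeff_le[of "2 * n"] Q_nonneg
        by (intro frac_le mult_mono) auto
      ultimately have "norm ((osc w + s) / (2 * w) + s * \<delta> / (2 * W * w))
          \<le> (3 * norm \<delta> * Q) / (2 * real n) + (Q * norm \<delta>) / (2 * (1 * real n))"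
        by (rule norm_triangle_mono)
      also have "\<dots> = 2 * (Q * norm \<delta> / real n)" by (simp add: field_simps)
      also have "\<dots> \<le> 3 * (Q * norm \<delta> / real n)" using Q_nonneg by (intro mult_right_mono) auto
      finally have "norm R3 \<le> B * (3 * (Q * norm \<delta> / real n))"
        unfolding R3_def norm_mult using B by (intro mult_mono) auto
      then show ?thesis by (simp add: mult_ac)
    qed
    have cw: "cos w = cos \<delta>"
      using cos.plus_of_int[of \<delta> "int n"] unfolding w_def W_def by (simp add: add.commute mult_ac)
    define X where "X = (1 - \<beta>) / 2 * gap_square n"
    have "X = - ((1 + \<beta>) * s / (2 * W))"
      unfolding X_def
      unfolding gap_square_def W_def[symmetric] s_def[symmetric] using \<beta>_ne w0 by (simp add: divide_simps) (simp add: algebra_simps)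
    moreover have "(1 + \<beta>) * osc w / (2 * w) = R3 - (1 + \<beta>) * s / (2 * W)"
    proof -
      have "\<delta> = w - W" by (simp add: w_def)
      then show ?thesis unfolding R3_def using w0 by (simp add: divide_simps) (simp add: algebra_simps)
    qed
    ultimately have Z: "(1 + \<beta>) * osc w / (2 * w) = R3 + X" by simp
    have e: "(1 - \<beta>) / 2 * (\<delta>^2 - gap_square n) = (1 - \<beta>) / 2 * \<delta>^2 - X"
      "R2 = (1 - \<beta>) * (1 - cos \<delta>) - (1 - \<beta>) / 2 * \<delta>^2"
      by (simp_all add: X_def R2_def right_diff_distrib)
    have "char_fun (w^2) - (1 - \<beta>) / 2 * (\<delta>^2 - gap_square n) = R1 + R2 - R3"
      unfolding R1_def cw Z e by simp
    also have "norm \<dots> \<le> norm R1 + norm R2 + norm R3"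
      by (intro order_trans[OF norm_triangle_ineq4] add_right_mono norm_triangle_ineq)
    also have "\<dots> \<le> 6 * Q^2 * B * (1 / (real n)^2) + norm (1 - \<beta>) * norm \<delta> ^ 4 + 3 * Q * B * (norm \<delta> / real n)"
      using R1 R2 R3 by (intro add_mono)
    also have "\<dots> \<le> C * (1 / (real n)^2) + C * norm \<delta> ^ 4 + C * (norm \<delta> / real n)"
      using B Q_nonneg by (intro add_mono mult_right_mono) (auto simp: C_def)
    finally show ?thesis unfolding w_def W_def by (simp add: distrib_left add_ac)
  qed
  show ?thesis by (rule that[OF C main])
qed

text \<open>The square root of \<open>gap_square\<close> with the branch that the asymptotic formula prescribes: up to sign,
  \<open>4\<pi>n gap n\<close> is its leading correction to \<open>(2\<pi>n)\<^sup>2\<close>.\<close>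

definition gap :: "nat \<Rightarrow> complex" where
  "gap n = csqrt (2 * gamma1 \<beta>) / 2 * csqrt (of_nat n * sine_coeff q (2 * n)) / of_real (4 * pi * real n)"

lemma gap_power2: "(gap n)^2 = gap_square n"
proof (cases "n = 0")
  case False
  have "(gap n)^2 = 2 * gamma1 \<beta> / 4 * (of_nat n * sine_coeff q (2 * n)) / (of_real (4 * pi * real n))^2"
    by (simp add: gap_def power_divide power_mult_distrib del: of_real_mult)
  also have "\<dots> = gap_square n"
    unfolding gap_square_def gamma1_def using \<beta>_ne False
    by (simp add: divide_simps power2_eq_square) (simp add: algebra_simps)
  finally show ?thesis .
qed (simp add: gap_def gap_square_def)

text \<open>\<open>n\<^sup>2 |gap n|\<^sup>2\<close> is a positive multiple of \<open>n |s\<^bsub>2n\<^esub>|\<close>, which tends to infinity by hypothesis because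
  \<open>ln n \<ge> 1\<close> eventually; and \<open>|gap n|\<^sup>2 = O(1/n)\<close> because the sine coefficients are bounded.\<close>

lemma gap_asymptotics:
  assumes dom: "sine_coeff_dominates q \<nu>" and \<nu>: "filterlim \<nu> at_top sequentially"
  shows "\<forall>\<^sub>F k in sequentially. gap (\<nu> k) \<noteq> 0"
    and "(\<lambda>k. norm (gap (\<nu> k))) \<longlonglongrightarrow> 0"
    and "(\<lambda>k. 1 / (real (\<nu> k) * norm (gap (\<nu> k)))) \<longlonglongrightarrow> 0"
proof -
  define r where "r = (1 + \<beta>) / (\<beta> - 1)"
  have "r \<noteq> 0" using \<beta>_ne by (auto simp: r_def add_eq_0_iff)
  define A where "A = norm r / (2 * pi)"
  have A: "0 < A" using \<open>r \<noteq> 0\<close> by (simp add: A_def)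
  have gA: "(norm (gap n))^2 = A * norm (sine_coeff q (2 * n)) / real n" for n
  proof -
    have "(norm (gap n))^2 = norm (gap_square n)" unfolding gap_power2[symmetric] norm_power ..
    then show ?thesis unfolding gap_square_def r_def[symmetric] by (simp add: A_def norm_mult norm_divide mult_ac)
  qed
  have big: "\<forall>\<^sub>F k in sequentially. 3 \<le> \<nu> k" using \<nu> by (simp add: filterlim_at_top)
  have nz: "\<forall>\<^sub>F k in sequentially. sine_coeff q (2 * \<nu> k) \<noteq> 0"
    and lim: "(\<lambda>k. of_real (ln (real (\<nu> k))) / (of_nat (\<nu> k) * sine_coeff q (2 * \<nu> k))) \<longlonglongrightarrow> 0"
    using dom by (auto simp: sine_coeff_dominates_def)
  show "\<forall>\<^sub>F k in sequentially. gap (\<nu> k) \<noteq> 0"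
    using big nz
  proof eventually_elim
    case (elim k)
    then have "(norm (gap (\<nu> k)))^2 > 0" unfolding gA using A by simp
    then show ?case by auto
  qed
  have inv0: "(\<lambda>k. 1 / real (\<nu> k)) \<longlonglongrightarrow> 0"
    using filterlim_compose[OF lim_inverse_n' \<nu>] by simp
  have "(\<lambda>k. (norm (gap (\<nu> k)))^2) \<longlonglongrightarrow> 0"
  proof (rule Lim_null_comparison)
    show "\<forall>\<^sub>F k in sequentially. norm ((norm (gap (\<nu> k)))^2) \<le> A * Q * (1 / real (\<nu> k))"
      using A sine_coeff_le by (intro always_eventually allI) (auto simp: gA intro!: divide_right_mono)
    show "(\<lambda>k. A * Q * (1 / real (\<nu> k))) \<longlonglongrightarrow> 0" by (rule tendsto_mult_right_zero[OF inv0])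
  qed
  then have "(\<lambda>k. sqrt ((norm (gap (\<nu> k)))^2)) \<longlonglongrightarrow> sqrt 0" by (rule tendsto_real_sqrt)
  then show "(\<lambda>k. norm (gap (\<nu> k))) \<longlonglongrightarrow> 0" by simp
  have "(\<lambda>k. (1 / (real (\<nu> k) * norm (gap (\<nu> k))))^2) \<longlonglongrightarrow> 0"
  proof (rule Lim_null_comparison)
    show "\<forall>\<^sub>F k in sequentially. norm ((1 / (real (\<nu> k) * norm (gap (\<nu> k))))^2)
        \<le> 1 / A * norm (of_real (ln (real (\<nu> k))) / (of_nat (\<nu> k) * sine_coeff q (2 * \<nu> k)) :: complex)"
      using big nz
    proof eventually_elim
      case (elim k)
      have "exp 1 \<le> real (\<nu> k)" using exp_le elim by linarith
      then have "ln (exp 1) \<le> ln (real (\<nu> k))" using elim by (subst ln_le_cancel_iff) auto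
      then have l: "1 \<le> ln (real (\<nu> k))" by simp
      have "norm ((1 / (real (\<nu> k) * norm (gap (\<nu> k))))^2) = 1 / (A * (real (\<nu> k) * norm (sine_coeff q (2 * \<nu> k))))"
      proof -
        have "(real (\<nu> k))^2 * (A * norm (sine_coeff q (2 * \<nu> k)) / real (\<nu> k))
            = A * (real (\<nu> k) * norm (sine_coeff q (2 * \<nu> k)))"
          using elim by (simp add: power2_eq_square)
        then show ?thesis unfolding power_divide power_mult_distrib gA using A by (simp add: abs_mult)
      qed
      also have "\<dots> \<le> ln (real (\<nu> k)) / (A * (real (\<nu> k) * norm (sine_coeff q (2 * \<nu> k))))"
        using l A by (intro divide_right_mono) auto
      also have "\<dots> = 1 / A * norm (of_real (ln (real (\<nu> k))) / (of_nat (\<nu> k) * sine_coeff q (2 * \<nu> k)) :: complex)"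
        using l by (simp add: norm_divide norm_mult)
      finally show ?case .
    qed
    show "(\<lambda>k. 1 / A * norm (of_real (ln (real (\<nu> k))) / (of_nat (\<nu> k) * sine_coeff q (2 * \<nu> k)) :: complex)) \<longlonglongrightarrow> 0"
      using tendsto_mult_right_zero[OF tendsto_norm_zero[OF lim]] .
  qed
  then have "(\<lambda>k. sqrt ((1 / (real (\<nu> k) * norm (gap (\<nu> k))))^2)) \<longlonglongrightarrow> sqrt 0" by (rule tendsto_real_sqrt)
  then show "(\<lambda>k. 1 / (real (\<nu> k) * norm (gap (\<nu> k)))) \<longlonglongrightarrow> 0" by simp
qed

text \<open>On the circle of radius \<open>\<epsilon> |gap|\<close> around \<open>\<plusminus>gap\<close> the factor \<open>\<delta>\<^sup>2 - gap\<^sup>2\<close> is at least \<open>\<epsilon> |gap|\<^sup>2\<close>, and at the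
  centre it vanishes. The error in \<open>char_fun_near\<close> is \<open>o(|gap|\<^sup>2)\<close> by \<open>gap_asymptotics\<close>. So the modulus is
  smaller at the centre than on the circle, which forces a zero inside.\<close>

lemma zeros_near:
  assumes dom: "sine_coeff_dominates q \<nu>" and \<nu>: "filterlim \<nu> at_top sequentially"
    and \<epsilon>: "0 < \<epsilon>" "\<epsilon> \<le> 1"
  shows "\<forall>\<^sub>F k in sequentially. \<forall>j :: nat. \<exists>\<delta>. norm (\<delta> - (-1) ^ j * gap (\<nu> k)) < \<epsilon> * norm (gap (\<nu> k)) \<and>
           char_fun ((of_real (2 * pi * real (\<nu> k)) + \<delta>)^2) = 0"
proof -
  obtain C n0 where C: "0 < C" and near: "\<And>n \<delta>. n0 \<le> n \<Longrightarrow> norm \<delta> \<le> 1 \<Longrightarrow>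
      norm (char_fun ((of_real (2 * pi * real n) + \<delta>)^2) - (1 - \<beta>) / 2 * (\<delta>^2 - gap_square n))
        \<le> C * (norm \<delta> ^ 4 + norm \<delta> / real n + 1 / (real n)^2)" using char_fun_near by metis
  define b where "b = norm (1 - \<beta>) / 2"
  have b: "0 < b" using \<beta>_ne by (simp add: b_def)
  note g = gap_asymptotics[OF dom \<nu>]
  define D where "D k = norm (gap (\<nu> k))" for k
  define T where "T k = 1 / (real (\<nu> k) * norm (gap (\<nu> k)))" for k
  have "(\<lambda>k. 16 * D k ^ 2 + 2 * T k + T k ^ 2) \<longlonglongrightarrow> 16 * 0 ^ 2 + 2 * 0 + 0 ^ 2"
    unfolding D_def T_def by (intro tendsto_intros g(2,3))
  moreover have "0 < b * \<epsilon> / (2 * C)" using b \<epsilon> C by simp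
  ultimately have small: "\<forall>\<^sub>F k in sequentially. 16 * D k ^ 2 + 2 * T k + T k ^ 2 < b * \<epsilon> / (2 * C)"
    by (intro order_tendstoD(2)) auto
  have D1: "\<forall>\<^sub>F k in sequentially. D k < 1 / 2"
    using g(2) unfolding D_def by (intro order_tendstoD(2)) auto
  have big: "\<forall>\<^sub>F k in sequentially. n0 + 1 \<le> \<nu> k" using \<nu> unfolding filterlim_at_top by blast
  show ?thesis using g(1) small D1 big
  proof eventually_elim
    case (elim k)
    define n where "n = \<nu> k"
    have n: "n0 \<le> n" "0 < n" using elim by (auto simp: n_def)
    have D: "0 < D k" using elim by (simp add: D_def)
    have err: "2 * (C * (norm \<delta> ^ 4 + norm \<delta> / real n + 1 / (real n)^2)) < b * \<epsilon> * D k ^ 2"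
      if "norm \<delta> \<le> 2 * D k" for \<delta>
    proof -
      have "norm \<delta> ^ 4 \<le> (2 * D k) ^ 4" using that by (intro power_mono) auto
      moreover have "norm \<delta> / real n \<le> 2 * D k / real n" using that n by (intro divide_right_mono) auto
      ultimately have "norm \<delta> ^ 4 + norm \<delta> / real n + 1 / (real n)^2
          \<le> (2 * D k) ^ 4 + 2 * D k / real n + 1 / (real n)^2" by simp
      also have "\<dots> = (16 * D k ^ 2 + 2 * T k + T k ^ 2) * D k ^ 2"
        using D n by (simp add: T_def D_def n_def[symmetric] field_simps power2_eq_square power4_eq_xxxx)
      also have "\<dots> < b * \<epsilon> / (2 * C) * D k ^ 2"
        using elim D by (intro mult_strict_right_mono) auto
      finally show ?thesis using C by (simp add: field_simps)
    qed
    show ?case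
    proof
      fix j :: nat
      define c where "c = (-1) ^ j * gap n"
      have c: "norm c = D k" "c^2 = gap_square n"
        by (simp_all add: c_def D_def n_def norm_mult norm_power power_mult_distrib gap_power2 flip: power_mult)
      define F where "F \<delta> = char_fun ((of_real (2 * pi * real n) + \<delta>)^2)" for \<delta>
      have F: "F holomorphic_on A" for A
        unfolding F_def
        by (intro holomorphic_on_compose_gen[OF _ char_fun_holomorphic, unfolded o_def] holomorphic_intros) auto
      have Fle: "norm (F \<delta> - (1 - \<beta>) / 2 * (\<delta>^2 - gap_square n)) \<le> C * (norm \<delta> ^ 4 + norm \<delta> / real n + 1 / (real n)^2)"
        if "norm \<delta> \<le> 2 * D k" for \<delta>
        unfolding F_def using that elim by (intro near n) auto
      have "\<exists>\<delta> \<in> ball c (\<epsilon> * D k). F \<delta> = 0"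
      proof (rule holomorphic_contract_to_zero[of c "\<epsilon> * D k" F])
        show "continuous_on (cball c (\<epsilon> * D k)) F" by (rule holomorphic_on_imp_continuous_on[OF F])
        show "F holomorphic_on ball c (\<epsilon> * D k)" by (rule F)
        show "0 < \<epsilon> * D k" using \<epsilon> D by simp
        fix z assume z: "norm (c - z) = \<epsilon> * D k"
        have "\<epsilon> * D k \<le> 1 * D k" using \<epsilon> D by (intro mult_right_mono) auto
        then have z': "norm (z - c) = \<epsilon> * D k" "norm (z - c) \<le> D k" using z by (simp_all add: norm_minus_commute)
        have z2: "norm z \<le> 2 * D k" using norm_triangle_ineq[of c "z - c"] z' c by simp
        have c2: "norm c \<le> 2 * D k" using c D by simp
        have "norm (F c) \<le> C * (norm c ^ 4 + norm c / real n + 1 / (real n)^2)"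
          using Fle[OF c2] unfolding c(2) by simp
        then have Fc: "2 * norm (F c) < b * \<epsilon> * D k ^ 2" using err[OF c2] by linarith
        have "2 * D k \<le> norm (z + c) + norm (z - c)"
          using norm_triangle_ineq4[of "z + c" "z - c"] c by (simp add: norm_mult flip: mult_2)
        then have "D k \<le> norm (z + c)" using z' by linarith
        then have "\<epsilon> * D k * D k \<le> norm (z - c) * norm (z + c)" unfolding z'(1) using \<epsilon> D by (intro mult_left_mono) auto
        also have "\<dots> = norm (z^2 - gap_square n)"
          unfolding c(2)[symmetric] norm_mult[symmetric] by (simp add: algebra_simps power2_eq_square)
        finally have "b * (\<epsilon> * D k * D k) \<le> norm ((1 - \<beta>) / 2 * (z^2 - gap_square n))"
          unfolding norm_mult using b by (auto simp: b_def norm_divide)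
        moreover have "norm ((1 - \<beta>) / 2 * (z^2 - gap_square n)) \<le> norm (F z) + norm (F z - (1 - \<beta>) / 2 * (z^2 - gap_square n))"
          by (metis norm_minus_commute norm_triangle_sub)
        ultimately have "b * \<epsilon> * D k ^ 2 < 2 * norm (F z)"
          using Fle[OF z2] err[OF z2] by (simp add: power2_eq_square mult.assoc)
        then show "norm (F c) < norm (F z)" using Fc by simp
      qed blast
      then show "\<exists>\<delta>. norm (\<delta> - (-1) ^ j * gap (\<nu> k)) < \<epsilon> * norm (gap (\<nu> k)) \<and>
           char_fun ((of_real (2 * pi * real (\<nu> k)) + \<delta>)^2) = 0"
        by (auto simp: F_def c_def D_def n_def dist_norm norm_minus_commute)
    qed
  qed
qed

end

section \<open>Asymptotics of the eigenvalues\<close>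

text \<open>Used to label the finitely many small eigenvalues with the right multiplicities.\<close>

lemma exists_function_with_fibre_cards:
  fixes m :: "'b \<Rightarrow> nat"
  assumes "finite I" "finite Z" "card I = (\<Sum>z\<in>Z. m z)"
  obtains f where "f ` I \<subseteq> Z" "\<And>z. z \<in> Z \<Longrightarrow> card {i \<in> I. f i = z} = m z"
proof -
  define S where "S = Sigma Z (\<lambda>z. {..<m z})"
  have "finite S" "card S = card I" using assms by (simp_all add: S_def)
  then obtain g where g: "bij_betw g I S" using finite_same_card_bij[OF assms(1)] by metis
  have "card {i \<in> I. fst (g i) = z} = m z" if "z \<in> Z" for z
  proof -
    have "g ` {i \<in> I. fst (g i) = z} = {s \<in> S. fst s = z}"
      unfolding bij_betw_imp_surj_on[OF g, symmetric] by auto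
    also have "\<dots> = {z} \<times> {..<m z}" using that by (auto simp: S_def)
    finally have "bij_betw g {i \<in> I. fst (g i) = z} ({z} \<times> {..<m z})"
      by (intro bij_betw_subset[OF g]) auto
    from bij_betw_same_card[OF this] show ?thesis by simp
  qed
  moreover have "(\<lambda>i. fst (g i)) ` I \<subseteq> Z" using bij_betwE[OF g] by (auto simp: S_def mem_Times_iff split_beta Sigma_def)
  ultimately show ?thesis by (intro that[of "\<lambda>i. fst (g i)"]) auto
qed

lemma circle_radius_less_iff: "circle_radius m < circle_radius n \<longleftrightarrow> m < n"
proof -
  have "circle_radius m < circle_radius n \<longleftrightarrow> pi * (2 * real m + 1) < pi * (2 * real n + 1)"
    unfolding circle_radius_def not_le[symmetric] by (subst power_mono_iff) auto
  then show ?thesis by simp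
qed

lemma circle_radius_mono: "m \<le> n \<Longrightarrow> circle_radius m \<le> circle_radius n"
  using circle_radius_less_iff[of n m] by linarith

lemma annulus_disjoint:
  assumes "circle_radius (n - 1) \<le> r" "r < circle_radius n" "circle_radius (m - 1) \<le> r" "r < circle_radius m"
  shows "n = m"
proof (rule ccontr)
  assume "n \<noteq> m"
  then have "n \<le> m - 1 \<or> m \<le> n - 1" by linarith
  then show False using circle_radius_mono[of n "m - 1"] circle_radius_mono[of m "n - 1"] assms by linarith
qed

lemma square_in_annulus:
  fixes \<delta> :: complex
  assumes n: "1 \<le> n" and \<delta>: "norm \<delta> < 1"
  shows "circle_radius (n - 1) \<le> norm ((of_real (2 * pi * real n) + \<delta>)^2)"
    "norm ((of_real (2 * pi * real n) + \<delta>)^2) < circle_radius n"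
proof -
  have nW: "norm (complex_of_real (2 * pi * real n)) = 2 * pi * real n" unfolding norm_of_real by simp
  have "2 * pi * real n - 1 \<le> norm (of_real (2 * pi * real n) + \<delta>)"
    using norm_diff_ineq[of "of_real (2 * pi * real n)" \<delta>] \<delta> unfolding nW by linarith
  moreover have "pi * (2 * real (n - 1) + 1) = 2 * pi * real n - pi" using n by (simp add: of_nat_diff algebra_simps)
  ultimately have "pi * (2 * real (n - 1) + 1) \<le> norm (of_real (2 * pi * real n) + \<delta>)" using pi_gt3 by linarith
  then show "circle_radius (n - 1) \<le> norm ((of_real (2 * pi * real n) + \<delta>)^2)"
    unfolding circle_radius_def norm_power by (intro power_mono) auto
  have "norm (of_real (2 * pi * real n) + \<delta>) < 2 * pi * real n + 1"
    using norm_triangle_ineq[of "of_real (2 * pi * real n)" \<delta>] \<delta> unfolding nW by linarith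
  also have "\<dots> \<le> pi * (2 * real n + 1)" using pi_gt3 by (simp add: algebra_simps)
  finally show "norm ((of_real (2 * pi * real n) + \<delta>)^2) < circle_radius n"
    unfolding circle_radius_def norm_power by (intro power_strict_mono) auto
qed

lemma square_shift_inj:
  assumes n: "1 \<le> (n :: nat)" and \<delta>: "norm \<delta> < 1" "norm \<delta>' < 1"
    and eq: "(complex_of_real (2 * pi * real n) + \<delta>)^2 = (of_real (2 * pi * real n) + \<delta>')^2"
  shows "\<delta> = \<delta>'"
proof (rule ccontr)
  assume "\<delta> \<noteq> \<delta>'"
  with eq have "complex_of_real (2 * pi * real n) + \<delta> = - (of_real (2 * pi * real n) + \<delta>')"
    unfolding power2_eq_iff by simp
  then have "complex_of_real (4 * pi * real n) = - \<delta> - \<delta>'" by (simp add: algebra_simps eq_neg_iff_add_eq_0)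
  then have "norm (complex_of_real (4 * pi * real n)) \<le> norm \<delta> + norm \<delta>'"
    using norm_triangle_ineq4[of "- \<delta>" \<delta>'] by simp
  then have "4 * pi * real n < 2" unfolding norm_of_real using \<delta> by simp
  moreover have "1 * 4 \<le> real n * (4 * pi)" using n pi_gt3 by (intro mult_mono) auto
  ultimately show False by (simp add: mult_ac)
qed

context T1_mean_zero
begin

lemma ord_pos_iff:
  assumes "char_fun l0 \<noteq> 0"
  shows "1 \<le> ord l \<longleftrightarrow> char_fun l = 0"
proof -
  have "char_fps l $ 0 = char_fun l" by (simp add: char_fps_def char_fun_def Y_fps_def Y'_fps_def)
  then show ?thesis using char_fps_nonzero[OF assms, of l] subdegree_eq_0_iff[of "char_fps l"]
    unfolding ord_def by auto
qed

lemma multiplicity_ord: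
  assumes "char_fun l0 \<noteq> 0"
  shows "T1_alg_multiplicity q \<beta> l (ord l)"
  unfolding ord_def by (rule T1_multiplicity_subdegree(1)[OF char_fps_nonzero[OF assms]])

definition near_zero :: "real \<Rightarrow> nat \<Rightarrow> nat \<Rightarrow> complex \<Rightarrow> bool" where
  "near_zero \<epsilon> n j \<delta> \<longleftrightarrow> norm (\<delta> - (-1) ^ j * gap n) < \<epsilon> * norm (gap n) \<and>
     char_fun ((of_real (2 * pi * real n) + \<delta>)^2) = 0"

lemma near_zero_small:
  assumes "near_zero \<epsilon> n j \<delta>" "\<epsilon> \<le> 1" "norm (gap n) < 1 / 2"
  shows "norm \<delta> < 2 * norm (gap n)" "norm \<delta> < 1"
proof -
  have "norm \<delta> \<le> norm ((-1) ^ j * gap n) + norm (\<delta> - (-1) ^ j * gap n)"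
    using norm_triangle_ineq[of "(-1) ^ j * gap n" "\<delta> - (-1) ^ j * gap n"] by simp
  also have "norm ((-1) ^ j * gap n) = norm (gap n)" by (simp add: norm_mult norm_power)
  also have "norm (\<delta> - (-1) ^ j * gap n) < \<epsilon> * norm (gap n)" using assms by (simp add: near_zero_def)
  also have "\<dots> \<le> 1 * norm (gap n)" using assms by (intro mult_right_mono) auto
  finally show "norm \<delta> < 2 * norm (gap n)" by simp
  then show "norm \<delta> < 1" using assms by simp
qed

lemma near_zero_distinct:
  assumes "near_zero \<epsilon> n 1 \<delta>1" "near_zero \<epsilon>' n 2 \<delta>2" "\<epsilon> \<le> 1" "\<epsilon>' \<le> 1"
  shows "\<delta>1 \<noteq> \<delta>2"
proof
  assume eq: "\<delta>1 = \<delta>2"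
  have "norm (2 * gap n) \<le> norm (\<delta>1 + gap n) + norm (\<delta>2 - gap n)"
    using norm_triangle_ineq4[of "\<delta>1 + gap n" "\<delta>2 - gap n"] eq by (simp flip: mult_2)
  moreover have "norm (\<delta>1 + gap n) < \<epsilon> * norm (gap n)" "norm (\<delta>2 - gap n) < \<epsilon>' * norm (gap n)"
    using assms by (simp_all add: near_zero_def)
  moreover have "\<epsilon> * norm (gap n) \<le> 1 * norm (gap n)" "\<epsilon>' * norm (gap n) \<le> 1 * norm (gap n)"
    using assms by (intro mult_right_mono; simp)+
  ultimately show False by (simp add: norm_mult)
qed

text \<open>The total order of the zeros in the annulus is \<open>(2n + 1) - (2n - 1) = 2\<close>, and two different zeros are
  known.\<close>

lemma annulus_pair:
  assumes nz: "char_fun l0 \<noteq> 0" and n: "1 \<le> n"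
    and cnt: "finite (zeros_below n)" "(\<Sum>l\<in>zeros_below n. ord l) = 2 * n + 1"
      "(\<Sum>l\<in>zeros_below (n - 1). ord l) = 2 * (n - 1) + 1"
    and g: "norm (gap n) < 1 / 2"
    and z: "near_zero \<epsilon> n 1 \<delta>1" "near_zero \<epsilon> n 2 \<delta>2" "\<epsilon> \<le> 1"
  defines "l1 \<equiv> (of_real (2 * pi * real n) + \<delta>1)^2" and "l2 \<equiv> (of_real (2 * pi * real n) + \<delta>2)^2"
  shows "l1 \<noteq> l2" "ord l1 = 1" "ord l2 = 1"
    "\<And>l. circle_radius (n - 1) \<le> norm l \<Longrightarrow> norm l < circle_radius n \<Longrightarrow> char_fun l = 0 \<Longrightarrow> l = l1 \<or> l = l2"
proof -
  define A where "A = zeros_below n - zeros_below (n - 1)"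
  have sub: "zeros_below (n - 1) \<subseteq> zeros_below n"
    using circle_radius_mono[of "n - 1" n] by (auto simp: zeros_below_def)
  have finA: "finite A" using cnt(1) by (simp add: A_def)
  have "(\<Sum>l\<in>zeros_below n. ord l) = (\<Sum>l\<in>A. ord l) + (\<Sum>l\<in>zeros_below (n - 1). ord l)"
    unfolding A_def by (rule sum.subset_diff[OF sub cnt(1)])
  then have sumA: "(\<Sum>l\<in>A. ord l) = 2" using cnt n by simp
  have A_iff: "l \<in> A \<longleftrightarrow> circle_radius (n - 1) \<le> norm l \<and> norm l < circle_radius n \<and> char_fun l = 0" for l
    by (auto simp: A_def zeros_below_def)
  note small = near_zero_small(2)[OF z(1) z(3) g] near_zero_small(2)[OF z(2) z(3) g]
  have l12: "l1 \<in> A" "l2 \<in> A"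
    unfolding A_iff l1_def l2_def
    using square_in_annulus[OF n small(1)] square_in_annulus[OF n small(2)] z by (auto simp: near_zero_def)
  show ne: "l1 \<noteq> l2"
    using square_shift_inj[OF n small] near_zero_distinct[OF z(1,2) z(3) z(3)] by (auto simp: l1_def l2_def)
  have pos: "1 \<le> ord l" if "l \<in> A" for l using that ord_pos_iff[OF nz] by (auto simp: A_iff)
  have "(\<Sum>l\<in>A. ord l) = ord l1 + ord l2 + (\<Sum>l\<in>A - {l1, l2}. ord l)"
    using finA l12 ne by (subst sum.subset_diff[of "{l1, l2}"]) auto
  moreover have "1 \<le> ord l1" "1 \<le> ord l2" using pos l12 by auto
  ultimately have *: "ord l1 = 1" "ord l2 = 1" "(\<Sum>l\<in>A - {l1, l2}. ord l) = 0" using sumA by linarith+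
  show "ord l1 = 1" "ord l2 = 1" by fact+
  fix l assume "circle_radius (n - 1) \<le> norm l" "norm l < circle_radius n" "char_fun l = 0"
  then have "l \<in> A" by (simp add: A_iff)
  show "l = l1 \<or> l = l2"
  proof (rule ccontr)
    assume "\<not> ?thesis"
    then have "l \<in> A - {l1, l2}" using \<open>l \<in> A\<close> by simp
    then have "ord l = 0" using *(3) finA by (simp add: sum_eq_0_iff del: Diff_iff)
    then show False using pos[OF \<open>l \<in> A\<close>] by simp
  qed
qed

text \<open>The large eigenvalues are labelled by the signs of the approximate roots \<open>\<plusminus>gap n\<close>, the others in an
  arbitrary way. Every disc of relative radius \<open>\<epsilon>\<close> eventually contains a zero, and since each annulus has
  only two zeros, it is always the one that was labelled; this gives the factor \<open>1 + o(1)\<close>.\<close>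

theorem eigenvalue_asymptotics:
  assumes dom: "sine_coeff_dominates q (\<lambda>n. n)"
  shows "\<exists>lam. T1_eigenvalue_sequences q \<beta> lam \<and>
           (\<exists>N. \<forall>n>N. \<forall>j\<in>{1, 2}. T1_simple_eigenvalue q \<beta> (lam n j)) \<and>
           (\<forall>j\<in>{1, 2}. \<exists>\<epsilon> :: nat \<Rightarrow> complex. \<epsilon> \<longlonglongrightarrow> 0 \<and>
              (\<forall>\<^sub>F n in sequentially.
                 lam n j = of_real ((2 * pi * real n)\<^sup>2)
                   + (-1) ^ j * (csqrt (2 * gamma1 \<beta>) / 2)
                       * csqrt (of_nat n * sine_coeff q (2 * n)) * (1 + \<epsilon> n)))"
proof -
  have id: "filterlim (\<lambda>n :: nat. n) at_top sequentially" by (rule filterlim_ident)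
  note g = gap_asymptotics[OF dom id]
  obtain N0 where fin: "\<And>N. N0 \<le> N \<Longrightarrow> finite (zeros_below N)"
    and cnt: "\<And>N. N0 \<le> N \<Longrightarrow> (\<Sum>l\<in>zeros_below N. ord l) = 2 * N + 1"
    and nz: "\<exists>l. char_fun l \<noteq> 0" using zeros_below_count by blast
  obtain l0 where l0: "char_fun l0 \<noteq> 0" using nz by blast
  have near_ev: "\<forall>\<^sub>F n in sequentially. \<forall>j. \<exists>\<delta>. near_zero \<epsilon> n j \<delta>" if "0 < \<epsilon>" "\<epsilon> \<le> 1" for \<epsilon>
    using zeros_near[OF dom id that] by (simp add: near_zero_def)
  have small_ev: "\<forall>\<^sub>F n in sequentially. norm (gap n) < 1 / 2" using g(2) by (intro order_tendstoD(2)) auto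
  have "\<forall>\<^sub>F n in sequentially. N0 < n \<and> gap n \<noteq> 0 \<and> norm (gap n) < 1 / 2 \<and> (\<forall>j. \<exists>\<delta>. near_zero 1 n j \<delta>)"
    using near_ev[of 1] g(1) small_ev eventually_gt_at_top[of N0] by (simp add: eventually_conj)
  then obtain M where M: "\<And>n. M < n \<Longrightarrow> N0 < n \<and> gap n \<noteq> 0 \<and> norm (gap n) < 1 / 2 \<and> (\<forall>j. \<exists>\<delta>. near_zero 1 n j \<delta>)"
    unfolding eventually_sequentially by (metis less_imp_le)
  have MN0: "N0 \<le> M" using M[of "Suc M"] by simp
  define d where "d n j = (SOME \<delta>. near_zero 1 n j \<delta>)" for n j
  have d: "near_zero 1 n j (d n j)" if "M < n" for n j
    unfolding d_def using M[OF that] by (auto intro: someI_ex)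
  define mu where "mu n j = (complex_of_real (2 * pi * real n) + d n j)^2" for n j
  have d_small: "norm (d n j) < 2 * norm (gap n)" "norm (d n j) < 1" if "M < n" for n j
    using near_zero_small[OF d[OF that]] M[OF that] by auto
  have mu_ann: "circle_radius (n - 1) \<le> norm (mu n j)" "norm (mu n j) < circle_radius n" "char_fun (mu n j) = 0"
    if "M < n" for n j
    using square_in_annulus[OF _ d_small(2)[OF that]] d[OF that] that by (auto simp: mu_def near_zero_def)
  have pair: "mu n 1 \<noteq> mu n 2" "ord (mu n 1) = 1" "ord (mu n 2) = 1"
    "\<And>l. circle_radius (n - 1) \<le> norm l \<Longrightarrow> norm l < circle_radius n \<Longrightarrow> char_fun l = 0 \<Longrightarrow> l = mu n 1 \<or> l = mu n 2"
    if n: "M < n" for n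
  proof -
    have "1 \<le> n" "N0 \<le> n" "N0 \<le> n - 1" "norm (gap n) < 1 / 2" using M[OF n] n by auto
    note P = annulus_pair[OF l0 this(1) fin[OF this(2)] cnt[OF this(2)] cnt[OF this(3)] this(4) d[OF n] d[OF n] order.refl, folded mu_def]
    show "mu n 1 \<noteq> mu n 2" "ord (mu n 1) = 1" "ord (mu n 2) = 1"
      "\<And>l. circle_radius (n - 1) \<le> norm l \<Longrightarrow> norm l < circle_radius n \<Longrightarrow> char_fun l = 0 \<Longrightarrow> l = mu n 1 \<or> l = mu n 2"
      using P by blast+
  qed
  define I where "I = ({..M} \<times> {1 :: nat}) \<union> ({1..M} \<times> {2})"
  have I_iff: "(n, j) \<in> I \<longleftrightarrow> n \<le> M \<and> (j = 1 \<or> j = 2 \<and> n \<ge> 1)" for n j by (auto simp: I_def)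
  have "finite I" by (simp add: I_def)
  moreover have "card I = 2 * M + 1"
    unfolding I_def by (subst card_Un_disjoint) (auto simp: card_cartesian_product)
  ultimately obtain h where h: "h ` I \<subseteq> zeros_below M" "\<And>z. z \<in> zeros_below M \<Longrightarrow> card {i \<in> I. h i = z} = ord z"
    using exists_function_with_fibre_cards[of I "zeros_below M" ord] fin[OF MN0] cnt[OF MN0] by metis
  define lam where "lam n j = (if n \<le> M then h (n, j) else mu n j)" for n j
  have "T1_eigenvalue_sequences q \<beta> lam"
    unfolding T1_eigenvalue_sequences_def Let_def
  proof (intro conjI allI ballI)
    fix \<mu>
    define J where "J = {(n, j). (j = 1 \<or> j = 2 \<and> n \<ge> 1) \<and> lam n j = \<mu>}"
    have "finite J \<and> card J = ord \<mu>"
    proof (cases "norm \<mu> < circle_radius M")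
      case True
      have out: "lam n j \<noteq> \<mu>" if "M < n" for n j
      proof -
        have "M \<le> n - 1" using that by simp
        from circle_radius_mono[OF this] show ?thesis
          using mu_ann(1)[OF that, of j] True that by (auto simp: lam_def)
      qed
      have J: "J = {i \<in> I. h i = \<mu>}"
      proof (intro equalityI subsetI)
        fix x assume x: "x \<in> J"
        obtain n j where nj: "x = (n, j)" by (cases x)
        have "n \<le> M" using x out[of n j] by (force simp: J_def nj)
        then show "x \<in> {i \<in> I. h i = \<mu>}" using x by (simp add: J_def nj I_iff lam_def)
      next
        fix x assume "x \<in> {i \<in> I. h i = \<mu>}"
        then show "x \<in> J" unfolding J_def by (cases x) (auto simp: I_iff lam_def)
      qed
      show ?thesis
      proof (cases "char_fun \<mu> = 0")
        case z: True
        then show ?thesis using h(2)[of \<mu>] True \<open>finite I\<close> by (simp add: J zeros_below_def)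
      next
        case False
        then have "J = {}" using h(1) unfolding J by (auto simp: zeros_below_def)
        moreover have "ord \<mu> = 0" using ord_pos_iff[OF l0, of \<mu>] False by simp
        ultimately show ?thesis by simp
      qed
    next
      case False
      have inn: "M < n \<and> (j = 1 \<or> j = 2) \<and> mu n j = \<mu>" if "(n, j) \<in> J" for n j
      proof -
        have "\<not> n \<le> M"
        proof
          assume "n \<le> M"
          then have "(n, j) \<in> I" "h (n, j) = \<mu>" using that by (auto simp: J_def I_iff lam_def)
          then have "\<mu> \<in> zeros_below M" using h(1) by blast
          then show False using False by (simp add: zeros_below_def)
        qed
        then show ?thesis using that by (auto simp: J_def lam_def)
      qed
      show ?thesis
      proof (cases "char_fun \<mu> = 0")
        case True
        have "\<exists>n. norm \<mu> < circle_radius n"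
        proof -
          obtain n :: nat where "norm \<mu> < real n" using reals_Archimedean2 by blast
          also have "real n \<le> circle_radius n"
          proof -
            have "1 * (2 * real n + 1) \<le> pi * (2 * real n + 1)" using pi_gt3 by (intro mult_right_mono) auto
            then have "(1 * (2 * real n + 1))^2 \<le> circle_radius n" unfolding circle_radius_def by (intro power_mono) auto
            moreover have "real n \<le> (1 * (2 * real n + 1))^2" by (simp add: power2_eq_square algebra_simps)
            ultimately show ?thesis by linarith
          qed
          finally show ?thesis by blast
        qed
        then obtain n where n: "norm \<mu> < circle_radius n" "\<And>m. m < n \<Longrightarrow> \<not> norm \<mu> < circle_radius m"
          using exists_least_iff[of "\<lambda>n. norm \<mu> < circle_radius n"] by blast
        have "M < n" using n(1) False circle_radius_mono[of n M] by linarith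
        then have lo: "circle_radius (n - 1) \<le> norm \<mu>" using n(2)[of "n - 1"] by simp
        obtain j0 where j0: "j0 = 1 \<or> j0 = 2" "\<mu> = mu n j0"
          using pair(4)[OF \<open>M < n\<close> lo n(1) True] by blast
        have "J = {(n, j0)}"
        proof (intro equalityI subsetI)
          fix x assume x: "x \<in> J"
          obtain n' j where nj: "x = (n', j)" by (cases x)
          note i = inn[OF x[unfolded nj]]
          have "n' = n"
            using mu_ann(1,2)[of n' j] i lo n(1) by (intro annulus_disjoint[of n' "norm \<mu>" n]) auto
          then have "j = j0" using i j0 pair(1)[OF \<open>M < n\<close>] by auto
          then show "x \<in> {(n, j0)}" using nj \<open>n' = n\<close> by simp
        qed (use j0 \<open>M < n\<close> in \<open>auto simp: J_def lam_def\<close>)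
        moreover have "ord \<mu> = 1" using j0 pair(2,3)[OF \<open>M < n\<close>] by auto
        ultimately show ?thesis by simp
      next
        case f: False
        have "J = {}" using inn mu_ann(3) f by (metis ex_in_conv surj_pair)
        moreover have "ord \<mu> = 0" using ord_pos_iff[OF l0, of \<mu>] f by simp
        ultimately show ?thesis by simp
      qed
    qed
    then show "finite {(n, j). (j = 1 \<or> j = 2 \<and> n \<ge> 1) \<and> lam n j = \<mu>}"
      "T1_alg_multiplicity q \<beta> \<mu> (card {(n, j). (j = 1 \<or> j = 2 \<and> n \<ge> 1) \<and> lam n j = \<mu>})"
      using multiplicity_ord[OF l0, of \<mu>] unfolding J_def by metis+
  next
    fix j :: nat assume "j \<in> {1, 2}"
    define A where "A = norm ((1 + \<beta>) / (\<beta> - 1)) / (2 * pi)"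
    have gA: "norm (gap n) \<le> sqrt (A * Q) / sqrt (real n)" for n
    proof -
      have "(norm (gap n))^2 = norm (gap_square n)" unfolding gap_power2[symmetric] norm_power ..
      also have "\<dots> = A * norm (sine_coeff q (2 * n)) / real n"
        unfolding gap_square_def A_def by (simp only: norm_mult norm_divide norm_of_real) (simp add: mult_ac)
      also have "\<dots> \<le> A * Q / real n"
        using sine_coeff_le by (intro divide_right_mono mult_left_mono) (auto simp: A_def)
      finally show ?thesis by (simp add: real_le_rsqrt flip: real_sqrt_divide)
    qed
    show "(\<lambda>n. cmod (lam n j - of_real ((2 * pi * real n)\<^sup>2))) \<in> O(\<lambda>n. sqrt (real n))"
    proof (rule bigoI[where c = "2 * (4 * pi + 1) * sqrt (A * Q)"])
      show "\<forall>\<^sub>F n in sequentially. norm (cmod (lam n j - of_real ((2 * pi * real n)\<^sup>2)))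
          \<le> 2 * (4 * pi + 1) * sqrt (A * Q) * norm (sqrt (real n))"
        using eventually_gt_at_top[of M]
      proof eventually_elim
        case (elim n)
        have n1: "1 \<le> real n" using elim by simp
        have "lam n j - of_real ((2 * pi * real n)\<^sup>2) = d n j * (of_real (4 * pi * real n) + d n j)"
          using elim by (simp add: lam_def mu_def power2_eq_square algebra_simps)
        then have "norm (lam n j - of_real ((2 * pi * real n)\<^sup>2)) = norm (d n j) * norm (of_real (4 * pi * real n) + d n j)"
          by (simp only: norm_mult)
        also have "\<dots> \<le> (2 * norm (gap n)) * ((4 * pi + 1) * real n)"
        proof (intro mult_mono)
          show "norm (d n j) \<le> 2 * norm (gap n)" using d_small(1)[OF elim, of j] by simp
          have "norm (of_real (4 * pi * real n) + d n j) \<le> norm (complex_of_real (4 * pi * real n)) + norm (d n j)"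
            by (rule norm_triangle_ineq)
          also have "norm (complex_of_real (4 * pi * real n)) = 4 * pi * real n" unfolding norm_of_real by simp
          also have "norm (d n j) \<le> real n" using d_small(2)[OF elim, of j] n1 by linarith
          finally show "norm (of_real (4 * pi * real n) + d n j) \<le> (4 * pi + 1) * real n" by (simp add: algebra_simps)
        qed auto
        also have "\<dots> \<le> (2 * (sqrt (A * Q) / sqrt (real n))) * ((4 * pi + 1) * real n)"
          using gA[of n] by (intro mult_right_mono mult_left_mono) auto
        also have "\<dots> = 2 * (4 * pi + 1) * sqrt (A * Q) * (real n / sqrt (real n))" by simp
        also have "real n / sqrt (real n) = sqrt (real n)" by (rule real_div_sqrt) simp
        finally show ?case by simp
      qed
    qed
  qed
  moreover have "\<forall>n>M. \<forall>j\<in>{1, 2}. T1_simple_eigenvalue q \<beta> (lam n j)"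
  proof (intro allI impI ballI)
    fix n j :: nat assume "M < n" "j \<in> {1, 2}"
    then have "ord (lam n j) = 1" using pair(2,3)[OF \<open>M < n\<close>] by (auto simp: lam_def)
    then show "T1_simple_eigenvalue q \<beta> (lam n j)"
      using multiplicity_ord[OF l0, of "lam n j"] by (simp add: T1_simple_eigenvalue_def)
  qed
  moreover have "\<exists>\<epsilon> :: nat \<Rightarrow> complex. \<epsilon> \<longlonglongrightarrow> 0 \<and>
              (\<forall>\<^sub>F n in sequentially.
                 lam n j = of_real ((2 * pi * real n)\<^sup>2)
                   + (-1) ^ j * (csqrt (2 * gamma1 \<beta>) / 2)
                       * csqrt (of_nat n * sine_coeff q (2 * n)) * (1 + \<epsilon> n))" if j: "j \<in> {1, 2}" for j
  proof -
    define sg where "sg = ((-1) ^ j :: complex)"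
    have sg: "sg \<noteq> 0" "norm sg = 1" by (simp_all add: sg_def norm_power)
    define e1 where "e1 n = (d n j - sg * gap n) / (sg * gap n)" for n
    define e2 where "e2 n = (d n j)^2 / (sg * of_real (4 * pi * real n) * gap n)" for n
    have "e1 \<longlonglongrightarrow> 0"
    proof (rule tendstoI)
      fix e :: real assume e: "0 < e"
      define \<epsilon> where "\<epsilon> = min e 1"
      have \<epsilon>: "0 < \<epsilon>" "\<epsilon> \<le> 1" "\<epsilon> \<le> e" using e by (auto simp: \<epsilon>_def)
      show "\<forall>\<^sub>F n in sequentially. dist (e1 n) 0 < e"
        using near_ev[OF \<epsilon>(1,2)] eventually_gt_at_top[of M]
      proof eventually_elim
        case (elim n)
        then obtain \<delta> where \<delta>: "near_zero \<epsilon> n j \<delta>" by blast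
        note n = \<open>M < n\<close>
        have n1: "1 \<le> n" using n by simp
        have \<delta>1: "norm \<delta> < 1" using near_zero_small(2)[OF \<delta> \<epsilon>(2)] M[OF n] by blast
        define l where "l = (complex_of_real (2 * pi * real n) + \<delta>)^2"
        have "l = mu n 1 \<or> l = mu n 2"
          using square_in_annulus[OF n1 \<delta>1] \<delta> by (intro pair(4)[OF n]) (auto simp: l_def near_zero_def)
        then have "\<delta> = d n 1 \<or> \<delta> = d n 2"
          unfolding l_def mu_def using square_shift_inj[OF n1 \<delta>1 d_small(2)[OF n]] by blast
        moreover have "\<delta> \<noteq> d n 2" if "j = 1" using near_zero_distinct[OF _ d[OF n] \<epsilon>(2) order.refl] \<delta> that by simp
        moreover have "\<delta> \<noteq> d n 1" if "j = 2" using near_zero_distinct[OF d[OF n] _ order.refl \<epsilon>(2)] \<delta> that by metis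
        ultimately have "\<delta> = d n j" using j by auto
        then have "norm (d n j - sg * gap n) < \<epsilon> * norm (gap n)" using \<delta> by (simp add: near_zero_def sg_def)
        also have "\<dots> \<le> e * norm (gap n)" using \<epsilon> by (intro mult_right_mono) auto
        finally show ?case using M[OF n] by (simp add: e1_def norm_divide norm_mult sg divide_less_eq)
      qed
    qed
    moreover have "e2 \<longlonglongrightarrow> 0"
    proof (rule Lim_null_comparison[OF _ g(2)])
      show "\<forall>\<^sub>F n in sequentially. norm (e2 n) \<le> norm (gap n)"
        using eventually_gt_at_top[of M]
      proof eventually_elim
        case (elim n)
        have n1: "1 \<le> real n" using elim by simp
        have g0: "0 < norm (gap n)" using M[OF elim] by simp
        have "norm (e2 n) = norm (d n j) ^ 2 / (4 * pi * real n * norm (gap n))"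
          unfolding e2_def by (simp only: norm_divide norm_mult norm_power norm_of_real sg) (simp add: abs_mult)
        also have "\<dots> \<le> (2 * norm (gap n)) ^ 2 / (4 * 1 * 1 * norm (gap n))"
          using d_small(1)[OF elim, of j] g0 n1 pi_gt3 by (intro frac_le power_mono mult_mono) auto
        also have "\<dots> = norm (gap n)" using g0 by (simp add: power2_eq_square)
        finally show ?case .
      qed
    qed
    ultimately have "(\<lambda>n. e1 n + e2 n) \<longlonglongrightarrow> 0 + 0" by (rule tendsto_add)
    moreover have "\<forall>\<^sub>F n in sequentially.
                 lam n j = of_real ((2 * pi * real n)\<^sup>2)
                   + (-1) ^ j * (csqrt (2 * gamma1 \<beta>) / 2)
                       * csqrt (of_nat n * sine_coeff q (2 * n)) * (1 + (e1 n + e2 n))"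
      using eventually_gt_at_top[of M]
    proof eventually_elim
      case (elim n)
      define W where "W = complex_of_real (4 * pi * real n)"
      have W: "W \<noteq> 0" using elim by (simp add: W_def)
      have g0: "gap n \<noteq> 0" using M[OF elim] by simp
      have "csqrt (2 * gamma1 \<beta>) / 2 * csqrt (of_nat n * sine_coeff q (2 * n)) = W * gap n"
        using W unfolding gap_def W_def[symmetric] by simp
      then have "(-1) ^ j * (csqrt (2 * gamma1 \<beta>) / 2) * csqrt (of_nat n * sine_coeff q (2 * n)) * (1 + (e1 n + e2 n))
          = sg * (W * gap n) * (1 + (e1 n + e2 n))"
        by (simp add: sg_def mult.assoc)
      also have "\<dots> = W * d n j + (d n j)^2"
        unfolding e1_def e2_def W_def[symmetric] using sg W g0 by (simp add: field_simps)
      also have "\<dots> = lam n j - of_real ((2 * pi * real n)\<^sup>2)"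
        using elim by (simp add: lam_def mu_def W_def power2_eq_square algebra_simps)
      finally have E: "(-1) ^ j * (csqrt (2 * gamma1 \<beta>) / 2) * csqrt (of_nat n * sine_coeff q (2 * n)) * (1 + (e1 n + e2 n))
          = lam n j - of_real ((2 * pi * real n)\<^sup>2)" .
      show ?case unfolding E by simp
    qed
    ultimately show ?thesis by (intro exI[of _ "\<lambda>n. e1 n + e2 n"]) simp
  qed
  ultimately show ?thesis by (intro exI[of _ lam] conjI exI[of _ M]) auto
qed

section \<open>Eigenfunctions for neighbouring eigenvalues\<close>

text \<open>For \<open>y = a c + b s\<close> the condition on the derivatives reads \<open>b (1 + \<beta> s'(1)) = -\<beta> a c'(1)\<close>. Near \<open>(2\<pi>n)\<^sup>2\<close> the
  factor \<open>1 + \<beta> s'(1)\<close> is close to \<open>1 + \<beta> \<noteq> 0\<close> and \<open>c'(1) = O(|w| |\<delta>| + 1)\<close>, while \<open>s = O(1/|w|)\<close>. So the sine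
  part is \<open>a\<close> times a small quantity, and \<open>c\<close> is close to \<open>cos 2\<pi>nx\<close>.\<close>

lemma eigenfunction_near:
  obtains K r n0 where "0 < K" "0 < r"
    "\<And>n \<delta> y. n0 \<le> n \<Longrightarrow> norm \<delta> \<le> r \<Longrightarrow> y \<in> T1_ker q \<beta> ((of_real (2 * pi * real n) + \<delta>)^2) 1 \<Longrightarrow>
       \<exists>a. \<forall>x\<in>{0..1}. norm (y x - a * of_real (cos (2 * pi * real n * x))) \<le> norm a * (K * (norm \<delta> + 1 / real n))"
proof -
  define L where "L = norm (1 + \<beta>)"
  have L: "0 < L" using \<beta>_ne by (simp add: L_def add_eq_0_iff)
  define K where "K = 12 * norm \<beta> / L * (3 + 6 * Q) + 6 * Q + 3"
  have K: "0 < K" using L Q_nonneg by (auto simp: K_def intro!: add_nonneg_pos)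
  \<comment> \<open>Chosen such that \<open>|\<beta> (s'(1) - 1)| \<le> |1 + \<beta>| / 2\<close>, half of it from \<open>\<delta>\<close> and half from \<open>1/n\<close>.\<close>
  define r where "r = min 1 (L / (4 * (1 + norm \<beta>) * 2))"
  have r: "0 < r" "r \<le> 1" "norm \<beta> * (2 * r) \<le> L / 4"
  proof -
    have p: "0 < 1 + norm \<beta>" by (rule add_pos_nonneg) auto
    show "0 < r" "r \<le> 1" using L p by (auto simp: r_def)
    have "norm \<beta> * (2 * r) \<le> (1 + norm \<beta>) * (2 * (L / (4 * (1 + norm \<beta>) * 2)))"
      using L p by (intro mult_mono) (auto simp: r_def)
    also have "\<dots> = L / 4" using p by (simp add: field_simps)
    finally show "norm \<beta> * (2 * r) \<le> L / 4" .
  qed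
  define n0 where "n0 = nat \<lceil>Q + 24 * norm \<beta> * Q / L\<rceil> + 1"
  have main: "\<exists>a. \<forall>x\<in>{0..1}. norm (y x - a * of_real (cos (2 * pi * real n * x))) \<le> norm a * (K * (norm \<delta> + 1 / real n))"
    if n: "n0 \<le> n" and \<delta>: "norm \<delta> \<le> r" and y: "y \<in> T1_ker q \<beta> ((of_real (2 * pi * real n) + \<delta>)^2) 1" for n \<delta> y
  proof -
    define W where "W = complex_of_real (2 * pi * real n)"
    define w where "w = W + \<delta>"
    have "Q + 24 * norm \<beta> * Q / L \<le> real n" "1 \<le> real n" using n unfolding n0_def by linarith+
    moreover have "0 \<le> 24 * norm \<beta> * Q / L" using L Q_nonneg by simp
    ultimately have n1: "1 \<le> real n" and nQ: "Q \<le> real n" and nL: "24 * norm \<beta> * Q / L \<le> real n" using Q_nonneg by linarith+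
    have \<delta>1: "norm \<delta> \<le> 1" using \<delta> r by linarith
    note w3 = frequency_near(2)[OF \<delta>1 n1, folded W_def w_def]
    note E = frequency_near(3)[OF \<delta>1 n1, folded W_def w_def]
    have w0: "w \<noteq> 0" using w3 n1 by auto
    have wQ: "2 * Q \<le> norm w" using w3 nQ n1 by linarith
    have Ex: "exp (\<bar>Im w\<bar> * x) \<le> 3" if "x \<in> {0..1}" for x
    proof -
      have "\<bar>Im w\<bar> * x \<le> \<bar>Im w\<bar> * 1" using that by (intro mult_left_mono) auto
      then have "exp (\<bar>Im w\<bar> * x) \<le> exp \<bar>Im w\<bar>" by simp
      then show ?thesis using E by linarith
    qed
    define C where "C = Y 1 0 (w^2) 0" define S where "S = Y 0 1 (w^2) 0"
    define C1 where "C1 = Y' 1 0 (w^2) 0 1" define S1 where "S1 = Y' 0 1 (w^2) 0 1"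
    note cont = Y_continuous[of 1 0 "w^2" 0, folded C_def] Y_continuous[of 0 1 "w^2" 0, folded S_def]
    have trig: "cos W = 1" "sin W = 0"
      unfolding W_def cos_of_real sin_of_real using cos_2npi[of n] sin_2npi[of n]
      by (simp_all add: mult.commute mult.left_commute)
    have cw: "cos w = cos \<delta>" "sin w = sin \<delta>" by (simp_all add: w_def cos_add sin_add trig)
    have sin\<delta>: "norm (sin \<delta>) \<le> 3 * norm \<delta>" using sin_cos_lipschitz(1)[OF \<delta>1, of 0] by simp
    have C1: "norm C1 \<le> norm w * (3 * norm \<delta>) + 6 * Q"
    proof -
      have "C1 = - (w * sin w) + integral {0..1} (\<lambda>t. q t * (C t * cos (w * of_real (1 - t))))"
        using sine_kernel(2)[OF Y_base(1)[of 1 0 "w^2"], of 1] by (simp add: C_def C1_def Y_base)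
      moreover have "norm (integral {0..1} (\<lambda>t. q t * (C t * cos (w * of_real (1 - t))))) \<le> 6 * Q"
      proof (rule q_integral_le)
        fix t :: real assume t: "t \<in> {0..1}"
        have "norm (C t * cos (w * of_real (1 - t))) \<le> (2 * exp (\<bar>Im w\<bar> * t)) * exp (\<bar>Im w\<bar> * (1 - t))"
          unfolding norm_mult C_def
          using t cosine_solution_bound(1)[OF wQ w0 t] norm_sin_cos_scaled_le(2)[of "1 - t" w]
          by (intro mult_mono) auto
        also have "\<dots> = 2 * exp \<bar>Im w\<bar>" by (simp add: algebra_simps flip: exp_add)
        finally show "norm (C t * cos (w * of_real (1 - t))) \<le> 6" using E by linarith
      qed (auto intro!: continuous_intros cont)
      moreover have "norm (- (w * sin w)) \<le> norm w * (3 * norm \<delta>)"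
        unfolding norm_minus_cancel norm_mult cw using sin\<delta> by (intro mult_left_mono) auto
      ultimately show ?thesis using norm_triangle_mono by metis
    qed
    have S1: "norm (S1 - 1) \<le> 2 * norm \<delta> + 6 * Q / norm w"
    proof -
      have eq: "S1 = cos w + integral {0..1} (\<lambda>t. q t * (S t * cos (w * of_real (1 - t))))"
        using sine_kernel(2)[OF Y_base(1)[of 0 1 "w^2"], of 1] by (simp add: S_def S1_def Y_base)
      have 1: "norm (integral {0..1} (\<lambda>t. q t * (S t * cos (w * of_real (1 - t))))) \<le> (6 / norm w) * Q"
      proof (rule q_integral_le)
        fix t :: real assume t: "t \<in> {0..1}"
        have "norm (S t * cos (w * of_real (1 - t))) \<le> (2 / norm w * exp (\<bar>Im w\<bar> * t)) * exp (\<bar>Im w\<bar> * (1 - t))"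
          unfolding norm_mult S_def
          using t sine_solution_bound(1)[OF wQ w0 t] norm_sin_cos_scaled_le(2)[of "1 - t" w]
          by (intro mult_mono) auto
        also have "\<dots> = 2 / norm w * exp \<bar>Im w\<bar>" by (simp add: algebra_simps flip: exp_add)
        also have "\<dots> \<le> 2 / norm w * 3" using E by (intro mult_left_mono) auto
        finally show "norm (S t * cos (w * of_real (1 - t))) \<le> 6 / norm w" by simp
      qed (auto intro!: continuous_intros cont)
      have "norm (1 - cos \<delta>) \<le> norm (1 - cos \<delta> - \<delta>^2 / 2) + norm (\<delta>^2 / 2)"
        using norm_triangle_ineq[of "1 - cos \<delta> - \<delta>^2 / 2" "\<delta>^2 / 2"] by simp
      also have "\<dots> \<le> norm \<delta> ^ 4 + norm \<delta> ^ 2 / 2"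
        using cos_quadratic[OF \<delta>1] by (simp add: norm_divide norm_power)
      also have "\<dots> \<le> norm \<delta> ^ 1 + norm \<delta> ^ 1"
      proof (rule add_mono)
        show "norm \<delta> ^ 4 \<le> norm \<delta> ^ 1" using \<delta>1 by (intro power_decreasing) auto
        have "norm \<delta> ^ 2 \<le> norm \<delta> ^ 1" using \<delta>1 by (intro power_decreasing) auto
        then show "norm \<delta> ^ 2 / 2 \<le> norm \<delta> ^ 1" using zero_le_power2[of "norm \<delta>"] by linarith
      qed
      finally have 2: "norm (cos \<delta> - 1) \<le> 2 * norm \<delta>" by (simp add: norm_minus_commute)
      have E1: "S1 - 1 = (cos \<delta> - 1) + integral {0..1} (\<lambda>t. q t * (S t * cos (w * of_real (1 - t))))" using eq cw by simp
      show ?thesis unfolding E1 using norm_triangle_mono[OF 2 1] by simp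
    qed
    have den: "L / 2 \<le> norm (1 + \<beta> * S1)"
    proof -
      have "6 * Q / norm w \<le> 6 * Q / real n" using w3 n1 Q_nonneg by (intro divide_left_mono mult_pos_pos) auto
      then have "norm (S1 - 1) \<le> 2 * r + 6 * Q / real n" using S1 \<delta> by linarith
      then have "norm (\<beta> * (S1 - 1)) \<le> norm \<beta> * (2 * r + 6 * Q / real n)"
        unfolding norm_mult by (intro mult_left_mono) auto
      also have "\<dots> = norm \<beta> * (2 * r) + norm \<beta> * (6 * Q / real n)" by (simp add: distrib_left)
      also have "norm \<beta> * (6 * Q / real n) \<le> L / 4" using nL n1 L by (simp add: field_simps)
      finally have "norm (\<beta> * (S1 - 1)) \<le> L / 2" using r(3) by linarith
      moreover have "1 + \<beta> = (1 + \<beta> * S1) - \<beta> * (S1 - 1)" by (simp add: algebra_simps)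
      then have "L \<le> norm (1 + \<beta> * S1) + norm (\<beta> * (S1 - 1))" unfolding L_def by (metis norm_triangle_ineq4)
      ultimately show ?thesis by linarith
    qed
    have "T1_graph q \<beta> y (cfun_scale (w^2) y + 0)" using y by (auto simp: w_def W_def)
    then obtain y1 where "second_deriv y y1 (\<lambda>t. (q t - w^2) * y t - 0 t)" and bc: "bc2 y1 = 0"
      using T1_graph_iff[of 0 y "w^2"] by (auto simp: zero_fun_def)
    then have sd: "second_deriv y y1 (\<lambda>t. (q t - w^2) * y t)" by simp
    define a where "a = y 0" define b where "b = y1 0"
    have yx: "y x = a * C x + b * S x" if "x \<in> {0..1}" for x
      using ivp_homogeneous(1)[OF sd that] by (simp add: a_def b_def C_def S_def)
    have "y1 1 = a * C1 + b * S1" using ivp_homogeneous(2)[OF sd, of 1] by (simp add: a_def b_def C1_def S1_def)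
    then have "b * (1 + \<beta> * S1) = - \<beta> * a * C1" using bc by (simp add: bc2_def b_def algebra_simps add_eq_0_iff2)
    then have "norm b * norm (1 + \<beta> * S1) = norm \<beta> * norm a * norm C1"
      by (metis norm_mult norm_minus_cancel)
    then have "norm b * (L / 2) \<le> norm \<beta> * norm a * norm C1" using den mult_left_mono[OF den, of "norm b"] by simp
    also have "\<dots> \<le> norm \<beta> * norm a * (norm w * (3 * norm \<delta>) + 6 * Q)" using C1 by (intro mult_left_mono) auto
    finally have b: "norm b \<le> 2 * norm \<beta> / L * norm a * (norm w * (3 * norm \<delta>) + 6 * Q)"
      using L by (simp add: field_simps)
    have iw: "1 / norm w \<le> 1 / real n" using w3 n1 by (intro divide_left_mono mult_pos_pos) auto
    have "norm (y x - a * of_real (cos (2 * pi * real n * x))) \<le> norm a * (K * (norm \<delta> + 1 / real n))" if x: "x \<in> {0..1}" for x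
    proof -
      have "norm (b * S x) \<le> (2 * norm \<beta> / L * norm a * (norm w * (3 * norm \<delta>) + 6 * Q)) * (6 / norm w)"
      proof -
        have "norm (S x) \<le> 2 / norm w * exp (\<bar>Im w\<bar> * x)" unfolding S_def by (rule sine_solution_bound(1)[OF wQ w0 x])
        also have "\<dots> \<le> 2 / norm w * 3" using Ex[OF x] by (intro mult_left_mono) auto
        finally have "norm (S x) \<le> 6 / norm w" by simp
        then show ?thesis unfolding norm_mult using L Q_nonneg by (intro mult_mono b) auto
      qed
      also have "\<dots> = norm a * (12 * norm \<beta> / L) * (3 * norm \<delta> + 6 * Q * (1 / norm w))"
        using w0 L by (simp add: field_simps)
      also have "\<dots> \<le> norm a * (12 * norm \<beta> / L) * ((3 + 6 * Q) * (norm \<delta> + 1 / real n))"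
      proof (rule mult_left_mono)
        have "6 * Q * (1 / norm w) \<le> 6 * Q * (1 / real n)" using iw Q_nonneg by (intro mult_left_mono) auto
        moreover have "0 \<le> 6 * Q * norm \<delta>" "0 \<le> 3 * (1 / real n)" using Q_nonneg by simp_all
        moreover have "(3 + 6 * Q) * (norm \<delta> + 1 / real n)
            = 3 * norm \<delta> + 6 * Q * norm \<delta> + (3 * (1 / real n) + 6 * Q * (1 / real n))"
          by (simp only: distrib_left distrib_right)
        ultimately show "3 * norm \<delta> + 6 * Q * (1 / norm w) \<le> (3 + 6 * Q) * (norm \<delta> + 1 / real n)"
          by linarith
      qed (use L in simp)
      finally have 1: "norm (b * S x) \<le> norm a * (12 * norm \<beta> / L * (3 + 6 * Q) * (norm \<delta> + 1 / real n))"
        by (simp add: mult_ac)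
      have "norm (C x - cos (w * of_real x)) \<le> 2 * Q / norm w * exp (\<bar>Im w\<bar> * x)"
        unfolding C_def by (rule cosine_solution_bound(2)[OF wQ w0 x])
      also have "\<dots> \<le> 2 * Q / norm w * 3" using Ex[OF x] Q_nonneg by (intro mult_left_mono) auto
      also have "\<dots> = 6 * Q * (1 / norm w)" by simp
      also have "\<dots> \<le> 6 * Q * (1 / real n)" using iw Q_nonneg by (intro mult_left_mono) auto
      finally have 2: "norm (C x - cos (w * of_real x)) \<le> 6 * Q * (1 / real n)" .
      have dx: "norm (\<delta> * of_real x) \<le> norm \<delta>"
        unfolding norm_mult norm_of_real using x mult_left_mono[of "\<bar>x\<bar>" 1 "norm \<delta>"] by simp
      have wx: "w * of_real x = of_real (2 * pi * real n * x) + \<delta> * of_real x"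
        by (simp add: w_def W_def algebra_simps)
      have "norm (cos (w * of_real x) - cos (complex_of_real (2 * pi * real n * x))) \<le> 3 * norm (\<delta> * of_real x)"
        unfolding wx by (rule sin_cos_lipschitz(2)) (use dx \<delta>1 in linarith)
      then have 3: "norm (cos (w * of_real x) - of_real (cos (2 * pi * real n * x))) \<le> 3 * norm \<delta>"
        using dx unfolding cos_of_real by linarith
      have "y x - a * of_real (cos (2 * pi * real n * x))
          = a * ((C x - cos (w * of_real x)) + (cos (w * of_real x) - of_real (cos (2 * pi * real n * x)))) + b * S x"
        unfolding yx[OF x] by (simp add: algebra_simps)
      also have "norm \<dots> \<le> norm a * (6 * Q * (1 / real n) + 3 * norm \<delta>) + norm a * (12 * norm \<beta> / L * (3 + 6 * Q) * (norm \<delta> + 1 / real n))"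
        by (intro norm_triangle_mono 1) (unfold norm_mult, intro mult_left_mono norm_triangle_mono 2 3, simp)
      also have "\<dots> \<le> norm a * ((6 * Q + 3) * (norm \<delta> + 1 / real n)) + norm a * (12 * norm \<beta> / L * (3 + 6 * Q) * (norm \<delta> + 1 / real n))"
      proof (intro add_right_mono mult_left_mono)
        have "0 \<le> 6 * Q * norm \<delta>" "0 \<le> 3 * (1 / real n)" using Q_nonneg by simp_all
        moreover have "(6 * Q + 3) * (norm \<delta> + 1 / real n)
            = 6 * Q * norm \<delta> + 3 * norm \<delta> + (6 * Q * (1 / real n) + 3 * (1 / real n))"
          by (simp only: distrib_left distrib_right)
        ultimately show "6 * Q * (1 / real n) + 3 * norm \<delta> \<le> (6 * Q + 3) * (norm \<delta> + 1 / real n)" by linarith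
      qed simp
      also have "\<dots> = norm a * (K * (norm \<delta> + 1 / real n))" by (simp add: K_def algebra_simps)
      finally show ?thesis .
    qed
    then show ?thesis by blast
  qed
  show ?thesis by (rule that[OF K r(1) main])
qed

lemma eigenfunction_two_eigenvalues:
  assumes y: "y \<in> T1_ker q \<beta> l1 1" "y \<in> T1_ker q \<beta> l2 1" and ne: "l1 \<noteq> l2"
  shows "y = 0"
proof
  fix x
  have gr: "T1_graph q \<beta> y (cfun_scale l1 y + 0)" "T1_graph q \<beta> y (cfun_scale l2 y + 0)" using y by auto
  have c0: "continuous_on {0..1} (0 :: real \<Rightarrow> complex)" by (simp add: zero_fun_def)
  obtain y1 y2 where sd: "second_deriv y y1 (\<lambda>t. (q t - l1) * y t - 0 t)" "second_deriv y y2 (\<lambda>t. (q t - l2) * y t - 0 t)"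
    and supp: "\<And>x. x \<notin> {0..1} \<Longrightarrow> y x = 0"
    using gr unfolding T1_graph_iff[OF c0] by blast
  have sd0: "second_deriv (\<lambda>x. 0) (\<lambda>t. y1 t + (-1) * y2 t) (\<lambda>t. (l2 - l1) * y t)"
    by (rule second_deriv_cong[OF second_deriv_add[OF sd(1) second_deriv_scale[OF sd(2), of "-1"]]])
       (simp_all add: algebra_simps)
  show "y x = 0 x"
  proof (cases "x \<in> {0..1}")
    case True
    have "(l2 - l1) * y x = 0"
    proof (rule continuous_integral_vanish[OF _ _ True])
      show "continuous_on {0..1} (\<lambda>t. (l2 - l1) * y t)"
        by (intro continuous_intros second_deriv_continuous(1)[OF sd(1)])
      show "integral {0..u} (\<lambda>t. (l2 - l1) * y t) = 0" if "u \<in> {0..1}" for u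
        by (rule second_deriv_vanish(2)[OF sd0 _ that]) simp
    qed
    then show ?thesis using ne by simp
  qed (simp add: supp)
qed

end

section \<open>Riesz bases\<close>

lemma L2_norm_cong:
  assumes "L2_eq f g"
  shows "L2_norm f = L2_norm g"
proof -
  obtain N where N: "negligible N" "\<And>x. x \<in> {0..1} - N \<Longrightarrow> f x = g x"
    using L2_eq_imp_negligible[OF assms] by blast
  have "integral {0..1} (\<lambda>x. (cmod (f x))\<^sup>2) = integral {0..1} (\<lambda>x. (cmod (g x))\<^sup>2)"
    by (rule integral_spike[OF N(1)]) (simp add: N(2))
  then show ?thesis by (simp add: L2_norm_def)
qed

lemma L2_eq_trans [trans]: "L2_eq f g \<Longrightarrow> L2_eq g h \<Longrightarrow> L2_eq f h"
  unfolding L2_eq_def by (auto elim: AE_mp)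

lemma L2_eq_sym: "L2_eq f g \<Longrightarrow> L2_eq g f"
  unfolding L2_eq_def by (simp add: eq_commute)

lemma L2_eq_lincomb:
  assumes "L2_eq f f'" "L2_eq g g'"
  shows "L2_eq (cfun_scale a f + cfun_scale b g) (cfun_scale a f' + cfun_scale b g')"
  using assms unfolding L2_eq_def by eventually_elim (simp add: cfun_scale_def)

lemma L2_integrable_square: "f \<in> L2 \<Longrightarrow> (\<lambda>x. (cmod (f x))\<^sup>2) integrable_on {0..1}"
  by (simp add: L2_def absolutely_integrable_on_def)

lemma L2_norm_power2: "(L2_norm f)\<^sup>2 = integral {0..1} (\<lambda>x. (cmod (f x))\<^sup>2)" if "f \<in> L2"
  unfolding L2_norm_def by (simp add: integral_nonneg L2_integrable_square[OF that])

lemma two_mult_norm_le: "2 * (norm (x :: complex) * norm (y :: complex)) \<le> (norm x)\<^sup>2 + (norm y)\<^sup>2"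
  using zero_le_power2[of "norm x - norm y"] by (simp add: power2_diff)

lemma L2_lincomb:
  assumes f: "f \<in> L2" and g: "g \<in> L2"
  shows "cfun_scale a f + cfun_scale b g \<in> L2"
proof -
  define h where "h x = a * f x + b * g x" for x
  have h: "h \<in> borel_measurable (lebesgue_on {0..1})"
    using f g unfolding L2_def h_def by (auto intro!: borel_measurable_add borel_measurable_times)
  have "(\<lambda>x. (cmod (h x))\<^sup>2) absolutely_integrable_on {0..1}"
  proof (rule measurable_bounded_by_integrable_imp_absolutely_integrable)
    show "(\<lambda>x. (cmod (h x))\<^sup>2) \<in> borel_measurable (lebesgue_on {0..1})"
      using h by measurable
    show "(\<lambda>x. 2 * (cmod a)\<^sup>2 * (cmod (f x))\<^sup>2 + 2 * (cmod b)\<^sup>2 * (cmod (g x))\<^sup>2) integrable_on {0..1}"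
      by (intro integrable_add integrable_on_mult_right L2_integrable_square f g)
    fix x
    have "cmod (h x) \<le> norm (a * f x) + norm (b * g x)" unfolding h_def by (rule norm_triangle_ineq)
    then have "(cmod (h x))\<^sup>2 \<le> (norm (a * f x) + norm (b * g x))\<^sup>2" by (intro power_mono) auto
    also have "\<dots> \<le> 2 * (norm (a * f x))\<^sup>2 + 2 * (norm (b * g x))\<^sup>2"
      using two_mult_norm_le[of "a * f x" "b * g x"] by (simp add: power2_sum)
    finally show "norm ((cmod (h x))\<^sup>2) \<le> 2 * (cmod a)\<^sup>2 * (cmod (f x))\<^sup>2 + 2 * (cmod b)\<^sup>2 * (cmod (g x))\<^sup>2"
      by (simp add: norm_mult power_mult_distrib)
  qed auto
  moreover have "cfun_scale a f + cfun_scale b g = h" by (simp add: h_def fun_eq_iff cfun_scale_def)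
  ultimately show ?thesis using h by (simp add: L2_def)
qed

lemma L2_inner_integrable:
  assumes f: "f \<in> L2" and g: "g \<in> L2"
  shows "(\<lambda>x. f x * cnj (g x)) integrable_on {0..1}"
proof -
  have "(\<lambda>x. f x * cnj (g x)) absolutely_integrable_on {0..1}"
  proof (rule measurable_bounded_by_integrable_imp_absolutely_integrable)
    have "cnj \<in> borel_measurable borel" by (intro borel_measurable_continuous_onI continuous_intros)
    then have "(\<lambda>x. cnj (g x)) \<in> borel_measurable (lebesgue_on {0..1})"
      using g measurable_compose unfolding L2_def by blast
    then show "(\<lambda>x. f x * cnj (g x)) \<in> borel_measurable (lebesgue_on {0..1})"
      using f unfolding L2_def by (intro borel_measurable_times) auto
    show "(\<lambda>x. (cmod (f x))\<^sup>2 + (cmod (g x))\<^sup>2) integrable_on {0..1}"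
      by (intro integrable_add L2_integrable_square f g)
    fix x
    have "0 \<le> norm (f x) * norm (g x)" by simp
    then show "norm (f x * cnj (g x)) \<le> (cmod (f x))\<^sup>2 + (cmod (g x))\<^sup>2"
      using two_mult_norm_le[of "f x" "g x"] unfolding norm_mult complex_mod_cnj by linarith
  qed auto
  then show ?thesis by (simp add: absolutely_integrable_on_def)
qed

lemma L2_inner_self: "L2_inner f f = of_real ((L2_norm f)\<^sup>2)" if "f \<in> L2"
proof -
  have "L2_inner f f = integral {0..1} (\<lambda>x. complex_of_real ((cmod (f x))\<^sup>2))"
    unfolding L2_inner_def by (simp only: complex_norm_square)
  also have "\<dots> = of_real (integral {0..1} (\<lambda>x. (cmod (f x))\<^sup>2))"
    using has_integral_of_real[OF integrable_integral[OF L2_integrable_square[OF that]]]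
    by (rule integral_unique)
  finally show ?thesis by (simp add: L2_norm_power2[OF that])
qed

lemma orthonormal_lincomb_norm:
  assumes u: "u \<in> L2" "v \<in> L2"
    and o: "L2_inner u u = 1" "L2_inner v v = 1" "L2_inner u v = 0" "L2_inner v u = 0"
  shows "(L2_norm (cfun_scale a u + cfun_scale b v))\<^sup>2 = (cmod a)\<^sup>2 + (cmod b)\<^sup>2"
proof -
  define w where "w = cfun_scale a u + cfun_scale b v"
  have w: "w \<in> L2" unfolding w_def by (rule L2_lincomb[OF u])
  note I = L2_inner_integrable[OF u(1) u(1)] L2_inner_integrable[OF u(1) u(2)]
    L2_inner_integrable[OF u(2) u(1)] L2_inner_integrable[OF u(2) u(2)]
  have "L2_inner w w = integral {0..1} (\<lambda>x. (a * cnj a * (u x * cnj (u x)) + a * cnj b * (u x * cnj (v x)))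
      + (b * cnj a * (v x * cnj (u x)) + b * cnj b * (v x * cnj (v x))))"
    unfolding L2_inner_def w_def cfun_scale_def by (simp add: algebra_simps)
  also have "\<dots> = (integral {0..1} (\<lambda>x. a * cnj a * (u x * cnj (u x))) + integral {0..1} (\<lambda>x. a * cnj b * (u x * cnj (v x))))
      + (integral {0..1} (\<lambda>x. b * cnj a * (v x * cnj (u x))) + integral {0..1} (\<lambda>x. b * cnj b * (v x * cnj (v x))))"
    using I by (simp only: integral_add integrable_add integrable_on_mult_right)
  also have "\<dots> = (a * cnj a * L2_inner u u + a * cnj b * L2_inner u v) + (b * cnj a * L2_inner v u + b * cnj b * L2_inner v v)"
    unfolding L2_inner_def by (simp only: integral_mult_right)
  also have "\<dots> = of_real ((cmod a)\<^sup>2 + (cmod b)\<^sup>2)" unfolding o by (simp add: complex_norm_square del: of_real_power)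
  finally have "complex_of_real ((L2_norm w)\<^sup>2) = of_real ((cmod a)\<^sup>2 + (cmod b)\<^sup>2)" unfolding L2_inner_self[OF w] .
  then show ?thesis unfolding w_def of_real_eq_iff .
qed

lemma L2_norm_nonneg: "f \<in> L2 \<Longrightarrow> 0 \<le> L2_norm f"
  unfolding L2_norm_def by (simp add: integral_nonneg L2_integrable_square)

text \<open>Bounds for an orthonormal basis carried over by the operator and its inverse. The lower bound for
  combinations of two members is the quantitative form of their not being parallel.\<close>

lemma Riesz_basis_bounds:
  assumes "L2_Riesz_basis e"
  obtains K where "0 < K" "\<And>n. e n \<in> L2" "\<And>n. L2_norm (e n) \<le> K"
    "\<And>m n a b. m \<noteq> n \<Longrightarrow> (cmod a)\<^sup>2 + (cmod b)\<^sup>2 \<le> K\<^sup>2 * (L2_norm (cfun_scale a (e m) + cfun_scale b (e n)))\<^sup>2"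
proof -
  obtain u A B where u: "L2_orthonormal_basis u" and A: "L2_bounded_operator A" and B: "L2_bounded_operator B"
    and inv: "\<And>f. f \<in> L2 \<Longrightarrow> L2_eq (B (A f)) f" and e: "\<And>n. e n \<in> L2" "\<And>n. L2_eq (e n) (A (u n))"
    using assms unfolding L2_Riesz_basis_def by blast
  obtain CA where CA: "\<And>f. f \<in> L2 \<Longrightarrow> L2_norm (A f) \<le> CA * L2_norm f"
    using A unfolding L2_bounded_operator_def by blast
  obtain CB where CB: "\<And>f. f \<in> L2 \<Longrightarrow> L2_norm (B f) \<le> CB * L2_norm f"
    using B unfolding L2_bounded_operator_def by blast
  have Alin: "L2_eq (A (cfun_scale a f + cfun_scale b g)) (cfun_scale a (A f) + cfun_scale b (A g))"
    and AL2: "A f \<in> L2" if "f \<in> L2" "g \<in> L2" for a b f g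
    using A that unfolding L2_bounded_operator_def by blast+
  have uL: "u n \<in> L2" and o: "L2_inner (u m) (u n) = (if m = n then 1 else 0)" for m n
    using u unfolding L2_orthonormal_basis_def by blast+
  define K where "K = max 1 (max \<bar>CA\<bar> \<bar>CB\<bar>)"
  have K: "0 < K" "CA \<le> K" "CB \<le> K" by (auto simp: K_def)
  have un: "L2_norm (u n) = 1" for n
  proof -
    have "complex_of_real ((L2_norm (u n))\<^sup>2) = of_real 1" using L2_inner_self[OF uL[of n]] o[of n n] by simp
    then have "(L2_norm (u n))\<^sup>2 = 1" unfolding of_real_eq_iff .
    then show ?thesis using L2_norm_nonneg[OF uL[of n]] by (simp add: power2_eq_1_iff)
  qed
  show ?thesis
  proof (rule that[OF K(1) e(1)])
    fix n
    have "L2_norm (e n) \<le> CA * L2_norm (u n)" unfolding L2_norm_cong[OF e(2)] by (rule CA[OF uL])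
    then show "L2_norm (e n) \<le> K" using un K by simp
  next
    fix m n :: nat and a b assume mn: "m \<noteq> n"
    define w where "w = cfun_scale a (u m) + cfun_scale b (u n)"
    define v where "v = cfun_scale a (e m) + cfun_scale b (e n)"
    have w: "w \<in> L2" unfolding w_def by (rule L2_lincomb[OF uL uL])
    have v: "v \<in> L2" unfolding v_def by (rule L2_lincomb[OF e(1) e(1)])
    have "L2_eq (A w) v"
      unfolding w_def v_def
      by (rule L2_eq_trans[OF Alin[OF uL uL] L2_eq_lincomb[OF L2_eq_sym[OF e(2)] L2_eq_sym[OF e(2)]]])
    have "(cmod a)\<^sup>2 + (cmod b)\<^sup>2 = (L2_norm w)\<^sup>2"
      unfolding w_def using mn by (intro orthonormal_lincomb_norm[symmetric] uL) (auto simp: o)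
    moreover have "L2_norm w = L2_norm (B (A w))" by (rule L2_norm_cong[OF inv[OF w], symmetric])
    moreover have "L2_norm (B (A w)) \<le> CB * L2_norm v"
      using CB[OF AL2[OF w w]] L2_norm_cong[OF \<open>L2_eq (A w) v\<close>] by simp
    moreover have "CB * L2_norm v \<le> K * L2_norm v" using K L2_norm_nonneg[OF v] by (intro mult_right_mono)
    ultimately have "L2_norm w \<le> K * L2_norm v" by linarith
    then have "(L2_norm w)\<^sup>2 \<le> (K * L2_norm v)\<^sup>2" using L2_norm_nonneg[OF w] by (intro power_mono)
    then show "(cmod a)\<^sup>2 + (cmod b)\<^sup>2 \<le> K\<^sup>2 * (L2_norm (cfun_scale a (e m) + cfun_scale b (e n)))\<^sup>2"
      using \<open>(cmod a)\<^sup>2 + (cmod b)\<^sup>2 = (L2_norm w)\<^sup>2\<close> by (simp add: v_def power_mult_distrib)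
  qed
qed

lemma integral_cos_square:
  assumes "1 \<le> (n :: nat)"
  shows "((\<lambda>x. (cos (2 * pi * real n * x))\<^sup>2) has_integral (1 / 2)) {0..1}"
proof -
  define c where "c = 2 * pi * real n"
  have c: "c \<noteq> 0" using assms by (simp add: c_def)
  define F where "F x = x / 2 + sin (c * x) * cos (c * x) / (2 * c)" for x
  have "((\<lambda>x. (cos (c * x))\<^sup>2) has_integral (F 1 - F 0)) {0..1}"
  proof (rule fundamental_theorem_of_calculus)
    fix x :: real
    have "(F has_real_derivative (1 / 2 + (c * cos (c * x) * cos (c * x) - sin (c * x) * (c * sin (c * x))) / (2 * c))) (at x within {0..1})"
      unfolding F_def using c by (auto intro!: derivative_eq_intros simp: field_simps)
    moreover have "1 / 2 + (c * cos (c * x) * cos (c * x) - sin (c * x) * (c * sin (c * x))) / (2 * c) = (cos (c * x))\<^sup>2"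
      using c by (simp add: field_simps power2_eq_square[symmetric] sin_squared_eq)
    ultimately show "(F has_vector_derivative (cos (c * x))\<^sup>2) (at x within {0..1})"
      by (simp add: has_real_derivative_iff_has_vector_derivative)
  qed simp
  moreover have "F 1 - F 0 = 1 / 2"
    using sin_2npi[of n] by (simp add: F_def c_def mult.commute mult.left_commute)
  ultimately show ?thesis by (simp add: c_def)
qed

lemma L2_norm_le_bound:
  assumes "f \<in> L2" "\<And>x. x \<in> {0..1} \<Longrightarrow> norm (f x) \<le> B"
  shows "(L2_norm f)\<^sup>2 \<le> B\<^sup>2"
proof -
  have "(L2_norm f)\<^sup>2 \<le> integral {0..1} (\<lambda>x :: real. B\<^sup>2)"
    unfolding L2_norm_power2[OF assms(1)] using assms
    by (intro integral_le L2_integrable_square power_mono) auto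
  then show ?thesis by simp
qed

text \<open>Integrating \<open>|a cos|\<^sup>2 \<le> 2 |y|\<^sup>2 + 2 |a|\<^sup>2 \<eta>\<^sup>2\<close>, where the cosine has mean square \<open>1/2\<close>.\<close>

lemma near_cosine_amplitude:
  assumes y: "y \<in> L2" "L2_norm y \<le> K" and n: "1 \<le> n" and \<eta>: "0 \<le> \<eta>" "\<eta> \<le> 1 / 4"
    and near: "\<And>x. x \<in> {0..1} \<Longrightarrow> norm (y x - a * of_real (cos (2 * pi * real n * x))) \<le> norm a * \<eta>"
  shows "(norm a)\<^sup>2 \<le> 8 * K\<^sup>2"
proof -
  define c where "c x = cos (2 * pi * real n * x)" for x
  have "(norm a)\<^sup>2 * (c x)\<^sup>2 \<le> 2 * (norm (y x))\<^sup>2 + 2 * ((norm a)\<^sup>2 * \<eta>\<^sup>2)" if "x \<in> {0..1}" for x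
  proof -
    have "norm (a * of_real (c x)) \<le> norm (y x) + norm (y x - a * of_real (c x))"
      by (metis norm_minus_commute norm_triangle_sub)
    also have "\<dots> \<le> norm (y x) + norm a * \<eta>" using near[OF that] by (simp add: c_def)
    finally have "(norm (a * of_real (c x)))\<^sup>2 \<le> (norm (y x) + norm a * \<eta>)\<^sup>2" by (intro power_mono) auto
    also have "\<dots> \<le> 2 * (norm (y x))\<^sup>2 + 2 * (norm a * \<eta>)\<^sup>2"
      using zero_le_power2[of "norm (y x) - norm a * \<eta>"] by (simp add: power2_sum power2_diff)
    finally show ?thesis by (simp add: norm_mult power_mult_distrib)
  qed
  then have "integral {0..1} (\<lambda>x. (norm a)\<^sup>2 * (c x)\<^sup>2) \<le> integral {0..1} (\<lambda>x. 2 * (norm (y x))\<^sup>2 + 2 * ((norm a)\<^sup>2 * \<eta>\<^sup>2))"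
    using integral_cos_square[OF n] unfolding c_def
    by (intro integral_le integrable_add integrable_on_mult_right L2_integrable_square y) auto
  also have "integral {0..1} (\<lambda>x. 2 * (norm (y x))\<^sup>2 + 2 * ((norm a)\<^sup>2 * \<eta>\<^sup>2))
      = 2 * (L2_norm y)\<^sup>2 + 2 * ((norm a)\<^sup>2 * \<eta>\<^sup>2)"
    unfolding L2_norm_power2[OF y(1)] using L2_integrable_square[OF y(1)]
    by (subst integral_add) (auto intro!: integrable_on_mult_right)
  also have "integral {0..1} (\<lambda>x. (norm a)\<^sup>2 * (c x)\<^sup>2) = (norm a)\<^sup>2 * (1 / 2)"
    using integral_unique[OF integral_cos_square[OF n]] by (simp add: c_def)
  finally have "(norm a)\<^sup>2 * (1 / 2) \<le> 2 * (L2_norm y)\<^sup>2 + 2 * ((norm a)\<^sup>2 * \<eta>\<^sup>2)" .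
  moreover have "(L2_norm y)\<^sup>2 \<le> K\<^sup>2" using y L2_norm_nonneg by (intro power_mono) auto
  moreover have "(norm a)\<^sup>2 * \<eta>\<^sup>2 \<le> (norm a)\<^sup>2 * (1 / 4)\<^sup>2" using \<eta> by (intro mult_left_mono power_mono) auto
  moreover have "(norm a)\<^sup>2 * (1 / 4)\<^sup>2 = (norm a)\<^sup>2 / 16" by (simp add: power2_eq_square)
  ultimately show ?thesis using zero_le_power2[of K] by linarith
qed

context T1_mean_zero
begin

lemma root_function_exists:
  assumes nz: "char_fun l0 \<noteq> 0" and o: "ord l = 1" and e: "T1_root_functions q \<beta> e"
  obtains m where "e m \<in> T1_ker q \<beta> l 1" "e m \<noteq> 0"
proof -
  have root: "T1_root_space q \<beta> l = T1_ker q \<beta> l 1"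
    using T1_multiplicity_subdegree(2)[OF char_fps_nonzero[OF nz, of l]] o by (simp add: ord_def)
  define E where "E = range e \<inter> T1_root_space q \<beta> l"
  have E: "cfun.independent E" "cfun.span E = T1_root_space q \<beta> l"
    using e by (auto simp: T1_root_functions_def E_def)
  obtain B where B: "card B = 1" "cfun.independent B" "cfun.span B = T1_root_space q \<beta> l"
    using multiplicity_ord[OF nz, of l] o by (auto simp: T1_alg_multiplicity_def)
  obtain v where v: "B = {v}" using B(1) card_1_singletonE by blast
  have "v \<noteq> 0" using B(2) cfun.dependent_zero[of B] v by auto
  have "v \<in> cfun.span E" unfolding E(2) B(3)[symmetric] v by (rule cfun.span_base) simp
  have "E \<noteq> {}"
  proof
    assume "E = {}"
    then show False using \<open>v \<in> cfun.span E\<close> \<open>v \<noteq> 0\<close> by (simp add: cfun.span_empty)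
  qed
  then obtain m where m: "e m \<in> E" by (auto simp: E_def)
  moreover have "e m \<noteq> 0" using m E(1) cfun.dependent_zero by metis
  ultimately show ?thesis using that[of m] root by (auto simp: E_def)
qed

text \<open>For root functions \<open>e m1 \<approx> a1 cos\<close> and \<open>e m2 \<approx> a2 cos\<close> the combination \<open>a2 e m1 - a1 e m2\<close> is of size
  \<open>|a1 a2| \<eta>\<close>, whereas \<open>Riesz_basis_bounds\<close> makes it at least of size \<open>|a2|\<close>. As \<open>a1\<close> is bounded, this is
  impossible for small \<open>\<eta>\<close>.\<close>

theorem not_Riesz_basis:
  assumes dom: "sine_coeff_dominates q \<nu>" and \<nu>: "filterlim \<nu> at_top sequentially"
    and e: "T1_root_functions q \<beta> e"
  shows "\<not> L2_Riesz_basis e"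
proof
  assume "L2_Riesz_basis e"
  then obtain R where R: "0 < R" "\<And>n. e n \<in> L2" "\<And>n. L2_norm (e n) \<le> R"
    and Rb: "\<And>m n a b. m \<noteq> n \<Longrightarrow> (cmod a)\<^sup>2 + (cmod b)\<^sup>2 \<le> R\<^sup>2 * (L2_norm (cfun_scale a (e m) + cfun_scale b (e n)))\<^sup>2"
    using Riesz_basis_bounds by metis
  obtain K r n0 where K: "0 < K" "0 < r" and near: "\<And>n \<delta> y. n0 \<le> n \<Longrightarrow> norm \<delta> \<le> r \<Longrightarrow>
      y \<in> T1_ker q \<beta> ((of_real (2 * pi * real n) + \<delta>)^2) 1 \<Longrightarrow>
       \<exists>a. \<forall>x\<in>{0..1}. norm (y x - a * of_real (cos (2 * pi * real n * x))) \<le> norm a * (K * (norm \<delta> + 1 / real n))"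
    using eigenfunction_near by metis
  obtain N0 where fin: "\<And>N. N0 \<le> N \<Longrightarrow> finite (zeros_below N)"
    and cnt: "\<And>N. N0 \<le> N \<Longrightarrow> (\<Sum>l\<in>zeros_below N. ord l) = 2 * N + 1"
    and nz: "\<exists>l. char_fun l \<noteq> 0" using zeros_below_count by blast
  obtain l0 where l0: "char_fun l0 \<noteq> 0" using nz by blast
  note g = gap_asymptotics[OF dom \<nu>]
  \<comment> \<open>Small enough for \<open>near_cosine_amplitude\<close> and for the final contradiction.\<close>
  define \<eta>0 where "\<eta>0 = min (1 / 4) (1 / (8 * R\<^sup>2))"
  have \<eta>0: "0 < \<eta>0" "\<eta>0 \<le> 1 / 4" "\<eta>0 \<le> 1 / (8 * R\<^sup>2)" using R(1) by (auto simp: \<eta>0_def)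
  have "(\<lambda>k. 1 / real (\<nu> k)) \<longlonglongrightarrow> 0" using filterlim_compose[OF lim_inverse_n' \<nu>] by simp
  then have "(\<lambda>k. K * (2 * norm (gap (\<nu> k)) + 1 / real (\<nu> k))) \<longlonglongrightarrow> K * (2 * 0 + 0)"
    by (intro tendsto_intros g(2))
  then have "\<forall>\<^sub>F k in sequentially. K * (2 * norm (gap (\<nu> k)) + 1 / real (\<nu> k)) < \<eta>0"
    using \<eta>0 by (intro order_tendstoD(2)) auto
  moreover have "\<forall>\<^sub>F k in sequentially. norm (gap (\<nu> k)) < min (1 / 2) (r / 2)"
    using g(2) K by (intro order_tendstoD(2)) auto
  moreover have "\<forall>\<^sub>F k in sequentially. \<forall>j. \<exists>\<delta>. near_zero 1 (\<nu> k) j \<delta>"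
    using zeros_near[OF dom \<nu>, of 1] by (simp add: near_zero_def)
  moreover have "\<forall>\<^sub>F k in sequentially. N0 + n0 + 1 \<le> \<nu> k" using \<nu> unfolding filterlim_at_top by blast
  ultimately have "\<forall>\<^sub>F k in sequentially. K * (2 * norm (gap (\<nu> k)) + 1 / real (\<nu> k)) < \<eta>0 \<and>
      norm (gap (\<nu> k)) < min (1 / 2) (r / 2) \<and> (\<forall>j. \<exists>\<delta>. near_zero 1 (\<nu> k) j \<delta>) \<and> N0 + n0 + 1 \<le> \<nu> k"
    by (simp add: eventually_conj_iff)
  then obtain k where k: "K * (2 * norm (gap (\<nu> k)) + 1 / real (\<nu> k)) < \<eta>0"
    "norm (gap (\<nu> k)) < min (1 / 2) (r / 2)" "\<forall>j. \<exists>\<delta>. near_zero 1 (\<nu> k) j \<delta>" "N0 + n0 + 1 \<le> \<nu> k"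
    using eventually_happens'[OF sequentially_bot] by blast
  define n where "n = \<nu> k"
  have n: "1 \<le> n" "N0 \<le> n" "N0 \<le> n - 1" "n0 \<le> n" using k(4) by (auto simp: n_def)
  have gap: "norm (gap n) < 1 / 2" "norm (gap n) < r / 2" using k(2) by (auto simp: n_def)
  obtain \<delta>1 \<delta>2 where z: "near_zero 1 n 1 \<delta>1" "near_zero 1 n 2 \<delta>2" using k(3) unfolding n_def by blast
  note pair = annulus_pair[OF l0 n(1) fin[OF n(2)] cnt[OF n(2)] cnt[OF n(3)] gap(1) z order.refl]
  define l1 where "l1 = (complex_of_real (2 * pi * real n) + \<delta>1)^2"
  define l2 where "l2 = (complex_of_real (2 * pi * real n) + \<delta>2)^2"
  note pair = pair[folded l1_def l2_def]
  obtain m1 where m1: "e m1 \<in> T1_ker q \<beta> l1 1" "e m1 \<noteq> 0" using root_function_exists[OF l0 pair(2) e] by blast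
  obtain m2 where m2: "e m2 \<in> T1_ker q \<beta> l2 1" "e m2 \<noteq> 0" using root_function_exists[OF l0 pair(3) e] by blast
  have "m1 \<noteq> m2" using eigenfunction_two_eigenvalues[OF _ _ pair(1)] m1 m2 by metis
  have amp: "\<exists>a. \<forall>x\<in>{0..1}. norm (y x - a * of_real (cos (2 * pi * real n * x))) \<le> norm a * \<eta>0"
    if "near_zero 1 n j \<delta>" "y \<in> T1_ker q \<beta> ((complex_of_real (2 * pi * real n) + \<delta>)^2) 1" for j \<delta> y
  proof -
    have \<delta>: "norm \<delta> < 2 * norm (gap n)" using near_zero_small(1)[OF that(1) order.refl gap(1)] .
    then have "norm \<delta> \<le> r" using gap(2) by linarith
    from near[OF n(4) this that(2)] obtain a where
      a: "\<And>x. x \<in> {0..1} \<Longrightarrow> norm (y x - a * of_real (cos (2 * pi * real n * x))) \<le> norm a * (K * (norm \<delta> + 1 / real n))" by blast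
    have "K * (norm \<delta> + 1 / real n) \<le> K * (2 * norm (gap n) + 1 / real n)" using \<delta> K by (intro mult_left_mono) auto
    also have "\<dots> \<le> \<eta>0" using k(1) by (simp add: n_def)
    finally have "norm a * (K * (norm \<delta> + 1 / real n)) \<le> norm a * \<eta>0" by (rule mult_left_mono) simp
    then show ?thesis using a order_trans by blast
  qed
  obtain a1 where a1: "\<And>x. x \<in> {0..1} \<Longrightarrow> norm (e m1 x - a1 * of_real (cos (2 * pi * real n * x))) \<le> norm a1 * \<eta>0"
    using amp[OF z(1)] m1(1) unfolding l1_def by blast
  obtain a2 where a2: "\<And>x. x \<in> {0..1} \<Longrightarrow> norm (e m2 x - a2 * of_real (cos (2 * pi * real n * x))) \<le> norm a2 * \<eta>0"
    using amp[OF z(2)] m2(1) unfolding l2_def by blast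
  have A1: "(norm a1)\<^sup>2 \<le> 8 * R\<^sup>2" using near_cosine_amplitude[OF R(2,3) n(1) _ \<eta>0(2) a1] \<eta>0(1) by simp
  have "a2 \<noteq> 0"
  proof
    assume "a2 = 0"
    then have "e m2 x = 0" if "x \<in> {0..1}" for x using a2[OF that] by simp
    moreover have "e m2 x = 0" if "x \<notin> {0..1}" for x using m2(1) that by (auto simp: T1_graph_def)
    ultimately have "e m2 = 0" by (auto simp: fun_eq_iff)
    then show False using m2 by simp
  qed
  define v where "v = cfun_scale a2 (e m1) + cfun_scale (- a1) (e m2)"
  have "v \<in> L2" unfolding v_def by (rule L2_lincomb[OF R(2) R(2)])
  have "(L2_norm v)\<^sup>2 \<le> (2 * norm a1 * norm a2 * \<eta>0)\<^sup>2"
  proof (rule L2_norm_le_bound[OF \<open>v \<in> L2\<close>])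
    fix x :: real assume x: "x \<in> {0..1}"
    define c where "c = complex_of_real (cos (2 * pi * real n * x))"
    have "v x = a2 * (e m1 x - a1 * c) - a1 * (e m2 x - a2 * c)" by (simp add: v_def cfun_scale_def algebra_simps)
    also have "norm \<dots> \<le> norm a2 * (norm a1 * \<eta>0) + norm a1 * (norm a2 * \<eta>0)"
    proof (rule order_trans[OF norm_triangle_ineq4 add_mono])
      show "norm (a2 * (e m1 x - a1 * c)) \<le> norm a2 * (norm a1 * \<eta>0)"
        unfolding norm_mult c_def by (intro mult_left_mono a1[OF x]) auto
      show "norm (a1 * (e m2 x - a2 * c)) \<le> norm a1 * (norm a2 * \<eta>0)"
        unfolding norm_mult[of a1] c_def by (intro mult_left_mono a2[OF x]) auto
    qed
    finally show "norm (v x) \<le> 2 * norm a1 * norm a2 * \<eta>0" by (simp add: mult_ac)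
  qed
  then have "R\<^sup>2 * (L2_norm v)\<^sup>2 \<le> R\<^sup>2 * (2 * norm a1 * norm a2 * \<eta>0)\<^sup>2" by (rule mult_left_mono) simp
  with Rb[OF \<open>m1 \<noteq> m2\<close>, of a2 "- a1"] have "(norm a2)\<^sup>2 + (norm a1)\<^sup>2 \<le> R\<^sup>2 * (2 * norm a1 * norm a2 * \<eta>0)\<^sup>2"
    unfolding v_def by simp
  also have "\<dots> = (norm a1)\<^sup>2 * (4 * R\<^sup>2 * \<eta>0\<^sup>2 * (norm a2)\<^sup>2)" by (simp add: power_mult_distrib)
  also have "\<dots> \<le> (8 * R\<^sup>2) * (4 * R\<^sup>2 * \<eta>0\<^sup>2 * (norm a2)\<^sup>2)" using A1 by (intro mult_right_mono) auto
  also have "\<dots> = 1 / 2 * (8 * R\<^sup>2 * \<eta>0)\<^sup>2 * (norm a2)\<^sup>2" by (simp add: power2_eq_square)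
  also have "\<dots> \<le> 1 / 2 * 1 * (norm a2)\<^sup>2"
  proof -
    have "8 * R\<^sup>2 * \<eta>0 \<le> 8 * R\<^sup>2 * (1 / (8 * R\<^sup>2))" using \<eta>0 by (intro mult_left_mono) auto
    then have "8 * R\<^sup>2 * \<eta>0 \<le> 1" using R(1) by simp
    then have "(8 * R\<^sup>2 * \<eta>0)\<^sup>2 \<le> 1" using \<eta>0 by (intro power_le_one) auto
    then show ?thesis by (intro mult_right_mono mult_left_mono) auto
  qed
  finally have "(norm a2)\<^sup>2 + (norm a1)\<^sup>2 \<le> 1 / 2 * (norm a2)\<^sup>2" by simp
  moreover have "0 < (norm a2)\<^sup>2" "0 \<le> (norm a1)\<^sup>2" using \<open>a2 \<noteq> 0\<close> by auto
  ultimately show False by linarith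
qed

end

theorem theorem2:
  fixes q :: "real \<Rightarrow> complex" and \<beta> :: complex
  assumes "q absolutely_integrable_on {0..1}"
    and "integral {0..1} q = 0"
    and "\<beta> \<noteq> 1" and "\<beta> \<noteq> -1"
  shows "(sine_coeff_dominates q (\<lambda>n. n) \<longrightarrow>
            (\<exists>lam. T1_eigenvalue_sequences q \<beta> lam \<and>
               (\<exists>N. \<forall>n>N. \<forall>j\<in>{1, 2}. T1_simple_eigenvalue q \<beta> (lam n j)) \<and>
               (\<forall>j\<in>{1, 2}. \<exists>\<epsilon> :: nat \<Rightarrow> complex. \<epsilon> \<longlonglongrightarrow> 0 \<and>
                  (\<forall>\<^sub>F n in sequentially.
                     lam n j = of_real ((2 * pi * real n)\<^sup>2)
                       + (-1) ^ j * (csqrt (2 * gamma1 \<beta>) / 2)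
                           * csqrt (of_nat n * sine_coeff q (2 * n)) * (1 + \<epsilon> n)))))
       \<and> ((\<exists>\<nu> :: nat \<Rightarrow> nat. (\<forall>k. \<nu> k > 0) \<and> filterlim \<nu> at_top sequentially \<and>
              sine_coeff_dominates q \<nu>) \<longrightarrow>
            (\<forall>e. T1_root_functions q \<beta> e \<longrightarrow> \<not> L2_Riesz_basis e))"
proof -
  interpret T1_mean_zero q \<beta> using assms by unfold_locales
  show ?thesis using eigenvalue_asymptotics not_Riesz_basis by blast
qed

end
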